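(* Let $V$ be a complex vector space of dimension $3$ and let $t\ge 2$ be an integer. Then, in the representation ring of $SL(V)=SL_3(\mathbb{C})$, $$\begin{aligned}S^t(S^3)={}&S^{3t}+\mathbb{S}_{4,2}\cdot\bigl(S^{t-2}(S^3)-S^{t-7}(S^3)\bigr)\\&-(\mathbb{S}_{5,4}+\mathbb{S}_{5,1}+\mathbb{S}_{4,2}+\mathbb{S}_{2,1})\cdot\bigl(S^{t-3}(S^3)-S^{t-6}(S^3)\bigr)\\&+(\mathbb{S}_{6,3}+\mathbb{S}_{5,4}+\mathbb{S}_{5,1}+\mathbb{S}_{4,2}+\mathbb{S}_{3,3}+S^3+\mathbb{S}_{2,1})\cdot\bigl(S^{t-4}(S^3)-S^{t-5}(S^3)\bigr)\\&+S^{t-9}(S^3).\end{aligned}$$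
   Context: $S^m$ denotes the $m$-th symmetric power $S^m(V)$, $S^r(S^s)$ denotes $S^r(S^s(V))$, and $\mathbb{S}_{\lambda}$ denotes the Schur functor of the partition $\lambda$ applied to $V$. The product $\cdot$ denotes the tensor product of representations, and $+$, $-$ denote sum and difference in the representation (Grothendieck) ring. By convention $S^\ell(\ldots)=0$ for $\ell<0$. *)

theory Defs
  imports
    "HOL-Analysis.Analysis"
    "HOL-Combinatorics.Permutations"
    "HOL-Library.Multiset"
    "HOL-Library.Function_Algebras"
begin

section \<open>Finite-dimensional representations of the special linear group\<close>

definition SL3 :: "(complex^3^3) set" where
  "SL3 = {g. det g = 1}"

text \<open>Regular functions on the space of matrices; \<^const>\<open>SL3\<close> is closed in it, so the regular
  functions on \<^const>\<open>SL3\<close> are exactly their restrictions.\<close>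

inductive regular :: "(complex^3^3 \<Rightarrow> complex) \<Rightarrow> bool" where
  const: "regular (\<lambda>g. c)"
| entry: "regular (\<lambda>g. g $ i $ j)"
| add: "regular p \<Longrightarrow> regular q \<Longrightarrow> regular (\<lambda>g. p g + q g)"
| mult: "regular p \<Longrightarrow> regular q \<Longrightarrow> regular (\<lambda>g. p g * q g)"

definition regular_on_SL3 :: "(complex^3^3 \<Rightarrow> complex) \<Rightarrow> bool" where
  "regular_on_SL3 f \<longleftrightarrow> (\<exists>p. regular p \<and> (\<forall>g\<in>SL3. f g = p g))"

text \<open>A rational representation on the space with basis \<open>(e\<^sub>i)\<^bsub>i\<in>I\<^esub>\<close>, given by its matrix
  coefficients: \<open>g e\<^sub>j = (\<Sum>i\<in>I. M g i j e\<^sub>i)\<close> for \<open>g \<in> SL3\<close>. Values of \<open>M\<close> outside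
  \<^const>\<open>SL3\<close> and outside \<open>I \<times> I\<close> carry no information.\<close>

definition is_rep :: "'i set \<Rightarrow> (complex^3^3 \<Rightarrow> 'i \<Rightarrow> 'i \<Rightarrow> complex) \<Rightarrow> bool" where
  "is_rep I M \<longleftrightarrow> finite I
     \<and> (\<forall>i\<in>I. \<forall>j\<in>I. M (mat 1) i j = (if i = j then 1 else 0))
     \<and> (\<forall>g\<in>SL3. \<forall>h\<in>SL3. \<forall>i\<in>I. \<forall>k\<in>I. M (g ** h) i k = (\<Sum>j\<in>I. M g i j * M h j k))
     \<and> (\<forall>i\<in>I. \<forall>j\<in>I. regular_on_SL3 (\<lambda>g. M g i j))"

typedef 'i rep = "{(I :: 'i set, M). is_rep I M}"
  by (rule exI[of _ "({}, \<lambda>_ _ _. 0)"]) (simp add: is_rep_def)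

setup_lifting type_definition_rep

lift_definition idx :: "'i rep \<Rightarrow> 'i set" is fst .
lift_definition mtx :: "'i rep \<Rightarrow> complex^3^3 \<Rightarrow> 'i \<Rightarrow> 'i \<Rightarrow> complex" is snd .

lemma SL3_one [simp]: "mat 1 \<in> SL3"
  by (simp add: SL3_def)

lemma SL3_mult [simp]: "g \<in> SL3 \<Longrightarrow> h \<in> SL3 \<Longrightarrow> g ** h \<in> SL3"
  by (simp add: SL3_def det_mul)

lemma is_rep_idx_mtx: "is_rep (idx r) (mtx r)"
  by transfer auto

lemma finite_idx [simp]: "finite (idx r)"
  using is_rep_idx_mtx[of r] by (simp add: is_rep_def)

lemma regular_sum: "(\<And>x. x \<in> A \<Longrightarrow> regular (f x)) \<Longrightarrow> regular (\<lambda>g. \<Sum>x\<in>A. f x g)"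
  by (induction A rule: infinite_finite_induct) (auto intro: regular.intros)

lemma regular_prod: "(\<And>x. x \<in> A \<Longrightarrow> regular (f x)) \<Longrightarrow> regular (\<lambda>g. \<Prod>x\<in>A. f x g)"
  by (induction A rule: infinite_finite_induct) (auto intro: regular.intros)

lemma regular_on_const: "regular_on_SL3 (\<lambda>g. c)"
  unfolding regular_on_SL3_def by (auto intro: regular.const)

lemma regular_on_mult:
  "regular_on_SL3 f \<Longrightarrow> regular_on_SL3 f' \<Longrightarrow> regular_on_SL3 (\<lambda>g. f g * f' g)"
  unfolding regular_on_SL3_def by (metis (mono_tags, lifting) regular.mult)

lemma regular_on_sum:
  assumes "\<And>x. x \<in> A \<Longrightarrow> regular_on_SL3 (f x)"
  shows "regular_on_SL3 (\<lambda>g. \<Sum>x\<in>A. f x g)"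
proof -
  obtain p where p: "\<And>x. x \<in> A \<Longrightarrow> regular (p x) \<and> (\<forall>g\<in>SL3. f x g = p x g)"
    using assms unfolding regular_on_SL3_def by metis
  then show ?thesis unfolding regular_on_SL3_def
    by (intro exI[of _ "\<lambda>g. \<Sum>x\<in>A. p x g"]) (auto intro!: regular_sum)
qed

lemma regular_on_prod:
  assumes "\<And>x. x \<in> A \<Longrightarrow> regular_on_SL3 (f x)"
  shows "regular_on_SL3 (\<lambda>g. \<Prod>x\<in>A. f x g)"
proof -
  obtain p where p: "\<And>x. x \<in> A \<Longrightarrow> regular (p x) \<and> (\<forall>g\<in>SL3. f x g = p x g)"
    using assms unfolding regular_on_SL3_def by metis
  then show ?thesis unfolding regular_on_SL3_def
    by (intro exI[of _ "\<lambda>g. \<Prod>x\<in>A. p x g"]) (auto intro!: regular_prod)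
qed

subsection \<open>Isomorphism, direct sum and tensor product\<close>

text \<open>\<open>P\<close> and \<open>Q\<close> are the matrices of mutually inverse equivariant linear maps.\<close>

definition rep_iso :: "'i rep \<Rightarrow> 'j rep \<Rightarrow> bool" (infix "\<cong>\<^sub>r" 50) where
  "r \<cong>\<^sub>r s \<longleftrightarrow> (\<exists>P Q.
     (\<forall>i\<in>idx r. \<forall>k\<in>idx r. (\<Sum>j\<in>idx s. P i j * Q j k) = (if i = k then 1 else 0)) \<and>
     (\<forall>j\<in>idx s. \<forall>l\<in>idx s. (\<Sum>i\<in>idx r. Q j i * P i l) = (if j = l then 1 else 0)) \<and>
     (\<forall>g\<in>SL3. \<forall>i\<in>idx r. \<forall>l\<in>idx s.
        (\<Sum>k\<in>idx r. mtx r g i k * P k l) = (\<Sum>j\<in>idx s. P i j * mtx s g j l)))"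

lift_definition zero_rep :: "nat rep" is "({}, \<lambda>_ _ _. 0)"
  by (simp add: is_rep_def)

lift_definition triv_rep :: "nat rep" is "({0}, \<lambda>_ _ _. 1)"
  by (simp add: is_rep_def regular_on_const)

lift_definition std_rep :: "3 rep" is "(UNIV, \<lambda>g i j. g $ i $ j)"
  unfolding is_rep_def regular_on_SL3_def
  by (auto simp: mat_def matrix_matrix_mult_def intro!: exI[of _ "\<lambda>g. g $ _ $ _"] regular.entry)

definition dsum_mtx ::
    "('g \<Rightarrow> 'i \<Rightarrow> 'k \<Rightarrow> complex) \<Rightarrow> ('g \<Rightarrow> 'j \<Rightarrow> 'l \<Rightarrow> complex) \<Rightarrow> 'g \<Rightarrow> 'i + 'j \<Rightarrow> 'k + 'l \<Rightarrow> complex" where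
  "dsum_mtx M N g x y = (case x of
      Inl i \<Rightarrow> (case y of Inl i' \<Rightarrow> M g i i' | Inr _ \<Rightarrow> 0)
    | Inr j \<Rightarrow> (case y of Inl _ \<Rightarrow> 0 | Inr j' \<Rightarrow> N g j j'))"

lemma dsum_mtx_simps [simp]:
  "dsum_mtx M N g (Inl i) (Inl i') = M g i i'"
  "dsum_mtx M N g (Inl i) (Inr j') = 0"
  "dsum_mtx M N g (Inr j) (Inl i') = 0"
  "dsum_mtx M N g (Inr j) (Inr j') = N g j j'"
  by (simp_all add: dsum_mtx_def)

lift_definition dsum_rep :: "'i rep \<Rightarrow> 'j rep \<Rightarrow> ('i + 'j) rep" (infixl "\<oplus>\<^sub>r" 65) is
  "\<lambda>(I, M) (J, N). (I <+> J, dsum_mtx M N)"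
proof (clarify)
  fix I :: "'i set" and M and J :: "'j set" and N
  assume *: "is_rep I M" "is_rep J N"
  show "is_rep (I <+> J) (dsum_mtx M N)"
    unfolding is_rep_def
  proof (intro conjI ballI)
    fix x y assume "x \<in> I <+> J" "y \<in> I <+> J"
    with * show "dsum_mtx M N (mat 1) x y = (if x = y then 1 else 0)"
      by (elim PlusE) (simp_all add: is_rep_def)
    from * \<open>x \<in> I <+> J\<close> \<open>y \<in> I <+> J\<close> show "regular_on_SL3 (\<lambda>g. dsum_mtx M N g x y)"
      by (elim PlusE) (simp_all add: is_rep_def regular_on_const)
    fix g h assume "g \<in> SL3" "h \<in> SL3"
    with * \<open>x \<in> I <+> J\<close> \<open>y \<in> I <+> J\<close>
    show "dsum_mtx M N (g ** h) x y = (\<Sum>z\<in>I <+> J. dsum_mtx M N g x z * dsum_mtx M N h z y)"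
      by (elim PlusE) (simp_all add: is_rep_def sum.Plus)
  qed (use * in \<open>simp add: is_rep_def\<close>)
qed

lift_definition tensor_rep :: "'i rep \<Rightarrow> 'j rep \<Rightarrow> ('i \<times> 'j) rep" (infixl "\<otimes>\<^sub>r" 70) is
  "\<lambda>(I, M) (J, N). (I \<times> J, \<lambda>g x y. M g (fst x) (fst y) * N g (snd x) (snd y))"
proof (clarify)
  fix I :: "'i set" and M and J :: "'j set" and N
  assume "is_rep I M" "is_rep J N"
  moreover have "(\<Sum>z\<in>I \<times> J. M g i (fst z) * N g j (snd z) * (M h (fst z) k * N h (snd z) l)) =
     (\<Sum>i'\<in>I. M g i i' * M h i' k) * (\<Sum>j'\<in>J. N g j j' * N h j' l)" for g h i j k l
    by (simp add: sum_product sum.cartesian_product case_prod_unfold mult_ac)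
  ultimately show "is_rep (I \<times> J) (\<lambda>g x y. M g (fst x) (fst y) * N g (snd x) (snd y))"
    by (auto simp: is_rep_def intro!: regular_on_mult)
qed

lemma idx_simps [simp]:
  "idx zero_rep = {}" "idx triv_rep = {0}" "idx std_rep = UNIV"
  "idx (r \<oplus>\<^sub>r s) = idx r <+> idx s" "idx (r \<otimes>\<^sub>r s) = idx r \<times> idx s"
  by (transfer; auto)+

lemma mtx_simps [simp]:
  "mtx triv_rep g a b = 1"
  "mtx std_rep g p q = g $ p $ q"
  "mtx (r \<oplus>\<^sub>r s) g (Inl i) (Inl i') = mtx r g i i'"
  "mtx (r \<oplus>\<^sub>r s) g (Inr j) (Inr j') = mtx s g j j'"
  "mtx (r \<oplus>\<^sub>r s) g (Inl i) (Inr j') = 0"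
  "mtx (r \<oplus>\<^sub>r s) g (Inr j) (Inl i') = 0"
  "mtx (r \<otimes>\<^sub>r s) g (i, j) (i', j') = mtx r g i i' * mtx s g j j'"
  by (transfer; auto)+

lemma mtx_tensor: "mtx (r \<otimes>\<^sub>r s) g x y = mtx r g (fst x) (fst y) * mtx s g (snd x) (snd y)"
  by (cases x; cases y) simp

text \<open>The same representation with its basis indexed by an initial segment of the naturals.\<close>

definition enum_set :: "'i set \<Rightarrow> nat \<Rightarrow> 'i" where
  "enum_set I = (SOME e. bij_betw e {0..<card I} I)"

lemma bij_betw_enum_set: "finite I \<Longrightarrow> bij_betw (enum_set I) {0..<card I} I"
  unfolding enum_set_def by (rule someI_ex[OF ex_bij_betw_nat_finite])

lift_definition nat_rep :: "'i rep \<Rightarrow> nat rep" is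
  "\<lambda>(I, M). ({0..<card I}, \<lambda>g a b. M g (enum_set I a) (enum_set I b))"
proof (clarify)
  fix I :: "'i set" and M assume *: "is_rep I M"
  then have b: "bij_betw (enum_set I) {0..<card I} I"
    by (simp add: is_rep_def bij_betw_enum_set)
  have "enum_set I a \<in> I" if "a < card I" for a
    using bij_betwE[OF b] that by auto
  moreover have "enum_set I a = enum_set I b \<longleftrightarrow> a = b" if "a < card I" "b < card I" for a b
    using bij_betw_imp_inj_on[OF b] that by (auto simp: inj_on_def)
  ultimately show "is_rep {0..<card I} (\<lambda>g a b. M g (enum_set I a) (enum_set I b))"
    using * sum.reindex_bij_betw[OF b, of "\<lambda>j. M _ _ j * M _ j _"] by (simp add: is_rep_def)
qed

lemma delta_mult:
  "(if b then y else 0) * (x::complex) = (if b then y * x else 0)"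
  "(x::complex) * (if b then y else 0) = (if b then x * y else 0)"
  by simp_all

lemma rep_iso_bij:
  assumes f: "bij_betw f (idx r) (idx s)"
    and m: "\<And>g i k. g \<in> SL3 \<Longrightarrow> i \<in> idx r \<Longrightarrow> k \<in> idx r \<Longrightarrow> mtx s g (f i) (f k) = mtx r g i k"
  shows "r \<cong>\<^sub>r s"
proof -
  have inj: "f i = f k \<longleftrightarrow> i = k" if "i \<in> idx r" "k \<in> idx r" for i k
    using bij_betw_imp_inj_on[OF f] that by (auto simp: inj_on_def)
  have im: "f i \<in> idx s" if "i \<in> idx r" for i
    using bij_betwE[OF f] that by auto
  have sur: "\<exists>i\<in>idx r. j = f i" if "j \<in> idx s" for j
    using bij_betw_imp_surj_on[OF f] that by auto
  show ?thesis unfolding rep_iso_def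
  proof (intro exI conjI ballI)
    fix i k assume "i \<in> idx r" "k \<in> idx r"
    then show "(\<Sum>j\<in>idx s. (if j = f i then 1 else 0) * (if j = f k then 1 else 0))
        = (if i = k then 1 else (0::complex))"
      using im inj by (simp add: delta_mult)
  next
    fix j l assume "j \<in> idx s" "l \<in> idx s"
    then obtain i k where [simp]: "j = f i" "l = f k" "i \<in> idx r" "k \<in> idx r"
      using sur by metis
    have "(\<Sum>m\<in>idx r. (if j = f m then 1 else 0) * (if l = f m then 1 else (0::complex)))
       = (\<Sum>m\<in>idx r. if m = i then (if k = m then 1 else 0) else 0)"
      by (intro sum.cong) (simp_all add: delta_mult inj)
    then show "(\<Sum>m\<in>idx r. (if j = f m then 1 else 0) * (if l = f m then 1 else 0))
        = (if j = l then 1 else (0::complex))"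
      by (simp add: inj eq_commute)
  next
    fix g i l assume g: "g \<in> SL3" and i: "i \<in> idx r" and "l \<in> idx s"
    then obtain k where k [simp]: "l = f k" "k \<in> idx r" using sur by metis
    have "(\<Sum>m\<in>idx r. mtx r g i m * (if l = f m then 1 else 0)) =
        (\<Sum>m\<in>idx r. if m = k then mtx r g i m else 0)"
      by (intro sum.cong) (simp_all add: delta_mult inj eq_commute)
    moreover have "(\<Sum>j\<in>idx s. (if j = f i then 1 else 0) * mtx s g j l) =
        (\<Sum>j\<in>idx s. if j = f i then mtx s g j l else 0)"
      by (intro sum.cong) (simp_all add: delta_mult)
    ultimately show "(\<Sum>m\<in>idx r. mtx r g i m * (if l = f m then 1 else 0)) =
       (\<Sum>j\<in>idx s. (if j = f i then 1 else 0) * mtx s g j l)"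
      using i im g m by simp
  qed
qed

lemma rep_iso_refl: "r \<cong>\<^sub>r r"
  by (rule rep_iso_bij[of id]) auto

lemma nat_rep_iso: "nat_rep r \<cong>\<^sub>r r"
proof (rule rep_iso_bij)
  show "bij_betw (enum_set (idx r)) (idx (nat_rep r)) (idx r)"
    by (transfer) (auto simp: is_rep_def bij_betw_enum_set)
qed (transfer, auto)

lemma rep_iso_sym: assumes "r \<cong>\<^sub>r s" shows "s \<cong>\<^sub>r r"
proof -
  obtain P Q where
    PQ: "\<And>i k. i \<in> idx r \<Longrightarrow> k \<in> idx r \<Longrightarrow> (\<Sum>j\<in>idx s. P i j * Q j k) = (if i = k then 1 else 0)"
    and QP: "\<And>j l. j \<in> idx s \<Longrightarrow> l \<in> idx s \<Longrightarrow> (\<Sum>i\<in>idx r. Q j i * P i l) = (if j = l then 1 else 0)"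
    and eq: "\<And>g i l. g \<in> SL3 \<Longrightarrow> i \<in> idx r \<Longrightarrow> l \<in> idx s \<Longrightarrow>
        (\<Sum>k\<in>idx r. mtx r g i k * P k l) = (\<Sum>j\<in>idx s. P i j * mtx s g j l)"
    using assms unfolding rep_iso_def by blast
  have "(\<Sum>l\<in>idx s. mtx s g j l * Q l k) = (\<Sum>i\<in>idx r. Q j i * mtx r g i k)"
    if g: "g \<in> SL3" and j: "j \<in> idx s" and k: "k \<in> idx r" for g j k
  proof -
    have "(\<Sum>i\<in>idx r. Q j i * mtx r g i k)
        = (\<Sum>i\<in>idx r. \<Sum>m\<in>idx r. Q j i * mtx r g i m * (if m = k then 1 else 0))"
      by (intro sum.cong refl) (simp add: k delta_mult)
    also have "\<dots> = (\<Sum>i\<in>idx r. \<Sum>m\<in>idx r. \<Sum>l\<in>idx s. Q j i * mtx r g i m * P m l * Q l k)"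
      by (intro sum.cong refl) (simp add: PQ[symmetric] k sum_distrib_left mult.assoc)
    also have "\<dots> = (\<Sum>i\<in>idx r. \<Sum>l\<in>idx s. Q j i * (\<Sum>m\<in>idx r. mtx r g i m * P m l) * Q l k)"
      by (subst sum.swap) (simp add: sum_distrib_left sum_distrib_right mult.assoc)
    also have "\<dots> = (\<Sum>i\<in>idx r. \<Sum>l\<in>idx s. \<Sum>n\<in>idx s. Q j i * P i n * mtx s g n l * Q l k)"
      by (intro sum.cong refl) (simp add: eq g sum_distrib_left sum_distrib_right mult.assoc)
    also have "\<dots> = (\<Sum>l\<in>idx s. \<Sum>n\<in>idx s. (\<Sum>i\<in>idx r. Q j i * P i n) * mtx s g n l * Q l k)"
      by (subst sum.swap, rule sum.cong[OF refl], subst sum.swap)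
         (simp add: sum_distrib_right)
    also have "\<dots> = (\<Sum>l\<in>idx s. \<Sum>n\<in>idx s. if j = n then mtx s g n l * Q l k else 0)"
      by (intro sum.cong refl) (simp add: QP j delta_mult)
    also have "\<dots> = (\<Sum>l\<in>idx s. mtx s g j l * Q l k)"
      by (simp add: j)
    finally show ?thesis by simp
  qed
  then show ?thesis unfolding rep_iso_def using PQ QP by blast
qed

lemma rep_iso_trans: assumes "r \<cong>\<^sub>r s" "s \<cong>\<^sub>r t" shows "r \<cong>\<^sub>r t"
proof -
  obtain P Q where
    PQ: "\<And>i k. i \<in> idx r \<Longrightarrow> k \<in> idx r \<Longrightarrow> (\<Sum>j\<in>idx s. P i j * Q j k) = (if i = k then 1 else 0)"
    and QP: "\<And>j l. j \<in> idx s \<Longrightarrow> l \<in> idx s \<Longrightarrow> (\<Sum>i\<in>idx r. Q j i * P i l) = (if j = l then 1 else 0)"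
    and eq: "\<And>g i l. g \<in> SL3 \<Longrightarrow> i \<in> idx r \<Longrightarrow> l \<in> idx s \<Longrightarrow>
        (\<Sum>k\<in>idx r. mtx r g i k * P k l) = (\<Sum>j\<in>idx s. P i j * mtx s g j l)"
    using assms(1) unfolding rep_iso_def by blast
  obtain P' Q' where
    PQ': "\<And>i k. i \<in> idx s \<Longrightarrow> k \<in> idx s \<Longrightarrow> (\<Sum>j\<in>idx t. P' i j * Q' j k) = (if i = k then 1 else 0)"
    and QP': "\<And>j l. j \<in> idx t \<Longrightarrow> l \<in> idx t \<Longrightarrow> (\<Sum>i\<in>idx s. Q' j i * P' i l) = (if j = l then 1 else 0)"
    and eq': "\<And>g i l. g \<in> SL3 \<Longrightarrow> i \<in> idx s \<Longrightarrow> l \<in> idx t \<Longrightarrow>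
        (\<Sum>k\<in>idx s. mtx s g i k * P' k l) = (\<Sum>j\<in>idx t. P' i j * mtx t g j l)"
    using assms(2) unfolding rep_iso_def by blast
  have sandwich: "(\<Sum>j\<in>C. (\<Sum>m\<in>B. A i m * D m j) * (\<Sum>n\<in>B. E j n * F n k)) =
     (\<Sum>m\<in>B. \<Sum>n\<in>B. A i m * (\<Sum>j\<in>C. D m j * E j n) * F n k)"
    for A :: "'x \<Rightarrow> 'b \<Rightarrow> complex" and B and C :: "'d set" and D E and F :: "'b \<Rightarrow> 'y \<Rightarrow> complex" and i k
  proof -
    have "(\<Sum>j\<in>C. (\<Sum>m\<in>B. A i m * D m j) * (\<Sum>n\<in>B. E j n * F n k)) =
       (\<Sum>j\<in>C. \<Sum>m\<in>B. \<Sum>n\<in>B. A i m * D m j * E j n * F n k)"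
      by (simp add: sum_product mult.assoc)
    also have "\<dots> = (\<Sum>m\<in>B. \<Sum>n\<in>B. \<Sum>j\<in>C. A i m * D m j * E j n * F n k)"
      by (subst sum.swap, rule sum.cong[OF refl], subst sum.swap) simp
    finally show ?thesis by (simp add: sum_distrib_left sum_distrib_right mult.assoc)
  qed
  have reassoc: "(\<Sum>k\<in>B. A i k * (\<Sum>m\<in>C. D k m * E m l)) = (\<Sum>m\<in>C. (\<Sum>k\<in>B. A i k * D k m) * E m l)"
    for A :: "'x \<Rightarrow> 'u \<Rightarrow> complex" and B and C :: "'v set" and D and E :: "'v \<Rightarrow> 'y \<Rightarrow> complex" and i l
    by (simp add: sum_distrib_left sum_distrib_right mult.assoc) (rule sum.swap)
  show ?thesis unfolding rep_iso_def
  proof (intro exI conjI ballI)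
    fix i k assume *: "i \<in> idx r" "k \<in> idx r"
    show "(\<Sum>j\<in>idx t. (\<Sum>m\<in>idx s. P i m * P' m j) * (\<Sum>n\<in>idx s. Q' j n * Q n k)) = (if i = k then 1 else 0)"
      unfolding sandwich using * by (simp add: PQ' PQ delta_mult)
  next
    fix i k assume *: "i \<in> idx t" "k \<in> idx t"
    have "(\<Sum>m\<in>idx s. \<Sum>n\<in>idx s. Q' i m * (\<Sum>j\<in>idx r. Q m j * P j n) * P' n k) = (if i = k then 1 else 0)"
      using * by (simp add: QP QP' delta_mult)
    then show "(\<Sum>j\<in>idx r. (\<Sum>m\<in>idx s. Q' i m * Q m j) * (\<Sum>n\<in>idx s. P j n * P' n k)) = (if i = k then 1 else 0)"
      unfolding sandwich .
  next
    fix g i l assume *: "g \<in> SL3" "i \<in> idx r" "l \<in> idx t"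
    have "(\<Sum>k\<in>idx r. mtx r g i k * (\<Sum>m\<in>idx s. P k m * P' m l)) =
       (\<Sum>m\<in>idx s. (\<Sum>j\<in>idx s. P i j * mtx s g j m) * P' m l)"
      unfolding reassoc using * by (simp add: eq)
    also have "\<dots> = (\<Sum>j\<in>idx s. P i j * (\<Sum>m\<in>idx s. mtx s g j m * P' m l))"
      by (simp only: reassoc)
    also have "\<dots> = (\<Sum>j\<in>idx t. (\<Sum>m\<in>idx s. P i m * P' m j) * mtx t g j l)"
      using * by (simp add: eq' reassoc)
    finally show "(\<Sum>k\<in>idx r. mtx r g i k * (\<Sum>m\<in>idx s. P k m * P' m l)) =
       (\<Sum>j\<in>idx t. (\<Sum>m\<in>idx s. P i m * P' m j) * mtx t g j l)" .
  qed
qed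


lemma rep_iso_card: assumes "r \<cong>\<^sub>r s" shows "card (idx r) = card (idx s)"
proof -
  obtain P Q where
    PQ: "\<And>i k. i \<in> idx r \<Longrightarrow> k \<in> idx r \<Longrightarrow> (\<Sum>j\<in>idx s. P i j * Q j k) = (if i = k then 1 else 0)"
    and QP: "\<And>j l. j \<in> idx s \<Longrightarrow> l \<in> idx s \<Longrightarrow> (\<Sum>i\<in>idx r. Q j i * P i l) = (if j = l then 1 else (0::complex))"
    using assms unfolding rep_iso_def by blast
  have "complex_of_nat (card (idx r)) = (\<Sum>i\<in>idx r. \<Sum>j\<in>idx s. P i j * Q j i)"
    by (simp add: PQ)
  also have "\<dots> = (\<Sum>j\<in>idx s. \<Sum>i\<in>idx r. Q j i * P i j)"
    by (subst sum.swap) (simp add: mult.commute)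
  also have "\<dots> = complex_of_nat (card (idx s))"
    by (simp add: QP)
  finally show ?thesis by simp
qed

lemma in_Plus_iff: "Inl a \<in> A <+> B \<longleftrightarrow> a \<in> A" "Inr b \<in> A <+> B \<longleftrightarrow> b \<in> B"
  by auto

lemma dsum_cong_left: assumes "r \<cong>\<^sub>r s" shows "r \<oplus>\<^sub>r t \<cong>\<^sub>r s \<oplus>\<^sub>r t"
proof -
  obtain P Q where
    PQ: "\<And>i k. i \<in> idx r \<Longrightarrow> k \<in> idx r \<Longrightarrow> (\<Sum>j\<in>idx s. P i j * Q j k) = (if i = k then 1 else 0)"
    and QP: "\<And>j l. j \<in> idx s \<Longrightarrow> l \<in> idx s \<Longrightarrow> (\<Sum>i\<in>idx r. Q j i * P i l) = (if j = l then 1 else 0)"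
    and eq: "\<And>g i l. g \<in> SL3 \<Longrightarrow> i \<in> idx r \<Longrightarrow> l \<in> idx s \<Longrightarrow>
        (\<Sum>k\<in>idx r. mtx r g i k * P k l) = (\<Sum>j\<in>idx s. P i j * mtx s g j l)"
    using assms unfolding rep_iso_def by blast
  define D :: "unit \<Rightarrow> 'c \<Rightarrow> 'c \<Rightarrow> complex" where "D = (\<lambda>_ a b. if a = b then 1 else 0)"
  let ?P = "dsum_mtx (\<lambda>_. P) D ()" and ?Q = "dsum_mtx (\<lambda>_. Q) D ()"
  show ?thesis unfolding rep_iso_def
  proof (intro exI[of _ ?P] exI[of _ ?Q] conjI ballI)
    fix x y assume "x \<in> idx (r \<oplus>\<^sub>r t)" "y \<in> idx (r \<oplus>\<^sub>r t)"
    then show "(\<Sum>j\<in>idx (s \<oplus>\<^sub>r t). ?P x j * ?Q j y) = (if x = y then 1 else 0)"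
      by (cases x; cases y; simp_all add: in_Plus_iff sum.Plus PQ D_def delta_mult)
  next
    fix x y assume "x \<in> idx (s \<oplus>\<^sub>r t)" "y \<in> idx (s \<oplus>\<^sub>r t)"
    then show "(\<Sum>j\<in>idx (r \<oplus>\<^sub>r t). ?Q x j * ?P j y) = (if x = y then 1 else 0)"
      by (cases x; cases y; simp_all add: in_Plus_iff sum.Plus QP D_def delta_mult)
  next
    fix g x y assume "g \<in> SL3" "x \<in> idx (r \<oplus>\<^sub>r t)" "y \<in> idx (s \<oplus>\<^sub>r t)"
    then show "(\<Sum>k\<in>idx (r \<oplus>\<^sub>r t). mtx (r \<oplus>\<^sub>r t) g x k * ?P k y) =
        (\<Sum>j\<in>idx (s \<oplus>\<^sub>r t). ?P x j * mtx (s \<oplus>\<^sub>r t) g j y)"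
      by (auto simp: sum.Plus eq D_def delta_mult)
  qed
qed

lemma sum_Times_prod:
  fixes f h :: "'a \<Rightarrow> complex" and u v :: "'b \<Rightarrow> complex"
  shows "(\<Sum>z\<in>A \<times> B. f (fst z) * u (snd z) * (h (fst z) * v (snd z))) =
    (\<Sum>a\<in>A. f a * h a) * (\<Sum>b\<in>B. u b * v b)"
  by (simp add: sum_product sum.cartesian_product case_prod_unfold mult_ac)

lemma tensor_cong_left: assumes "r \<cong>\<^sub>r s" shows "r \<otimes>\<^sub>r t \<cong>\<^sub>r s \<otimes>\<^sub>r t"
proof -
  obtain P Q where
    PQ: "\<And>i k. i \<in> idx r \<Longrightarrow> k \<in> idx r \<Longrightarrow> (\<Sum>j\<in>idx s. P i j * Q j k) = (if i = k then 1 else 0)"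
    and QP: "\<And>j l. j \<in> idx s \<Longrightarrow> l \<in> idx s \<Longrightarrow> (\<Sum>i\<in>idx r. Q j i * P i l) = (if j = l then 1 else 0)"
    and eq: "\<And>g i l. g \<in> SL3 \<Longrightarrow> i \<in> idx r \<Longrightarrow> l \<in> idx s \<Longrightarrow>
        (\<Sum>k\<in>idx r. mtx r g i k * P k l) = (\<Sum>j\<in>idx s. P i j * mtx s g j l)"
    using assms unfolding rep_iso_def by blast
  let ?E = "\<lambda>P a b. P (fst a) (fst b) * (if snd a = snd b then 1 else (0::complex))"
  show ?thesis unfolding rep_iso_def
  proof (intro exI[of _ "?E P"] exI[of _ "?E Q"] conjI ballI)
    fix x y assume *: "x \<in> idx (r \<otimes>\<^sub>r t)" "y \<in> idx (r \<otimes>\<^sub>r t)"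
    have "(\<Sum>j\<in>idx (s \<otimes>\<^sub>r t). ?E P x j * ?E Q j y) =
      (\<Sum>a\<in>idx s. P (fst x) a * Q a (fst y)) *
      (\<Sum>b\<in>idx t. (if snd x = b then 1 else 0) * (if b = snd y then 1 else 0))"
      unfolding idx_simps
      by (rule sum_Times_prod[where f = "P (fst x)" and h = "\<lambda>a. Q a (fst y)"
            and u = "\<lambda>b. if snd x = b then 1 else 0" and v = "\<lambda>b. if b = snd y then 1 else 0"])
    with * show "(\<Sum>j\<in>idx (s \<otimes>\<^sub>r t). ?E P x j * ?E Q j y) = (if x = y then 1 else 0)"
      by (auto simp: PQ delta_mult prod_eq_iff mem_Times_iff simp del: fst_conv snd_conv)
  next
    fix x y assume *: "x \<in> idx (s \<otimes>\<^sub>r t)" "y \<in> idx (s \<otimes>\<^sub>r t)"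
    have "(\<Sum>j\<in>idx (r \<otimes>\<^sub>r t). ?E Q x j * ?E P j y) =
      (\<Sum>a\<in>idx r. Q (fst x) a * P a (fst y)) *
      (\<Sum>b\<in>idx t. (if snd x = b then 1 else 0) * (if b = snd y then 1 else 0))"
      unfolding idx_simps
      by (rule sum_Times_prod[where f = "Q (fst x)" and h = "\<lambda>a. P a (fst y)"
            and u = "\<lambda>b. if snd x = b then 1 else 0" and v = "\<lambda>b. if b = snd y then 1 else 0"])
    with * show "(\<Sum>j\<in>idx (r \<otimes>\<^sub>r t). ?E Q x j * ?E P j y) = (if x = y then 1 else 0)"
      by (auto simp: QP delta_mult prod_eq_iff mem_Times_iff simp del: fst_conv snd_conv)
  next
    fix g x y assume *: "g \<in> SL3" "x \<in> idx (r \<otimes>\<^sub>r t)" "y \<in> idx (s \<otimes>\<^sub>r t)"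
    have "(\<Sum>k\<in>idx (r \<otimes>\<^sub>r t). mtx (r \<otimes>\<^sub>r t) g x k * ?E P k y) =
      (\<Sum>a\<in>idx r. mtx r g (fst x) a * P a (fst y)) *
      (\<Sum>b\<in>idx t. mtx t g (snd x) b * (if b = snd y then 1 else 0))"
      unfolding idx_simps mtx_tensor
      by (rule sum_Times_prod[where f = "mtx r g (fst x)" and h = "\<lambda>a. P a (fst y)"
            and u = "mtx t g (snd x)" and v = "\<lambda>b. if b = snd y then 1 else 0"])
    moreover have "(\<Sum>k\<in>idx (s \<otimes>\<^sub>r t). ?E P x k * mtx (s \<otimes>\<^sub>r t) g k y) =
      (\<Sum>a\<in>idx s. P (fst x) a * mtx s g a (fst y)) *
      (\<Sum>b\<in>idx t. (if snd x = b then 1 else 0) * mtx t g b (snd y))"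
      unfolding idx_simps mtx_tensor
      by (rule sum_Times_prod[where f = "P (fst x)" and h = "\<lambda>a. mtx s g a (fst y)"
            and u = "\<lambda>b. if snd x = b then 1 else 0" and v = "\<lambda>b. mtx t g b (snd y)"])
    ultimately show "(\<Sum>k\<in>idx (r \<otimes>\<^sub>r t). mtx (r \<otimes>\<^sub>r t) g x k * ?E P k y) =
        (\<Sum>j\<in>idx (s \<otimes>\<^sub>r t). ?E P x j * mtx (s \<otimes>\<^sub>r t) g j y)"
      using * by (auto simp: eq delta_mult mem_Times_iff)
  qed
qed

lemma dsum_comm: "r \<oplus>\<^sub>r s \<cong>\<^sub>r s \<oplus>\<^sub>r r"
  by (rule rep_iso_bij[of "case_sum Inr Inl"])
     (auto intro!: bij_betwI[where g = "case_sum Inr Inl"] split: sum.splits)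

lemma dsum_assoc: "(r \<oplus>\<^sub>r s) \<oplus>\<^sub>r t \<cong>\<^sub>r r \<oplus>\<^sub>r (s \<oplus>\<^sub>r t)"
  by (rule rep_iso_bij[of "case_sum (case_sum Inl (Inr \<circ> Inl)) (Inr \<circ> Inr)"])
     (auto intro!: bij_betwI[where g = "case_sum (Inl \<circ> Inl) (case_sum (Inl \<circ> Inr) Inr)"])

lemma dsum_zero: "zero_rep \<oplus>\<^sub>r r \<cong>\<^sub>r r"
  by (rule rep_iso_bij[of "case_sum undefined id"])
     (auto intro!: bij_betwI[where g = Inr])

lemma tensor_comm: "r \<otimes>\<^sub>r s \<cong>\<^sub>r s \<otimes>\<^sub>r r"
  by (rule rep_iso_bij[of prod.swap])
     (auto intro!: bij_betwI[where g = prod.swap])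

lemma tensor_assoc: "(r \<otimes>\<^sub>r s) \<otimes>\<^sub>r t \<cong>\<^sub>r r \<otimes>\<^sub>r (s \<otimes>\<^sub>r t)"
  by (rule rep_iso_bij[of "\<lambda>((a, b), c). (a, (b, c))"])
     (auto intro!: bij_betwI[where g = "\<lambda>(a, (b, c)). ((a, b), c)"])

lemma tensor_triv: "triv_rep \<otimes>\<^sub>r r \<cong>\<^sub>r r"
  by (rule rep_iso_bij[of snd])
     (auto intro!: bij_betwI[where g = "\<lambda>a. (0, a)"])

lemma tensor_zero: "zero_rep \<otimes>\<^sub>r r \<cong>\<^sub>r zero_rep"
  by (rule rep_iso_bij[of fst]) (auto simp: bij_betw_def)

lemma tensor_dsum: "(r \<oplus>\<^sub>r s) \<otimes>\<^sub>r t \<cong>\<^sub>r (r \<otimes>\<^sub>r t) \<oplus>\<^sub>r (s \<otimes>\<^sub>r t)"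
  by (rule rep_iso_bij[of "\<lambda>(x, c). case x of Inl a \<Rightarrow> Inl (a, c) | Inr b \<Rightarrow> Inr (b, c)"])
     (auto intro!: bij_betwI[where g = "case_sum (\<lambda>(a, c). (Inl a, c)) (\<lambda>(b, c). (Inr b, c))"])

lemma dsum_cong: "r \<cong>\<^sub>r r' \<Longrightarrow> s \<cong>\<^sub>r s' \<Longrightarrow> r \<oplus>\<^sub>r s \<cong>\<^sub>r r' \<oplus>\<^sub>r s'"
  by (rule rep_iso_trans[OF dsum_cong_left rep_iso_trans[OF dsum_comm
        rep_iso_trans[OF dsum_cong_left dsum_comm]]])

lemma tensor_cong: "r \<cong>\<^sub>r r' \<Longrightarrow> s \<cong>\<^sub>r s' \<Longrightarrow> r \<otimes>\<^sub>r s \<cong>\<^sub>r r' \<otimes>\<^sub>r s'"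
  by (rule rep_iso_trans[OF tensor_cong_left rep_iso_trans[OF tensor_comm
        rep_iso_trans[OF tensor_cong_left tensor_comm]]])


section \<open>The representation ring\<close>

text \<open>Isomorphism classes of representations, with direct sum as addition and tensor product as
  multiplication. Every representation is isomorphic to one indexed by naturals.\<close>

quotient_type rep_class = "nat rep" / "rep_iso :: nat rep \<Rightarrow> nat rep \<Rightarrow> bool"
proof (intro equivpI reflpI sympI transpI)
  show "r \<cong>\<^sub>r r" for r :: "nat rep" by (rule rep_iso_refl)
  show "r \<cong>\<^sub>r s \<Longrightarrow> s \<cong>\<^sub>r r" for r s :: "nat rep" by (rule rep_iso_sym)
qed (rule rep_iso_trans)

lemma nat_rep_cong: "r \<cong>\<^sub>r s \<Longrightarrow> nat_rep r \<cong>\<^sub>r nat_rep s"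
  by (rule rep_iso_trans[OF nat_rep_iso rep_iso_trans[OF _ rep_iso_sym[OF nat_rep_iso]]])

lemma nat_rep_iso_left: "nat_rep r \<cong>\<^sub>r s \<longleftrightarrow> r \<cong>\<^sub>r s"
  by (rule iffI) (erule rep_iso_trans[OF rep_iso_sym[OF nat_rep_iso]], erule rep_iso_trans[OF nat_rep_iso])

lemma nat_rep_iso_right: "s \<cong>\<^sub>r nat_rep r \<longleftrightarrow> s \<cong>\<^sub>r r"
  by (rule iffI) (erule rep_iso_trans[OF _ nat_rep_iso], erule rep_iso_trans[OF _ rep_iso_sym[OF nat_rep_iso]])

lemmas nat_rep_iso_iff = nat_rep_iso_left nat_rep_iso_right

definition class_of :: "'i rep \<Rightarrow> rep_class" where
  "class_of r = abs_rep_class (nat_rep r)"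

lemma class_of_eq_iff: "class_of r = class_of s \<longleftrightarrow> r \<cong>\<^sub>r s"
  by (simp add: class_of_def rep_class.abs_eq_iff nat_rep_iso_iff)

instantiation rep_class :: comm_semiring_1
begin

lift_definition zero_rep_class :: rep_class is zero_rep .
lift_definition one_rep_class :: rep_class is triv_rep .
lift_definition plus_rep_class :: "rep_class \<Rightarrow> rep_class \<Rightarrow> rep_class" is
  "\<lambda>r s. nat_rep (r \<oplus>\<^sub>r s)"
  by (intro nat_rep_cong dsum_cong)
lift_definition times_rep_class :: "rep_class \<Rightarrow> rep_class \<Rightarrow> rep_class" is
  "\<lambda>r s. nat_rep (r \<otimes>\<^sub>r s)"
  by (intro nat_rep_cong tensor_cong)

instance
proof
  have comm: "a * b = b * a" for a b :: rep_class
    by transfer (intro nat_rep_cong tensor_comm)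
  fix a b c :: rep_class
  show "a + b + c = a + (b + c)"
    by transfer (unfold nat_rep_iso_iff, rule rep_iso_trans[OF dsum_cong[OF nat_rep_iso rep_iso_refl]
        rep_iso_trans[OF dsum_assoc dsum_cong[OF rep_iso_refl rep_iso_sym[OF nat_rep_iso]]]])
  show "a + b = b + a"
    by transfer (intro nat_rep_cong dsum_comm)
  show "0 + a = a"
    by transfer (simp add: nat_rep_iso_iff dsum_zero)
  show "a * b * c = a * (b * c)"
    by transfer (unfold nat_rep_iso_iff, rule rep_iso_trans[OF tensor_cong[OF nat_rep_iso rep_iso_refl]
        rep_iso_trans[OF tensor_assoc tensor_cong[OF rep_iso_refl rep_iso_sym[OF nat_rep_iso]]]])
  show "a * b = b * a"
    by (rule comm)
  show "1 * a = a"
    by transfer (simp add: nat_rep_iso_iff tensor_triv)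
  show "0 * a = 0"
    by transfer (simp add: nat_rep_iso_iff tensor_zero)
  then show "a * 0 = 0"
    by (simp add: comm[of a])
  show "(a + b) * c = a * c + b * c"
    by transfer (unfold nat_rep_iso_iff, rule rep_iso_trans[OF tensor_cong[OF nat_rep_iso rep_iso_refl]
        rep_iso_trans[OF tensor_dsum rep_iso_sym[OF dsum_cong[OF nat_rep_iso nat_rep_iso]]]])
  show "(0 :: rep_class) \<noteq> 1"
    by transfer (auto dest: rep_iso_card)
qed

end

lemma class_of_dsum: "class_of (r \<oplus>\<^sub>r s) = class_of r + class_of s"
  by (simp add: class_of_def plus_rep_class.abs_eq rep_class.abs_eq_iff nat_rep_iso_iff)
     (rule rep_iso_sym[OF dsum_cong[OF nat_rep_iso nat_rep_iso]])

lemma class_of_tensor: "class_of (r \<otimes>\<^sub>r s) = class_of r * class_of s"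
  by (simp add: class_of_def times_rep_class.abs_eq rep_class.abs_eq_iff nat_rep_iso_iff)
     (rule rep_iso_sym[OF tensor_cong[OF nat_rep_iso nat_rep_iso]])

lift_definition class_dim :: "rep_class \<Rightarrow> nat" is "\<lambda>r. card (idx r)"
  by (rule rep_iso_card)

lemma idx_nat_rep: "idx (nat_rep r) = {0..<card (idx r)}"
  by transfer auto

lemma class_dim_simps [simp]:
  "class_dim 0 = 0" "class_dim 1 = 1" "class_dim (a + b) = class_dim a + class_dim b"
  by (transfer; simp add: idx_nat_rep card_Plus)+

text \<open>The representation ring: the Grothendieck ring of the semiring of isomorphism classes. As
  the special linear group is linearly reductive, short exact sequences give no further relations.
  A pair stands for a formal difference.\<close>

definition groth_rel :: "rep_class \<times> rep_class \<Rightarrow> rep_class \<times> rep_class \<Rightarrow> bool" where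
  "groth_rel x y \<longleftrightarrow> (\<exists>e. fst x + snd y + e = fst y + snd x + e)"

lemma groth_rel_trans: assumes "groth_rel x y" "groth_rel y z" shows "groth_rel x z"
proof -
  obtain e f where e: "fst x + snd y + e = fst y + snd x + e"
    and f: "fst y + snd z + f = fst z + snd y + f"
    using assms unfolding groth_rel_def by blast
  have "fst x + snd z + (snd y + fst y + e + f) = (fst x + snd y + e) + (fst y + snd z + f)"
    by (simp add: add_ac)
  also have "\<dots> = (fst y + snd x + e) + (fst z + snd y + f)"
    by (simp add: e f)
  also have "\<dots> = fst z + snd x + (snd y + fst y + e + f)"
    by (simp add: add_ac)
  finally show ?thesis unfolding groth_rel_def by blast
qed

quotient_type rep_ring = "rep_class \<times> rep_class" / groth_rel
proof (intro equivpI reflpI sympI transpI)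
  show "groth_rel x x" for x by (simp add: groth_rel_def)
  show "groth_rel x y \<Longrightarrow> groth_rel y x" for x y by (auto simp: groth_rel_def dest: sym)
qed (rule groth_rel_trans)

lemma groth_relI: "fst x + snd y + e = fst y + snd x + e \<Longrightarrow> groth_rel x y"
  by (auto simp: groth_rel_def)

lemma groth_rel_mult_left:
  assumes "groth_rel x y"
  shows "groth_rel (fst x * fst z + snd x * snd z, fst x * snd z + snd x * fst z)
                   (fst y * fst z + snd y * snd z, fst y * snd z + snd y * fst z)"
proof -
  obtain e where e: "fst x + snd y + e = fst y + snd x + e"
    using assms unfolding groth_rel_def by blast
  have "(fst x + snd y + e) * fst z + (fst y + snd x + e) * snd z =
        (fst y + snd x + e) * fst z + (fst x + snd y + e) * snd z"
    by (simp add: e)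
  then show ?thesis
    by (intro groth_relI[where e = "e * fst z + e * snd z"]) (simp add: algebra_simps)
qed

instantiation rep_ring :: comm_ring_1
begin

lift_definition zero_rep_ring :: rep_ring is "(0, 0)" .
lift_definition one_rep_ring :: rep_ring is "(1, 0)" .
lift_definition plus_rep_ring :: "rep_ring \<Rightarrow> rep_ring \<Rightarrow> rep_ring" is
  "\<lambda>x y. (fst x + fst y, snd x + snd y)"
proof -
  fix x x' y y' :: "rep_class \<times> rep_class"
  assume "groth_rel x x'" "groth_rel y y'"
  then obtain e f where "fst x + snd x' + e = fst x' + snd x + e"
    and "fst y + snd y' + f = fst y' + snd y + f"
    unfolding groth_rel_def by blast
  then have "(fst x + snd x' + e) + (fst y + snd y' + f) = (fst x' + snd x + e) + (fst y' + snd y + f)"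
    by simp
  then show "groth_rel (fst x + fst y, snd x + snd y) (fst x' + fst y', snd x' + snd y')"
    by (intro groth_relI[where e = "e + f"]) (simp add: add_ac)
qed
lift_definition uminus_rep_ring :: "rep_ring \<Rightarrow> rep_ring" is "\<lambda>x. (snd x, fst x)"
  by (auto simp: groth_rel_def add_ac dest: sym)
definition minus_rep_ring :: "rep_ring \<Rightarrow> rep_ring \<Rightarrow> rep_ring" where
  "minus_rep_ring x y = x + - y"
lift_definition times_rep_ring :: "rep_ring \<Rightarrow> rep_ring \<Rightarrow> rep_ring" is
  "\<lambda>x y. (fst x * fst y + snd x * snd y, fst x * snd y + snd x * fst y)"
proof -
  fix x x' y y' :: "rep_class \<times> rep_class"
  assume "groth_rel x x'" "groth_rel y y'"
  have "groth_rel (fst x * fst y + snd x * snd y, fst x * snd y + snd x * fst y)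
       (fst x' * fst y + snd x' * snd y, fst x' * snd y + snd x' * fst y)"
    by (rule groth_rel_mult_left) fact
  moreover have "groth_rel (fst x' * fst y + snd x' * snd y, fst x' * snd y + snd x' * fst y)
       (fst x' * fst y' + snd x' * snd y', fst x' * snd y' + snd x' * fst y')"
    using groth_rel_mult_left[OF \<open>groth_rel y y'\<close>, of x'] by (simp add: mult.commute add.commute)
  ultimately show "groth_rel (fst x * fst y + snd x * snd y, fst x * snd y + snd x * fst y)
       (fst x' * fst y' + snd x' * snd y', fst x' * snd y' + snd x' * fst y')"
    by (rule groth_rel_trans)
qed

instance
proof
  fix a b c :: rep_ring
  show "a + b + c = a + (b + c)" "a + b = b + a" "0 + a = a" "- a + a = 0"
    by (transfer; rule groth_relI[where e = 0]; simp add: add_ac)+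
  show "a - b = a + - b" by (simp add: minus_rep_ring_def)
  show "a * b * c = a * (b * c)" "a * b = b * a" "1 * a = a" "(a + b) * c = a * c + b * c"
    by (transfer; rule groth_relI[where e = 0]; simp add: algebra_simps)+
  show "(0 :: rep_ring) \<noteq> 1"
  proof (transfer, rule notI)
    assume "groth_rel (0, 0) (1, 0)"
    then have "\<exists>e :: rep_class. e = 1 + e" by (simp add: groth_rel_def)
    then obtain e :: rep_class where "e = 1 + e" ..
    then have "class_dim e = class_dim (1 + e)" by simp
    then show False by simp
  qed
qed

end

definition rep_ring_of :: "'i rep \<Rightarrow> rep_ring" where
  "rep_ring_of r = abs_rep_ring (class_of r, 0)"

lemma rep_ring_of_iso: "r \<cong>\<^sub>r s \<Longrightarrow> rep_ring_of r = rep_ring_of s"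
  by (simp add: rep_ring_of_def class_of_eq_iff[symmetric])

lemma rep_ring_of_dsum: "rep_ring_of (r \<oplus>\<^sub>r s) = rep_ring_of r + rep_ring_of s"
  by (simp add: rep_ring_of_def class_of_dsum plus_rep_ring.abs_eq)

lemma rep_ring_of_tensor: "rep_ring_of (r \<otimes>\<^sub>r s) = rep_ring_of r * rep_ring_of s"
  by (simp add: rep_ring_of_def class_of_tensor times_rep_ring.abs_eq)

section \<open>Tensor powers, symmetric powers and Schur functors\<close>

definition words :: "nat \<Rightarrow> 'i set \<Rightarrow> 'i list set" where
  "words d I = {xs. length xs = d \<and> set xs \<subseteq> I}"

text \<open>If \<open>K\<close> is the matrix of a linear map, this is the matrix of its tensor power on the basis of
  pure tensors of basis vectors, indexed by words.\<close>

definition pow_entry :: "('i \<Rightarrow> 'i \<Rightarrow> complex) \<Rightarrow> 'i list \<Rightarrow> 'i list \<Rightarrow> complex" where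
  "pow_entry K is js = (\<Prod>k<length is. K (is ! k) (js ! k))"

lemma words_0: "words 0 I = {[]}"
  by (auto simp: words_def)

lemma words_Suc: "words (Suc d) I = (\<lambda>(x, xs). x # xs) ` (I \<times> words d I)"
  by (auto simp: words_def length_Suc_conv image_iff)

lemma sum_words_Suc: "(\<Sum>xs\<in>words (Suc d) I. f xs) = (\<Sum>x\<in>I. \<Sum>xs\<in>words d I. f (x # xs))"
  by (simp add: words_Suc sum.reindex inj_on_def case_prod_unfold sum.cartesian_product o_def)

lemma finite_words: "finite I \<Longrightarrow> finite (words d I)"
  by (induction d) (auto simp: words_0 words_Suc)

lemma pow_entry_Nil [simp]: "pow_entry K [] js = 1"
  by (simp add: pow_entry_def)

lemma pow_entry_Cons [simp]: "pow_entry K (x # xs) (y # ys) = K x y * pow_entry K xs ys"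
  by (simp add: pow_entry_def prod.lessThan_Suc_shift del: prod.lessThan_Suc)

lemma pow_entry_comp:
  assumes "is \<in> words d I" "ks \<in> words d I"
    and "\<And>i k. i \<in> I \<Longrightarrow> k \<in> I \<Longrightarrow> C i k = (\<Sum>j\<in>I. A i j * B j k)"
  shows "pow_entry C is ks = (\<Sum>js\<in>words d I. pow_entry A is js * pow_entry B js ks)"
  using assms(1,2)
proof (induction d arbitrary: "is" ks)
  case 0
  then show ?case by (simp add: words_0)
next
  case (Suc d)
  from Suc.prems obtain x xs y ys where *: "is = x # xs" "ks = y # ys" "x \<in> I" "y \<in> I"
    "xs \<in> words d I" "ys \<in> words d I"
    by (auto simp: words_Suc)
  have "pow_entry C is ks = (\<Sum>j\<in>I. A x j * B j y) * (\<Sum>js\<in>words d I. pow_entry A xs js * pow_entry B js ys)"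
    using * Suc.IH[of xs ys] by (simp add: assms(3))
  also have "\<dots> = (\<Sum>js\<in>words (Suc d) I. pow_entry A is js * pow_entry B js ks)"
    unfolding sum_product sum_words_Suc *(1,2) by (simp only: pow_entry_Cons mult_ac)
  finally show ?case .
qed

lemma pow_entry_one:
  assumes "is \<in> words d I" "ks \<in> words d I"
    and "\<And>i k. i \<in> I \<Longrightarrow> k \<in> I \<Longrightarrow> C i k = (if i = k then 1 else 0)"
  shows "pow_entry C is ks = (if is = ks then 1 else 0)"
  using assms(1,2)
proof (induction d arbitrary: "is" ks)
  case 0
  then show ?case by (simp add: words_0)
next
  case (Suc d)
  from Suc.prems obtain x xs y ys where "is = x # xs" "ks = y # ys" "x \<in> I" "y \<in> I"
    "xs \<in> words d I" "ys \<in> words d I"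
    by (auto simp: words_Suc)
  then show ?case by (simp add: Suc.IH assms(3))
qed

lemma pow_entry_regular:
  assumes "is \<in> words d I" "ks \<in> words d I"
    and "\<And>i k. i \<in> I \<Longrightarrow> k \<in> I \<Longrightarrow> regular_on_SL3 (\<lambda>g. M g i k)"
  shows "regular_on_SL3 (\<lambda>g. pow_entry (M g) is ks)"
proof -
  have "is ! k \<in> I" "ks ! k \<in> I" if "k < length is" for k
    using assms(1,2) nth_mem[OF that] nth_mem[of k ks] that by (auto simp: words_def)
  then show ?thesis
    unfolding pow_entry_def by (intro regular_on_prod assms(3)) auto
qed

lemma pow_entry_permute:
  assumes "p permutes {..<length xs}" "length ys = length xs"
  shows "pow_entry K (permute_list p xs) (permute_list p ys) = pow_entry K xs ys"
  unfolding pow_entry_def length_permute_list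
  by (subst prod.permute[OF assms(1)], intro prod.cong)
     (use assms in \<open>simp_all add: permute_list_nth\<close>)

lemma is_rep_tensor_pow:
  assumes *: "is_rep I M"
  shows "is_rep (words d I) (\<lambda>g. pow_entry (M g))"
proof -
  show ?thesis
    unfolding is_rep_def
  proof (intro conjI ballI)
    show "finite (words d I)" using * by (simp add: is_rep_def finite_words)
    fix xs ys assume **: "xs \<in> words d I" "ys \<in> words d I"
    show "pow_entry (M (mat 1)) xs ys = (if xs = ys then 1 else 0)"
      using * by (intro pow_entry_one[OF **]) (simp add: is_rep_def)
    show "regular_on_SL3 (\<lambda>g. pow_entry (M g) xs ys)"
      using * by (intro pow_entry_regular[OF **]) (simp add: is_rep_def)
    fix g h assume "g \<in> SL3" "h \<in> SL3"
    then show "pow_entry (M (g ** h)) xs ys = (\<Sum>zs\<in>words d I. pow_entry (M g) xs zs * pow_entry (M h) zs ys)"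
      using * by (intro pow_entry_comp[OF **]) (simp add: is_rep_def)
  qed
qed

lift_definition tensor_pow :: "nat \<Rightarrow> 'i rep \<Rightarrow> 'i list rep" is
  "\<lambda>d (I, M). (words d I, \<lambda>g. pow_entry (M g))"
  by (auto simp: is_rep_tensor_pow)

subsection \<open>Symmetric powers\<close>

text \<open>The symmetric power has as basis the monomials in the basis vectors, i.e. multisets of
  indices. As \<open>g (e\<^bsub>j1\<^esub> \<cdots> e\<^bsub>jm\<^esub>) = (g e\<^bsub>j1\<^esub>) \<cdots> (g e\<^bsub>jm\<^esub>)\<close>, the following is the coefficient at the
  monomial \<open>\<alpha>\<close> of the image of the monomial with factors \<open>js\<close>, in any order.\<close>

definition sym_entry :: "('i \<Rightarrow> 'i \<Rightarrow> complex) \<Rightarrow> 'i multiset \<Rightarrow> 'i list \<Rightarrow> complex" where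
  "sym_entry K \<alpha> js = (\<Sum>is | mset is = \<alpha>. pow_entry K is js)"

definition monomials :: "nat \<Rightarrow> 'i set \<Rightarrow> 'i multiset set" where
  "monomials m I = {\<alpha>. size \<alpha> = m \<and> set_mset \<alpha> \<subseteq> I}"

definition some_word :: "'i multiset \<Rightarrow> 'i list" where
  "some_word \<alpha> = (SOME is. mset is = \<alpha>)"

lemma mset_some_word [simp]: "mset (some_word \<alpha>) = \<alpha>"
  unfolding some_word_def by (rule someI_ex[OF ex_mset])

lemma some_word_in_words: "\<alpha> \<in> monomials m I \<Longrightarrow> some_word \<alpha> \<in> words m I"
  unfolding monomials_def words_def by (simp flip: size_mset set_mset_mset)

lemma monomials_eq: "monomials m I = mset ` words m I"
proof (intro equalityI subsetI)
  show "\<alpha> \<in> monomials m I \<Longrightarrow> \<alpha> \<in> mset ` words m I" for \<alpha>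
    using some_word_in_words by (intro image_eqI[where x = "some_word \<alpha>"]) simp_all
qed (auto simp: monomials_def words_def)

lemma sum_words_eq:
  assumes "finite I"
  shows "(\<Sum>xs\<in>words m I. f xs) = (\<Sum>\<alpha>\<in>monomials m I. \<Sum>xs | mset xs = \<alpha>. f xs)"
proof -
  have "{xs. mset xs = \<alpha>} = {xs \<in> words m I. mset xs = \<alpha>}" if "\<alpha> \<in> monomials m I" for \<alpha>
    using that by (auto simp: monomials_def words_def)
  then show ?thesis
    using sum.group[of "words m I" "monomials m I" mset f] assms
    by (simp add: finite_words monomials_eq)
qed

lemma permute_list_inv:
  assumes p: "p permutes {..<d}" and len: "length xs = d"
  shows "permute_list (inv p) (permute_list p xs) = xs" "permute_list p (permute_list (inv p) xs) = xs"
proof -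
  have "permute_list (inv p) (permute_list p xs) = permute_list (p \<circ> inv p) xs"
    by (rule permute_list_compose[symmetric]) (unfold len, rule permutes_inv[OF p])
  then show "permute_list (inv p) (permute_list p xs) = xs"
    by (simp only: permutes_inv_o(1)[OF p] permute_list_id)
  have "permute_list p (permute_list (inv p) xs) = permute_list (inv p \<circ> p) xs"
    by (rule permute_list_compose[symmetric]) (unfold len, rule p)
  then show "permute_list p (permute_list (inv p) xs) = xs"
    by (simp only: permutes_inv_o(2)[OF p] permute_list_id)
qed

lemma sym_entry_perm:
  assumes "mset js = mset js'" "size \<alpha> = length js"
  shows "sym_entry K \<alpha> js = sym_entry K \<alpha> js'"
proof -
  obtain p where p: "p permutes {..<length js'}" "permute_list p js' = js"
    using mset_eq_permutation[OF assms(1)] .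
  have len: "length xs = length js'" if "mset xs = \<alpha>" for xs
    using assms(2) mset_eq_length[OF assms(1)] unfolding that[symmetric] by simp
  have inv: "inv p permutes {..<length js'}"
    using p(1) by (rule permutes_inv)
  note a = permute_list_inv[OF p(1)]
  have "(\<Sum>is | mset is = \<alpha>. pow_entry K is js') = (\<Sum>is | mset is = \<alpha>. pow_entry K is js)"
  proof (rule sum.reindex_bij_witness[where i = "permute_list (inv p)" and j = "permute_list p"])
    fix xs assume "xs \<in> {is. mset is = \<alpha>}"
    then have xs: "mset xs = \<alpha>" "length xs = length js'" using len by auto
    show "permute_list (inv p) (permute_list p xs) = xs" "permute_list p (permute_list (inv p) xs) = xs"
      using a[OF xs(2)] .
    have "mset (permute_list p xs) = mset xs" "mset (permute_list (inv p) xs) = mset xs"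
      using p(1) inv by (simp_all add: xs(2))
    then show "permute_list p xs \<in> {is. mset is = \<alpha>}" "permute_list (inv p) xs \<in> {is. mset is = \<alpha>}"
      unfolding mem_Collect_eq xs(1) .
    have "pow_entry K (permute_list p xs) (permute_list p js') = pow_entry K xs js'"
      by (rule pow_entry_permute) (unfold xs(2), rule p(1), rule refl)
    then show "pow_entry K (permute_list p xs) js = pow_entry K xs js'"
      unfolding p(2) .
  qed
  then show ?thesis unfolding sym_entry_def by (rule sym)
qed

lift_definition sym_pow :: "nat \<Rightarrow> 'i rep \<Rightarrow> 'i multiset rep" is
  "\<lambda>m (I, M). (monomials m I, \<lambda>g \<alpha> \<beta>. sym_entry (M g) \<alpha> (some_word \<beta>))"
proof (clarify)
  fix m and I :: "'i set" and M assume *: "is_rep I M"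
  then have fin: "finite I" by (simp add: is_rep_def)
  have W: "xs \<in> words m I" if "mset xs \<in> monomials m I" for xs
    using that by (auto simp: monomials_def words_def)
  show "is_rep (monomials m I) (\<lambda>g \<alpha> \<beta>. sym_entry (M g) \<alpha> (some_word \<beta>))"
    unfolding is_rep_def
  proof (intro conjI ballI)
    show "finite (monomials m I)" using fin by (simp add: finite_words monomials_eq)
    fix \<alpha> \<beta> assume ab: "\<alpha> \<in> monomials m I" "\<beta> \<in> monomials m I"
    note b = some_word_in_words[OF ab(2)]
    have fa: "finite {xs. mset xs = \<alpha>}"
      by (rule finite_subset[OF _ finite_words[OF fin, of m]]) (use ab W in auto)
    have "sym_entry (M (mat 1)) \<alpha> (some_word \<beta>) = (\<Sum>is | mset is = \<alpha>. if is = some_word \<beta> then 1 else 0)"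
      unfolding sym_entry_def
      by (intro sum.cong refl pow_entry_one[OF W b]) (use * ab in \<open>auto simp: is_rep_def\<close>)
    also have "\<dots> = (if \<alpha> = \<beta> then 1 else 0)"
      using fa by (auto simp: sum.delta)
    finally show "sym_entry (M (mat 1)) \<alpha> (some_word \<beta>) = (if \<alpha> = \<beta> then 1 else 0)" .
    show "regular_on_SL3 (\<lambda>g. sym_entry (M g) \<alpha> (some_word \<beta>))"
      unfolding sym_entry_def
      by (intro regular_on_sum pow_entry_regular[OF W b]) (use * ab in \<open>auto simp: is_rep_def\<close>)
    fix g h assume gh: "g \<in> SL3" "h \<in> SL3"
    have "sym_entry (M (g ** h)) \<alpha> (some_word \<beta>) = (\<Sum>is | mset is = \<alpha>.
        \<Sum>ks\<in>words m I. pow_entry (M g) is ks * pow_entry (M h) ks (some_word \<beta>))"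
      unfolding sym_entry_def
      by (intro sum.cong refl pow_entry_comp[OF W b]) (use * ab gh in \<open>auto simp: is_rep_def\<close>)
    also have "\<dots> = (\<Sum>ks\<in>words m I. sym_entry (M g) \<alpha> ks * pow_entry (M h) ks (some_word \<beta>))"
      unfolding sym_entry_def by (subst sum.swap) (simp add: sum_distrib_right)
    also have "\<dots> = (\<Sum>\<gamma>\<in>monomials m I. \<Sum>ks | mset ks = \<gamma>.
        sym_entry (M g) \<alpha> ks * pow_entry (M h) ks (some_word \<beta>))"
      by (rule sum_words_eq[OF fin])
    also have "\<dots> = (\<Sum>\<gamma>\<in>monomials m I. \<Sum>ks | mset ks = \<gamma>.
        sym_entry (M g) \<alpha> (some_word \<gamma>) * pow_entry (M h) ks (some_word \<beta>))"
    proof (intro sum.cong refl)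
      fix \<gamma> ks assume "\<gamma> \<in> monomials m I" and ks: "ks \<in> {ks. mset ks = \<gamma>}"
      then have "size \<alpha> = length ks" using ab by (auto simp: monomials_def)
      then show "sym_entry (M g) \<alpha> ks * pow_entry (M h) ks (some_word \<beta>) =
          sym_entry (M g) \<alpha> (some_word \<gamma>) * pow_entry (M h) ks (some_word \<beta>)"
        using sym_entry_perm[of ks "some_word \<gamma>" \<alpha> "M g"] ks by simp
    qed
    also have "\<dots> = (\<Sum>\<gamma>\<in>monomials m I. sym_entry (M g) \<alpha> (some_word \<gamma>) * sym_entry (M h) \<gamma> (some_word \<beta>))"
      by (simp add: sym_entry_def[of "M h"] sum_distrib_left)
    finally show "sym_entry (M (g ** h)) \<alpha> (some_word \<beta>) =
        (\<Sum>\<gamma>\<in>monomials m I. sym_entry (M g) \<alpha> (some_word \<gamma>) * sym_entry (M h) \<gamma> (some_word \<beta>))" .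
  qed
qed

subsection \<open>Subrepresentations\<close>

definition fscale :: "complex \<Rightarrow> ('i \<Rightarrow> complex) \<Rightarrow> 'i \<Rightarrow> complex" where
  "fscale c f = (\<lambda>i. c * f i)"

interpretation fn: vector_space fscale
  by unfold_locales (auto simp: fscale_def fun_eq_iff algebra_simps)

text \<open>The linear map with matrix \<open>K\<close> on functions supported on \<open>J\<close>.\<close>

definition mat_op :: "'j set \<Rightarrow> ('j \<Rightarrow> 'j \<Rightarrow> complex) \<Rightarrow> ('j \<Rightarrow> complex) \<Rightarrow> 'j \<Rightarrow> complex" where
  "mat_op J K T = (\<lambda>i. if i \<in> J then \<Sum>j\<in>J. K i j * T j else 0)"

definition supported_on :: "'j set \<Rightarrow> ('j \<Rightarrow> complex) set" where
  "supported_on J = {T. \<forall>j. j \<notin> J \<longrightarrow> T j = 0}"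

definition basis_of :: "('j \<Rightarrow> complex) set \<Rightarrow> ('j \<Rightarrow> complex) set" where
  "basis_of W = (SOME B. fn.independent B \<and> fn.span B = W)"

text \<open>The matrices, with respect to the chosen basis of the invariant subspace \<open>W\<close>, of the
  restriction to \<open>W\<close> of the representation with matrices \<open>N\<close>.\<close>

definition restr_mtx :: "'j set \<Rightarrow> ('g \<Rightarrow> 'j \<Rightarrow> 'j \<Rightarrow> complex) \<Rightarrow> ('j \<Rightarrow> complex) set \<Rightarrow>
    'g \<Rightarrow> ('j \<Rightarrow> complex) \<Rightarrow> ('j \<Rightarrow> complex) \<Rightarrow> complex" where
  "restr_mtx J N W g b b' = fn.representation (basis_of W) (mat_op J (N g) b') b"

lemma basis_of:
  assumes "fn.subspace W"
  shows "fn.independent (basis_of W)" "fn.span (basis_of W) = W"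
proof -
  obtain B where "B \<subseteq> W" "fn.independent B" "W \<subseteq> fn.span B"
    using fn.maximal_independent_subset[of W] by blast
  then have "fn.independent B \<and> fn.span B = W"
    using fn.span_minimal[OF _ assms] by auto
  then have "fn.independent (basis_of W) \<and> fn.span (basis_of W) = W"
    unfolding basis_of_def by (rule someI)
  then show "fn.independent (basis_of W)" "fn.span (basis_of W) = W" by auto
qed

definition unit_fun :: "'j \<Rightarrow> 'j \<Rightarrow> complex" where
  "unit_fun j = (\<lambda>i. if i = j then 1 else 0)"

lemma sum_fun_apply: "(\<Sum>x\<in>A. f x) i = (\<Sum>x\<in>A. f x i :: complex)"
  by (induction A rule: infinite_finite_induct) auto

lemma unit_fun_expansion:
  assumes "finite J" "T \<in> supported_on J"
  shows "T = (\<Sum>j\<in>J. fscale (T j) (unit_fun j))"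
  using assms by (auto simp: fun_eq_iff sum_fun_apply fscale_def unit_fun_def supported_on_def delta_mult)

lemma mat_op_supported: "mat_op J K T \<in> supported_on J"
  by (simp add: mat_op_def supported_on_def)

lemma mat_op_sum: "mat_op J K (\<Sum>x\<in>A. fscale (c x) (T x)) = (\<Sum>x\<in>A. fscale (c x) (mat_op J K (T x)))"
proof
  fix i
  show "mat_op J K (\<Sum>x\<in>A. fscale (c x) (T x)) i = (\<Sum>x\<in>A. fscale (c x) (mat_op J K (T x))) i"
    unfolding mat_op_def sum_fun_apply fscale_def
    by (cases "i \<in> J") (simp_all add: sum_distrib_left mult_ac sum.swap[of _ A J])
qed

lemma is_rep_restr:
  assumes rep: "is_rep J N" and sub: "fn.subspace W" and supp: "W \<subseteq> supported_on J"
    and inv: "\<And>g T. g \<in> SL3 \<Longrightarrow> T \<in> W \<Longrightarrow> mat_op J (N g) T \<in> W"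
  shows "is_rep (basis_of W) (restr_mtx J N W)"
proof -
  let ?B = "basis_of W" and ?R = "fn.representation (basis_of W)"
  note B = basis_of[OF sub]
  have finJ: "finite J" using rep by (simp add: is_rep_def)
  have BW: "?B \<subseteq> W" using B(2) fn.span_superset by blast
  have "?B \<subseteq> fn.span (unit_fun ` J)"
  proof
    fix b assume "b \<in> ?B"
    then have "b = (\<Sum>j\<in>J. fscale (b j) (unit_fun j))"
      using BW supp by (intro unit_fun_expansion[OF finJ]) auto
    also have "\<dots> \<in> fn.span (unit_fun ` J)"
      by (intro fn.span_sum fn.span_scale fn.span_base) auto
    finally show "b \<in> fn.span (unit_fun ` J)" .
  qed
  then have finB: "finite ?B"
    using fn.independent_span_bound[OF _ B(1)] finJ by blast
  show ?thesis unfolding is_rep_def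
  proof (intro conjI ballI)
    show "finite ?B" by (rule finB)
    fix b b' assume b: "b \<in> ?B" and b': "b' \<in> ?B"
    then have b'W: "b' \<in> W" using BW by auto
    have "mat_op J (N (mat 1)) b' = mat_op J (\<lambda>i j. if i = j then 1 else 0) b'"
      using rep by (auto simp: mat_op_def is_rep_def fun_eq_iff intro!: sum.cong)
    also have "\<dots> = b'"
      using b'W supp finJ by (auto simp: mat_op_def fun_eq_iff delta_mult supported_on_def)
    finally show "restr_mtx J N W (mat 1) b b' = (if b = b' then 1 else 0)"
      by (simp add: restr_mtx_def fn.representation_basis[OF B(1) b'])
    show "regular_on_SL3 (\<lambda>g. restr_mtx J N W g b b')"
    proof -
      let ?B' = "fn.extend_basis ?B"
      note ext = fn.independent_extend_basis[OF B(1)] fn.extend_basis_superset[OF B(1)]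
        fn.span_extend_basis[OF B(1)]
      let ?f = "\<lambda>g. \<Sum>j\<in>J. (\<Sum>k\<in>J. N g j k * b' k) * fn.representation ?B' (unit_fun j) b"
      have eq: "restr_mtx J N W g b b' = ?f g" if g: "g \<in> SL3" for g
      proof -
        let ?v = "mat_op J (N g) b'"
        have "?v \<in> fn.span ?B" using B(2) inv[OF g b'W] by simp
        then have "?R ?v b = fn.representation ?B' ?v b"
          by (simp add: fn.representation_extend[OF ext(1) _ ext(2)])
        also have "\<dots> = fn.representation ?B' (\<Sum>j\<in>J. fscale (?v j) (unit_fun j)) b"
          using unit_fun_expansion[OF finJ mat_op_supported, of "N g" b'] by simp
        also have "\<dots> = (\<Sum>j\<in>J. ?v j * fn.representation ?B' (unit_fun j) b)"
          by (simp add: fn.representation_sum[OF ext(1)] fn.representation_scale[OF ext(1)] ext(3))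
        also have "\<dots> = ?f g"
          by (intro sum.cong refl) (simp add: mat_op_def)
        finally show ?thesis by (simp add: restr_mtx_def)
      qed
      have "regular_on_SL3 ?f"
        using rep by (intro regular_on_sum regular_on_mult regular_on_const) (auto simp: is_rep_def)
      then show ?thesis by (simp add: regular_on_SL3_def eq)
    qed
    fix g h assume g: "g \<in> SL3" and h: "h \<in> SL3"
    let ?w = "mat_op J (N h) b'"
    have wW: "?w \<in> W" by (rule inv[OF h b'W])
    have "mat_op J (N (g ** h)) b' i = mat_op J (N g) ?w i" for i
    proof (cases "i \<in> J")
      case True
      then have "mat_op J (N (g ** h)) b' i = (\<Sum>k\<in>J. (\<Sum>j\<in>J. N g i j * N h j k) * b' k)"
        using rep g h by (simp add: mat_op_def is_rep_def)
      also have "\<dots> = (\<Sum>j\<in>J. N g i j * (\<Sum>k\<in>J. N h j k * b' k))"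
        by (simp add: sum_distrib_left sum_distrib_right mult.assoc) (rule sum.swap)
      also have "\<dots> = mat_op J (N g) ?w i"
        using True by (simp add: mat_op_def)
      finally show ?thesis .
    qed (simp add: mat_op_def)
    then have "mat_op J (N (g ** h)) b' = mat_op J (N g) ?w" ..
    also have "?w = (\<Sum>c\<in>?B. fscale (?R ?w c) c)"
      using fn.sum_representation_eq[OF B(1) _ finB subset_refl, of ?w] wW B(2) by simp
    also have "mat_op J (N g) \<dots> = (\<Sum>c\<in>?B. fscale (?R ?w c) (mat_op J (N g) c))"
      by (rule mat_op_sum)
    finally have e: "mat_op J (N (g ** h)) b' = (\<Sum>c\<in>?B. fscale (?R ?w c) (mat_op J (N g) c))" .
    have s: "mat_op J (N g) c \<in> fn.span ?B" if "c \<in> ?B" for c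
      using that BW B(2) inv[OF g] by auto
    have "?R (\<Sum>c\<in>?B. fscale (?R ?w c) (mat_op J (N g) c)) b = (\<Sum>c\<in>?B. ?R ?w c * ?R (mat_op J (N g) c) b)"
      by (simp add: fn.representation_sum[OF B(1)] fn.representation_scale[OF B(1)] s fn.span_scale)
    then show "restr_mtx J N W (g ** h) b b' = (\<Sum>c\<in>?B. restr_mtx J N W g b c * restr_mtx J N W h c b')"
      unfolding restr_mtx_def e by (simp add: mult.commute)
  qed
qed

subsection \<open>Schur functors\<close>

text \<open>The boxes \<open>(row, column)\<close> of the Young diagram with row lengths \<open>lam\<close>, in reading order. The tableau
  underlying the Young symmetrizer is the one with \<open>k\<close> in the \<open>k\<close>-th box, \<open>k < sum_list lam\<close>.\<close>

definition boxes :: "nat list \<Rightarrow> (nat \<times> nat) list" where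
  "boxes lam = concat (map (\<lambda>i. map (\<lambda>j. (i, j)) [0..<lam ! i]) [0..<length lam])"

definition row_group :: "nat list \<Rightarrow> (nat \<Rightarrow> nat) set" where
  "row_group lam = {p. p permutes {..<sum_list lam} \<and>
     (\<forall>k<sum_list lam. fst (boxes lam ! p k) = fst (boxes lam ! k))}"

definition col_group :: "nat list \<Rightarrow> (nat \<Rightarrow> nat) set" where
  "col_group lam = {p. p permutes {..<sum_list lam} \<and>
     (\<forall>k<sum_list lam. snd (boxes lam ! p k) = snd (boxes lam ! k))}"

text \<open>The right action of permutations on tensors,
  \<open>(v\<^sub>0 \<otimes> \<cdots> \<otimes> v\<^bsub>d-1\<^esub>) \<cdot> p = v\<^bsub>p(0)\<^esub> \<otimes> \<cdots> \<otimes> v\<^bsub>p(d-1)\<^esub>\<close>. A tensor is given by its coefficient function: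
  \<open>T\<close> stands for the sum of the \<open>T is\<close>-multiples of \<open>e\<^bsub>is ! 0\<^esub> \<otimes> \<cdots> \<otimes> e\<^bsub>is ! (d-1)\<^esub>\<close>.\<close>

definition perm_tensor :: "('i list \<Rightarrow> complex) \<Rightarrow> (nat \<Rightarrow> nat) \<Rightarrow> 'i list \<Rightarrow> complex" where
  "perm_tensor T p = (\<lambda>is. T (permute_list (inv p) is))"

text \<open>Right multiplication by the Young symmetrizer \<open>c\<^sub>\<lambda> = a\<^sub>\<lambda> b\<^sub>\<lambda>\<close>: first symmetrize along the rows,
  then antisymmetrize along the columns. Its image is the Schur functor.\<close>

definition young_symmetrizer :: "nat list \<Rightarrow> ('i list \<Rightarrow> complex) \<Rightarrow> 'i list \<Rightarrow> complex" where
  "young_symmetrizer lam T =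
     (\<Sum>q\<in>col_group lam. \<Sum>p\<in>row_group lam. fscale (of_int (sign q)) (perm_tensor (perm_tensor T p) q))"

definition schur_space :: "nat list \<Rightarrow> 'i set \<Rightarrow> ('i list \<Rightarrow> complex) set" where
  "schur_space lam I = young_symmetrizer lam ` supported_on (words (sum_list lam) I)"

lemma row_group_permutes: "p \<in> row_group lam \<Longrightarrow> p permutes {..<sum_list lam}"
  by (simp add: row_group_def)

lemma col_group_permutes: "p \<in> col_group lam \<Longrightarrow> p permutes {..<sum_list lam}"
  by (simp add: col_group_def)

lemma permute_list_words:
  assumes "p permutes {..<d}" "length xs = d"
  shows "permute_list p xs \<in> words d I \<longleftrightarrow> xs \<in> words d I"
  using assms by (simp add: words_def)

lemma perm_tensor_supported:
  assumes "p permutes {..<d}" "T \<in> supported_on (words d I)"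
  shows "perm_tensor T p \<in> supported_on (words d I)"
  unfolding supported_on_def perm_tensor_def
proof (clarify)
  fix xs assume "xs \<notin> words d I"
  then have "permute_list (inv p) xs \<notin> words d I"
    using permute_list_words[OF permutes_inv[OF assms(1)], of xs I]
    by (cases "length xs = d") (auto simp: words_def)
  then show "T (permute_list (inv p) xs) = 0"
    using assms(2) by (simp add: supported_on_def)
qed

lemma mat_op_perm_tensor:
  fixes I :: "'i set"
  assumes p: "p permutes {..<d}" and fin: "finite I" and T: "T \<in> supported_on (words d I)"
  shows "mat_op (words d I) (pow_entry K) (perm_tensor T p) =
         perm_tensor (mat_op (words d I) (pow_entry K) T) p"
proof
  fix xs
  have ip: "inv p permutes {..<d}" by (rule permutes_inv[OF p])
  show "mat_op (words d I) (pow_entry K) (perm_tensor T p) xs =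
      perm_tensor (mat_op (words d I) (pow_entry K) T) p xs"
  proof (cases "xs \<in> words d I")
    case True
    then have len: "length xs = d" by (simp add: words_def)
    note a = permute_list_inv[OF p]
    have "(\<Sum>ys\<in>words d I. pow_entry K xs ys * T (permute_list (inv p) ys)) =
          (\<Sum>ys\<in>words d I. pow_entry K (permute_list (inv p) xs) ys * T ys)"
    proof (rule sum.reindex_bij_witness[where i = "permute_list p" and j = "permute_list (inv p)"])
      fix ys assume ys: "ys \<in> words d I"
      then have l: "length ys = d" by (simp add: words_def)
      show "permute_list p (permute_list (inv p) ys) = ys" "permute_list (inv p) (permute_list p ys) = ys"
        using a[OF l] by (simp_all only:)
      show "permute_list (inv p) ys \<in> words d I" "permute_list p ys \<in> words d I"
        using ys permute_list_words[OF p l] permute_list_words[OF ip l] by auto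
      show "pow_entry K (permute_list (inv p) xs) (permute_list (inv p) ys) * T (permute_list (inv p) ys) =
          pow_entry K xs ys * T (permute_list (inv p) ys)"
        using pow_entry_permute[of "inv p" xs ys K] ip l len by simp
    qed
    then show ?thesis
      using True permute_list_words[OF ip len] by (simp add: mat_op_def perm_tensor_def)
  next
    case False
    then show ?thesis
      using perm_tensor_supported[OF p mat_op_supported[of "words d I" "pow_entry K" T]]
      by (simp add: mat_op_def[of _ _ "perm_tensor T p"] supported_on_def)
  qed
qed

lemma young_symmetrizer_supported:
  assumes "T \<in> supported_on (words (sum_list lam) I)"
  shows "young_symmetrizer lam T \<in> supported_on (words (sum_list lam) I)"
proof -
  have "perm_tensor (perm_tensor T p) q \<in> supported_on (words (sum_list lam) I)"
    if "p \<in> row_group lam" "q \<in> col_group lam" for p q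
    using that by (intro perm_tensor_supported assms row_group_permutes col_group_permutes)
  then show ?thesis
    by (auto simp: supported_on_def young_symmetrizer_def sum_fun_apply fscale_def intro!: sum.neutral)
qed

lemma mat_op_young_symmetrizer:
  assumes fin: "finite I" and T: "T \<in> supported_on (words (sum_list lam) I)"
  shows "mat_op (words (sum_list lam) I) (pow_entry K) (young_symmetrizer lam T) =
         young_symmetrizer lam (mat_op (words (sum_list lam) I) (pow_entry K) T)"
proof -
  let ?op = "mat_op (words (sum_list lam) I) (pow_entry K)"
  have c: "?op (perm_tensor (perm_tensor T p) q) = perm_tensor (perm_tensor (?op T) p) q"
    if "p \<in> row_group lam" "q \<in> col_group lam" for p q
    using that T mat_op_perm_tensor[OF _ fin] perm_tensor_supported row_group_permutes col_group_permutes
    by metis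
  have "?op (young_symmetrizer lam T) =
    ?op (\<Sum>x\<in>col_group lam \<times> row_group lam. fscale (of_int (sign (fst x))) (perm_tensor (perm_tensor T (snd x)) (fst x)))"
    by (simp add: young_symmetrizer_def sum.cartesian_product case_prod_unfold)
  also have "\<dots> = (\<Sum>x\<in>col_group lam \<times> row_group lam. fscale (of_int (sign (fst x)))
      (?op (perm_tensor (perm_tensor T (snd x)) (fst x))))"
    by (rule mat_op_sum)
  also have "\<dots> = (\<Sum>x\<in>col_group lam \<times> row_group lam. fscale (of_int (sign (fst x)))
      (perm_tensor (perm_tensor (?op T) (snd x)) (fst x)))"
    by (intro sum.cong refl arg_cong2[where f = fscale] c) auto
  also have "\<dots> = young_symmetrizer lam (?op T)"
    by (simp add: young_symmetrizer_def sum.cartesian_product case_prod_unfold)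
  finally show ?thesis .
qed

lemma schur_space_subspace: "fn.subspace (schur_space lam I)"
proof -
  let ?S = "supported_on (words (sum_list lam) I)"
  have lin: "young_symmetrizer lam (T + U) = young_symmetrizer lam T + young_symmetrizer lam U"
       "young_symmetrizer lam (fscale c T) = fscale c (young_symmetrizer lam T)"
    for T U :: "'a list \<Rightarrow> complex" and c
    by (simp_all add: fun_eq_iff young_symmetrizer_def sum_fun_apply fscale_def perm_tensor_def
        sum.distrib[symmetric] sum_distrib_left algebra_simps)
  have zero: "young_symmetrizer lam 0 = (0 :: 'a list \<Rightarrow> complex)"
    by (simp add: fun_eq_iff young_symmetrizer_def sum_fun_apply fscale_def perm_tensor_def)
  show ?thesis unfolding fn.subspace_def schur_space_def
  proof (intro conjI ballI allI)
    have "0 \<in> ?S" by (simp add: supported_on_def)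
    then show "0 \<in> young_symmetrizer lam ` ?S" using zero by (metis image_eqI)
    fix x assume "x \<in> young_symmetrizer lam ` ?S"
    then obtain T where T: "x = young_symmetrizer lam T" "T \<in> ?S" by auto
    have "fscale c T \<in> ?S" for c using T by (simp add: supported_on_def fscale_def)
    then show "fscale c x \<in> young_symmetrizer lam ` ?S" for c
      using T lin(2) by (metis image_eqI)
    fix y assume "y \<in> young_symmetrizer lam ` ?S"
    then obtain U where U: "y = young_symmetrizer lam U" "U \<in> ?S" by auto
    have "T + U \<in> ?S" using T U by (simp add: supported_on_def)
    then show "x + y \<in> young_symmetrizer lam ` ?S"
      using T U lin(1) by (metis image_eqI)
  qed
qed

lift_definition schur :: "nat list \<Rightarrow> 'i rep \<Rightarrow> ('i list \<Rightarrow> complex) rep" is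
  "\<lambda>lam (I, M). (basis_of (schur_space lam I),
     restr_mtx (words (sum_list lam) I) (\<lambda>g. pow_entry (M g)) (schur_space lam I))"
proof (clarify)
  fix lam and I :: "'i set" and M assume rep: "is_rep I M"
  let ?J = "words (sum_list lam) I"
  have fin: "finite I" using rep by (simp add: is_rep_def)
  show "is_rep (basis_of (schur_space lam I)) (restr_mtx ?J (\<lambda>g. pow_entry (M g)) (schur_space lam I))"
  proof (rule is_rep_restr)
    show "is_rep ?J (\<lambda>g. pow_entry (M g))"
      using rep by (rule is_rep_tensor_pow)
    show "fn.subspace (schur_space lam I)" by (rule schur_space_subspace)
    show "schur_space lam I \<subseteq> supported_on ?J"
      by (auto simp: schur_space_def young_symmetrizer_supported)
    fix g T assume "T \<in> schur_space lam I"
    then obtain U where U: "T = young_symmetrizer lam U" "U \<in> supported_on ?J"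
      by (auto simp: schur_space_def)
    show "mat_op ?J (pow_entry (M g)) T \<in> schur_space lam I"
      unfolding U(1) mat_op_young_symmetrizer[OF fin U(2)] schur_space_def
      by (intro imageI mat_op_supported)
  qed
qed

subsection \<open>Classes in the representation ring\<close>

definition Sym :: "int \<Rightarrow> 'i rep \<Rightarrow> rep_ring" where
  "Sym m r = (if m < 0 then 0 else rep_ring_of (sym_pow (nat m) r))"

definition Schur :: "nat list \<Rightarrow> 'i rep \<Rightarrow> rep_ring" where
  "Schur lam r = rep_ring_of (schur lam r)"

end

(* Restricted to SU(3), every representation that occurs is unitary, and unitary representations
   with equal traces are isomorphic: by the double commutant argument equal nonzero traces force a
   nonzero intertwiner, and one splits off its image and induces on the dimension. So the identity
   may be checked on traces, and there on upper triangular matrices. The two-row Schur functors are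
   removed by Jacobi--Trudi, S_{a,b} + S^{a+1} S^{b-1} = S^a S^b, which comes from the sl_2 action
   on S^a (x) S^b: the Young symmetrizer kills the image of the lowering operator and is injective
   on the kernel of the raising operator, and the raising operator is surjective. What remains is
   the equality, modulo xyw = 1, of two forms of the numerator K(z) of the equivariant Hilbert
   series of the cubic Veronese ring, where (sum over t of h_{3t}(x,y,w) z^t) equals K(z) divided
   by the product of 1 - z m over the ten cubic monomials m. *)

theory Submission
  imports Defs
    "HOL-Computational_Algebra.Formal_Power_Series"
    "HOL-Computational_Algebra.Fundamental_Theorem_Algebra"
begin

section \<open>Equivariant bijections\<close>

text \<open>The Schur functors are images of Young symmetrizers, written in a basis obtained by
  choice, so neither their traces nor their unitarity can be read off. Jacobi--Trudi turns each of
  their classes into a difference of products of symmetric powers, and unitarity is proved for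
  those. It is used algebraically: the operator of the conjugate transpose is the adjoint operator,
  so orthogonal complements give complete reducibility without integration over SU(3) and without
  weights. Traces are compared on triangular rather than diagonal matrices because every matrix of
  SL_3 is conjugate within SL_3 to a triangular one; this spares a density argument. The
  representations in the statement are the terms of the minimal free resolution of the cubic
  Veronese surface in P^9: the three brackets have dimensions 27, 105 and 189, the shifts 2, 3, 4,
  5, 6, 7, 9 are its degrees, and the pairing of t-2 with t-7, of t-3 with t-6 and of t-4 with t-5
  is its self-duality. The resolution itself is not constructed; its Euler characteristic is
  K(z).\<close>

lemma is_repD:
  assumes "g \<in> SL3" "h \<in> SL3" "i \<in> idx r" "k \<in> idx r"
  shows "mtx r (g ** h) i k = (\<Sum>j\<in>idx r. mtx r g i j * mtx r h j k)"
  using is_rep_idx_mtx[of r] assms by (simp add: is_rep_def)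

lemma mtx_one: "i \<in> idx r \<Longrightarrow> j \<in> idx r \<Longrightarrow> mtx r (mat 1) i j = (if i = j then 1 else 0)"
  using is_rep_idx_mtx[of r] by (simp add: is_rep_def)

lemma sum_mult_assoc:
  fixes A :: "'a \<Rightarrow> complex" and C :: "'b \<Rightarrow> complex"
  shows "(\<Sum>k\<in>K. A k * (\<Sum>m\<in>M. D k m * C m)) = (\<Sum>m\<in>M. (\<Sum>k\<in>K. A k * D k m) * C m)"
  by (simp add: sum_distrib_left sum_distrib_right mult.assoc) (rule sum.swap)

text \<open>Solving \<open>X v = e_l\<close> for each \<open>l\<close> gives a right inverse
  \<open>P\<close>. Injectivity of \<open>X\<close> makes it two-sided and equivariant: both
  remaining identities are verified after applying \<open>X\<close>. In \<open>rep_iso\<close> the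
  matrix \<open>X\<close> takes the place of \<open>Q\<close>.\<close>

lemma rep_iso_of_bij_matrix:
  assumes eqv: "\<And>g j i. g \<in> SL3 \<Longrightarrow> j \<in> idx s \<Longrightarrow> i \<in> idx r \<Longrightarrow>
      (\<Sum>j'\<in>idx s. mtx s g j j' * X j' i) = (\<Sum>i'\<in>idx r. X j i' * mtx r g i' i)"
    and inj: "\<And>v i. (\<And>j. j \<in> idx s \<Longrightarrow> (\<Sum>i\<in>idx r. X j i * v i) = 0) \<Longrightarrow> i \<in> idx r \<Longrightarrow> v i = 0"
    and surj: "\<And>w. \<exists>v. \<forall>j\<in>idx s. (\<Sum>i\<in>idx r. X j i * v i) = w j"
  shows "r \<cong>\<^sub>r s"
proof -
  have "\<exists>v. \<forall>j\<in>idx s. (\<Sum>i\<in>idx r. X j i * v i) = (if j = l then 1 else 0)" for l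
    by (rule surj)
  then obtain P' where "\<forall>l. \<forall>j\<in>idx s. (\<Sum>i\<in>idx r. X j i * P' l i) = (if j = l then 1 else 0)"
    by metis
  then have "\<exists>P. \<forall>l. \<forall>j\<in>idx s. (\<Sum>i\<in>idx r. X j i * P i l) = (if j = l then 1 else 0)"
    by (intro exI[of _ "\<lambda>i l. P' l i"])
  then obtain P where P: "\<And>j l. j \<in> idx s \<Longrightarrow> (\<Sum>i\<in>idx r. X j i * P i l) = (if j = l then 1 else 0)"
    by auto
  have inj': "v i = v' i" if "\<And>j. j \<in> idx s \<Longrightarrow> (\<Sum>i\<in>idx r. X j i * v i) = (\<Sum>i\<in>idx r. X j i * v' i)"
      and "i \<in> idx r" for v v' i
    using inj[of "\<lambda>i. v i - v' i" i] that by (simp add: algebra_simps sum_subtractf)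
  show ?thesis unfolding rep_iso_def
  proof (intro exI[of _ P] exI[of _ X] conjI ballI)
    fix i k assume i: "i \<in> idx r" and k: "k \<in> idx r"
    show "(\<Sum>j\<in>idx s. P i j * X j k) = (if i = k then 1 else 0)"
    proof (rule inj'[OF _ i])
      fix j assume j: "j \<in> idx s"
      have "(\<Sum>i\<in>idx r. X j i * (\<Sum>l\<in>idx s. P i l * X l k)) = (\<Sum>l\<in>idx s. (if j = l then 1 else 0) * X l k)"
        unfolding sum_mult_assoc by (simp add: P j)
      also have "\<dots> = X j k" using j by (simp add: delta_mult)
      also have "\<dots> = (\<Sum>i\<in>idx r. X j i * (if i = k then 1 else 0))"
        using k by (simp add: delta_mult)
      finally show "(\<Sum>i\<in>idx r. X j i * (\<Sum>l\<in>idx s. P i l * X l k)) = \<dots>" .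
    qed
  next
    fix j l assume "j \<in> idx s" "l \<in> idx s"
    then show "(\<Sum>i\<in>idx r. X j i * P i l) = (if j = l then 1 else 0)" by (simp add: P)
  next
    fix g i l assume g: "g \<in> SL3" and i: "i \<in> idx r" and l: "l \<in> idx s"
    show "(\<Sum>k\<in>idx r. mtx r g i k * P k l) = (\<Sum>j\<in>idx s. P i j * mtx s g j l)"
    proof (rule inj'[OF _ i])
      fix j assume j: "j \<in> idx s"
      have "(\<Sum>i\<in>idx r. X j i * (\<Sum>k\<in>idx r. mtx r g i k * P k l)) =
          (\<Sum>k\<in>idx r. (\<Sum>j'\<in>idx s. mtx s g j j' * X j' k) * P k l)"
        unfolding sum_mult_assoc by (intro sum.cong refl) (simp add: eqv[OF g j])
      also have "\<dots> = (\<Sum>j'\<in>idx s. mtx s g j j' * (\<Sum>k\<in>idx r. X j' k * P k l))"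
        by (simp only: sum_mult_assoc)
      also have "\<dots> = mtx s g j l" using l by (simp add: P delta_mult)
      also have "\<dots> = (\<Sum>k\<in>idx s. (if j = k then 1 else 0) * mtx s g k l)"
        using j by (simp add: delta_mult)
      also have "\<dots> = (\<Sum>i\<in>idx r. X j i * (\<Sum>k\<in>idx s. P i k * mtx s g k l))"
        unfolding sum_mult_assoc by (simp add: P j)
      finally show "(\<Sum>i\<in>idx r. X j i * (\<Sum>k\<in>idx r. mtx r g i k * P k l)) = \<dots>" .
    qed
  qed
qed

section \<open>Orthonormal families\<close>

text \<open>Conjugate-linear in the first argument, so that \<open>hip I (u i) v\<close> is the
  coefficient of \<open>v\<close> along an orthonormal \<open>u i\<close>.\<close>

definition hip :: "'i set \<Rightarrow> ('i \<Rightarrow> complex) \<Rightarrow> ('i \<Rightarrow> complex) \<Rightarrow> complex" where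
  "hip I u v = (\<Sum>i\<in>I. cnj (u i) * v i)"

lemma hip_add: "hip I u (v + w) = hip I u v + hip I u w" "hip I (v + w) u = hip I v u + hip I w u"
  and hip_diff: "hip I u (v - w) = hip I u v - hip I u w"
  and hip_scale: "hip I u (fscale c v) = c * hip I u v" "hip I (fscale c v) u = cnj c * hip I v u"
  by (simp_all add: hip_def fscale_def algebra_simps sum.distrib sum_subtractf sum_distrib_left)

lemma hip_sum: "hip I u (\<Sum>k\<in>K. v k) = (\<Sum>k\<in>K. hip I u (v k))"
  by (simp add: hip_def sum_fun_apply sum_distrib_left) (rule sum.swap)

lemma hip_cnj: "cnj (hip I u v) = hip I v u"
  by (simp add: hip_def mult.commute)

lemma hip_self: "hip I u u = of_real (\<Sum>i\<in>I. (cmod (u i))\<^sup>2)"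
proof -
  have "cnj (u i) * u i = of_real ((cmod (u i))\<^sup>2)" for i
    by (metis complex_norm_square mult.commute of_real_power)
  then show ?thesis by (simp add: hip_def)
qed

lemma hip_self_eq_0: "finite I \<Longrightarrow> hip I u u = 0 \<longleftrightarrow> (\<forall>i\<in>I. u i = 0)"
  unfolding hip_self of_real_eq_0_iff by (subst sum_nonneg_eq_0_iff) auto

definition orthonormal :: "'i set \<Rightarrow> nat \<Rightarrow> (nat \<Rightarrow> 'i \<Rightarrow> complex) \<Rightarrow> bool" where
  "orthonormal I k u \<longleftrightarrow> (\<forall>i<k. \<forall>j<k. hip I (u i) (u j) = (if i = j then 1 else 0))"

lemma subspace_supported: "fn.subspace (supported_on I)"
  by (simp add: fn.subspace_def supported_on_def fscale_def)

text \<open>Gram--Schmidt, one vector of \<open>B\<close> at a time: the residual \<open>v\<close>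
  of the new vector \<open>b\<close> is normalized, or dropped if it vanishes. The expansion formula
  is carried through the induction as the form in which the basis property is used later.\<close>

lemma orthonormal_span_exists:
  assumes I: "finite I" and "finite B" "B \<subseteq> supported_on I"
  shows "\<exists>k u. orthonormal I k u \<and> (\<forall>i<k. u i \<in> fn.span B) \<and>
     (\<forall>v\<in>fn.span B. v = (\<Sum>i<k. fscale (hip I (u i) v) (u i)))"
  using assms(2,3)
proof (induction B)
  case empty
  then show ?case by (intro exI[of _ 0]) (simp add: orthonormal_def)
next
  case (insert b B)
  then obtain k u where u: "orthonormal I k u" "\<And>i. i < k \<Longrightarrow> u i \<in> fn.span B"
    and rec: "\<And>v. v \<in> fn.span B \<Longrightarrow> v = (\<Sum>i<k. fscale (hip I (u i) v) (u i))" by auto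
  have on: "hip I (u i) (u j) = (if i = j then 1 else 0)" if "i < k" "j < k" for i j
    using u(1) that by (simp add: orthonormal_def)
  have mono: "fn.span B \<subseteq> fn.span (insert b B)" by (rule fn.span_mono) auto
  define pb where "pb = (\<Sum>i<k. fscale (hip I (u i) b) (u i))"
  define v where "v = b - pb"
  have pbB: "pb \<in> fn.span B" unfolding pb_def by (intro fn.span_sum fn.span_scale) (simp add: u)
  have vspan: "v \<in> fn.span (insert b B)"
    unfolding v_def using pbB mono by (intro fn.span_diff) (auto intro: fn.span_base)
  have vsupp: "v \<in> supported_on I"
    using vspan fn.span_minimal[OF insert.prems subspace_supported] by auto
  have ort: "hip I (u i) v = 0" if "i < k" for i
    using that unfolding v_def pb_def hip_diff hip_sum hip_scale by (simp add: on delta_mult)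
  have dec: "\<exists>c. w - fscale c v \<in> fn.span B" if w: "w \<in> fn.span (insert b B)" for w
  proof -
    obtain c where c: "w - fscale c b \<in> fn.span B" using w fn.span_insert[of b B] by auto
    have "w - fscale c v = (w - fscale c b) + fscale c pb"
      by (simp add: v_def fscale_def fun_eq_iff algebra_simps)
    then show ?thesis using c pbB by (metis fn.span_add fn.span_scale)
  qed
  show ?case
  proof (cases "hip I v v = 0")
    case True
    then have "v = 0" using vsupp hip_self_eq_0[OF I] by (auto simp: supported_on_def fun_eq_iff)
    then have "b \<in> fn.span B" using pbB by (simp add: v_def)
    then have "fn.span (insert b B) = fn.span B"
      by (rule fn.span_redundant)
    then show ?thesis using u rec by (intro exI[of _ k] exI[of _ u]) auto
  next
    case False
    define N where "N = sqrt (\<Sum>i\<in>I. (cmod (v i))\<^sup>2)"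
    have "(\<Sum>i\<in>I. (cmod (v i))\<^sup>2) \<noteq> 0" using False unfolding hip_self of_real_eq_0_iff .
    then have N0: "complex_of_real N \<noteq> 0" by (simp add: N_def)
    have NN: "hip I v v = of_real N * of_real N"
      unfolding hip_self N_def of_real_mult[symmetric] by (simp add: sum_nonneg)
    define n where "n = fscale (1 / of_real N) v"
    let ?u = "u(k := n)"
    have nn: "hip I n n = 1" using N0 by (simp add: n_def hip_scale NN)
    have n1: "hip I (u i) n = 0" "hip I n (u i) = 0" if "i < k" for i
      using ort[OF that] hip_cnj[of I "u i" v] by (simp_all add: n_def hip_scale)
    have on': "orthonormal I (Suc k) ?u"
      unfolding orthonormal_def by (auto simp: less_Suc_eq on nn n1)
    have usp: "?u i \<in> fn.span (insert b B)" if "i < Suc k" for i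
      using that u(2) mono vspan by (auto simp: n_def less_Suc_eq intro: fn.span_scale)
    have "w = (\<Sum>i<Suc k. fscale (hip I (?u i) w) (?u i))" if w: "w \<in> fn.span (insert b B)" for w
    proof -
      obtain c where c: "w - fscale c v \<in> fn.span B" using dec[OF w] by auto
      let ?w = "w - fscale c v"
      have "v = fscale (of_real N) n" using N0 by (simp add: n_def)
      then have cv: "fscale c v = fscale (c * of_real N) n" by simp
      have h: "hip I n ?w = 0"
        by (subst rec[OF c]) (simp add: hip_sum hip_scale n1)
      then have hn: "hip I n w = c * of_real N"
        unfolding cv by (simp add: hip_diff hip_scale nn)
      have hu: "hip I (u i) ?w = hip I (u i) w" if "i < k" for i
        using ort[OF that] by (simp add: hip_diff hip_scale)
      have "(\<Sum>i<Suc k. fscale (hip I (?u i) w) (?u i)) = (\<Sum>i<k. fscale (hip I (u i) w) (u i)) + fscale c v"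
        by (simp add: hn cv)
      also have "(\<Sum>i<k. fscale (hip I (u i) w) (u i)) = ?w"
        by (subst rec[OF c]) (simp add: hu)
      finally show ?thesis by (simp only: diff_add_cancel)
    qed
    with on' usp show ?thesis by blast
  qed
qed

text \<open>\<open>basis_of\<close> comes from a choice; it is finite because an independent set in
  the span of the finitely many unit functions of \<open>I\<close> is bounded by their
  number.\<close>

lemma finite_basis:
  assumes I: "finite I" and W: "fn.subspace W" "W \<subseteq> supported_on I"
  obtains B where "finite B" "B \<subseteq> W" "fn.independent B" "fn.span B = W"
proof -
  note B = basis_of[OF W(1)]
  have "basis_of W \<subseteq> W" using B(2) fn.span_superset by blast
  moreover have "v \<in> fn.span (unit_fun ` I)" if "v \<in> supported_on I" for v
    by (subst unit_fun_expansion[OF I that]) (intro fn.span_sum fn.span_scale fn.span_base, auto)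
  ultimately have "basis_of W \<subseteq> fn.span (unit_fun ` I)" using W(2) by blast
  then have "finite (basis_of W)" using fn.independent_span_bound[OF _ B(1)] I by blast
  with \<open>basis_of W \<subseteq> W\<close> B that show ?thesis by blast
qed

lemma orthonormal_basis_exists:
  assumes I: "finite I" and W: "fn.subspace W" "W \<subseteq> supported_on I"
  obtains k u where "orthonormal I k u" "\<And>i. i < k \<Longrightarrow> u i \<in> W"
    "\<And>v. v \<in> W \<Longrightarrow> v = (\<Sum>i<k. fscale (hip I (u i) v) (u i))"
proof -
  obtain B where "finite B" "B \<subseteq> W" "fn.span B = W" using finite_basis[OF assms] .
  then show ?thesis using orthonormal_span_exists[OF I, of B] W(2) that by blast
qed

definition ortho_compl :: "'i set \<Rightarrow> ('i \<Rightarrow> complex) set \<Rightarrow> ('i \<Rightarrow> complex) set" where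
  "ortho_compl I W = {v \<in> supported_on I. \<forall>w\<in>W. hip I w v = 0}"

lemma subspace_ortho_compl: "fn.subspace (ortho_compl I W)"
proof -
  have "hip I w 0 = 0" for w by (simp add: hip_def)
  then show ?thesis
    using subspace_supported[of I]
    by (auto simp: fn.subspace_def ortho_compl_def hip_add hip_scale)
qed

lemma ortho_decomp:
  assumes I: "finite I" and W: "fn.subspace W" "W \<subseteq> supported_on I" and v: "v \<in> supported_on I"
  obtains w z where "w \<in> W" "z \<in> ortho_compl I W" "v = w + z"
proof -
  obtain k u where u: "orthonormal I k u" "\<And>i. i < k \<Longrightarrow> u i \<in> W"
    and rec: "\<And>v. v \<in> W \<Longrightarrow> v = (\<Sum>i<k. fscale (hip I (u i) v) (u i))"
    using orthonormal_basis_exists[OF I W] by blast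
  define w where "w = (\<Sum>i<k. fscale (hip I (u i) v) (u i))"
  have wW: "w \<in> W" unfolding w_def
    by (intro fn.subspace_sum[OF W(1)] fn.subspace_scale[OF W(1)]) (simp add: u)
  have z0: "hip I (u i) (v - w) = 0" if "i < k" for i
    using that u(1) by (simp add: w_def hip_diff hip_sum hip_scale orthonormal_def delta_mult)
  have "hip I x (v - w) = 0" if x: "x \<in> W" for x
  proof -
    have "hip I (v - w) x = 0"
      by (subst rec[OF x]) (use z0 hip_cnj[of I _ "v - w"] in \<open>simp add: hip_sum hip_scale\<close>,
          metis (no_types, lifting) complex_cnj_zero hip_cnj lessThan_iff mult_zero_right sum.neutral)
    then show ?thesis using hip_cnj[of I "v - w" x] by simp
  qed
  moreover have "v - w \<in> supported_on I"
    using v wW W(2) by (intro fn.subspace_diff[OF subspace_supported]) auto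
  ultimately have "v - w \<in> ortho_compl I W" by (simp add: ortho_compl_def)
  then show ?thesis using that[OF wW] by simp
qed

section \<open>Unitary matrix representations\<close>

definition adj :: "complex^3^3 \<Rightarrow> complex^3^3" where
  "adj g = (\<chi> i j. cnj (g $ j $ i))"

lemma adj_nth [simp]: "adj g $ i $ j = cnj (g $ j $ i)"
  by (simp add: adj_def)

lemma adj_adj [simp]: "adj (adj g) = g"
  by (simp add: adj_def vec_eq_iff)

lemma adj_SL3 [simp]: "g \<in> SL3 \<Longrightarrow> adj g \<in> SL3"
proof -
  have "det (adj g) = cnj (det g)" for g :: "complex^3^3"
    by (simp add: det_3)
  then show "g \<in> SL3 \<Longrightarrow> adj g \<in> SL3" by (simp add: SL3_def)
qed

text \<open>Equivalently, the restriction to \<open>SU(3)\<close> is unitary.\<close>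

definition star_rep :: "'i rep \<Rightarrow> bool" where
  "star_rep r \<longleftrightarrow> (\<forall>g\<in>SL3. \<forall>i\<in>idx r. \<forall>j\<in>idx r. mtx r (adj g) i j = cnj (mtx r g j i))"

lemma star_repD:
  "star_rep r \<Longrightarrow> g \<in> SL3 \<Longrightarrow> i \<in> idx r \<Longrightarrow> j \<in> idx r \<Longrightarrow> mtx r (adj g) i j = cnj (mtx r g j i)"
  by (simp add: star_rep_def)

lemma star_rep_dsum: "star_rep r \<Longrightarrow> star_rep s \<Longrightarrow> star_rep (r \<oplus>\<^sub>r s)"
  by (auto simp: star_rep_def)

lemma mtx_nat_rep: "mtx (nat_rep r) g a b = mtx r g (enum_set (idx r) a) (enum_set (idx r) b)"
  by transfer auto

lemma enum_set_in: "finite I \<Longrightarrow> a < card I \<Longrightarrow> enum_set I a \<in> I"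
  using bij_betwE[OF bij_betw_enum_set, of I] by auto

lemma star_rep_nat_rep: "star_rep r \<Longrightarrow> star_rep (nat_rep r)"
  by (auto simp: star_rep_def mtx_nat_rep idx_nat_rep enum_set_in)

lemma ex_rep: assumes "is_rep I M" obtains r where "idx r = I" "mtx r = M"
  using assms that[of "Abs_rep (I, M)"] by (simp add: idx.rep_eq mtx.rep_eq Abs_rep_inverse)

lemma mat_op_mult:
  assumes "g \<in> SL3" "h \<in> SL3"
  shows "mat_op (idx r) (mtx r (g ** h)) v = mat_op (idx r) (mtx r g) (mat_op (idx r) (mtx r h) v)"
  by (auto simp: mat_op_def fun_eq_iff sum_mult_assoc is_repD[OF assms])

lemma mat_op_one: "v \<in> supported_on (idx r) \<Longrightarrow> mat_op (idx r) (mtx r (mat 1)) v = v"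
  by (auto simp: mat_op_def fun_eq_iff mtx_one supported_on_def delta_mult)

lemma hip_mat_op_adj:
  assumes r: "star_rep r" and g: "g \<in> SL3"
  shows "hip (idx r) v (mat_op (idx r) (mtx r g) w) = hip (idx r) (mat_op (idx r) (mtx r (adj g)) v) w"
proof -
  have "hip (idx r) v (mat_op (idx r) (mtx r g) w) =
      (\<Sum>i\<in>idx r. \<Sum>j\<in>idx r. cnj (v i) * mtx r g i j * w j)"
    by (simp add: hip_def mat_op_def sum_distrib_left mult.assoc)
  also have "\<dots> = (\<Sum>j\<in>idx r. \<Sum>i\<in>idx r. cnj (v i) * mtx r g i j * w j)"
    by (rule sum.swap)
  also have "\<dots> = hip (idx r) (mat_op (idx r) (mtx r (adj g)) v) w"
    by (simp add: hip_def mat_op_def sum_distrib_right sum_distrib_left star_repD[OF r g] mult_ac)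
  finally show ?thesis .
qed

definition invariant :: "'i rep \<Rightarrow> ('i \<Rightarrow> complex) set \<Rightarrow> bool" where
  "invariant r W \<longleftrightarrow> fn.subspace W \<and> W \<subseteq> supported_on (idx r) \<and>
     (\<forall>g\<in>SL3. \<forall>v\<in>W. mat_op (idx r) (mtx r g) v \<in> W)"

text \<open>The adjoint of the operator of \<open>g\<close> is the operator of \<open>adj g\<close>,
  which lies in \<open>SL3\<close> and hence preserves \<open>W\<close>; so \<open>g\<close>
  preserves the complement. Complete reducibility rests on this.\<close>

lemma invariant_ortho_compl:
  assumes r: "star_rep r" and W: "invariant r W"
  shows "invariant r (ortho_compl (idx r) W)"
  unfolding invariant_def
proof (intro conjI ballI)
  fix g v assume g: "g \<in> SL3" and v: "v \<in> ortho_compl (idx r) W"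
  have "hip (idx r) w (mat_op (idx r) (mtx r g) v) = 0" if "w \<in> W" for w
    using v W that adj_SL3[OF g] by (simp add: hip_mat_op_adj[OF r g] ortho_compl_def invariant_def)
  then show "mat_op (idx r) (mtx r g) v \<in> ortho_compl (idx r) W"
    by (simp add: ortho_compl_def mat_op_supported)
qed (simp_all add: subspace_ortho_compl, auto simp: ortho_compl_def)

text \<open>Written in an orthonormal basis of \<open>W\<close>, the restricted operators keep the
  adjoint relation, so the subrepresentation is again unitary. The last clause says that the matrix
  with columns \<open>u i\<close> intertwines \<open>r1\<close> with \<open>r\<close>. Naturals
  serve as indices so that the induction on the dimension stays within one type.\<close>

lemma star_subrep:
  assumes r: "star_rep r" and W: "invariant r W"
  obtains r1 :: "nat rep" and k u where "idx r1 = {..<k}" "star_rep r1" "orthonormal (idx r) k u"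
    "\<And>i. i < k \<Longrightarrow> u i \<in> W"
    "\<And>v. v \<in> W \<Longrightarrow> v = (\<Sum>i<k. fscale (hip (idx r) (u i) v) (u i))"
    "\<And>g i a. g \<in> SL3 \<Longrightarrow> i < k \<Longrightarrow> a \<in> idx r \<Longrightarrow>
       (\<Sum>b\<in>idx r. mtx r g a b * u i b) = (\<Sum>j<k. u j a * mtx r1 g j i)"
proof -
  let ?I = "idx r" and ?op = "\<lambda>g. mat_op (idx r) (mtx r g)"
  have subW: "fn.subspace W" "W \<subseteq> supported_on ?I" using W by (auto simp: invariant_def)
  have inv: "?op g v \<in> W" if "g \<in> SL3" "v \<in> W" for g v using W that by (auto simp: invariant_def)
  obtain k u where on: "orthonormal ?I k u" and uW: "\<And>i. i < k \<Longrightarrow> u i \<in> W"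
    and rec: "\<And>v. v \<in> W \<Longrightarrow> v = (\<Sum>i<k. fscale (hip ?I (u i) v) (u i))"
    using orthonormal_basis_exists[OF finite_idx subW] by blast
  define M where "M g j i = hip ?I (u j) (?op g (u i))" for g j i
  have "is_rep {..<k} M"
    unfolding is_rep_def
  proof (intro conjI ballI)
    fix i j assume ij: "i \<in> {..<k}" "j \<in> {..<k}"
    then show "M (mat 1) i j = (if i = j then 1 else 0)"
      using on uW[of j] subW by (auto simp: M_def mat_op_one orthonormal_def)
    have "M g i j = (\<Sum>a\<in>?I. cnj (u i a) * (\<Sum>b\<in>?I. mtx r g a b * u j b))" for g
      by (simp add: M_def hip_def mat_op_def)
    then show "regular_on_SL3 (\<lambda>g. M g i j)"
      using is_rep_idx_mtx[of r]
      by (auto simp: is_rep_def intro!: regular_on_sum regular_on_mult regular_on_const)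
  next
    fix g h i l assume gh: "g \<in> SL3" "h \<in> SL3" and il: "i \<in> {..<k}" "l \<in> {..<k}"
    have "?op (g ** h) (u l) = ?op g (\<Sum>j<k. fscale (M h j l) (u j))"
      unfolding mat_op_mult[OF gh] using rec[of "?op h (u l)"] inv gh il uW by (simp add: M_def)
    also have "\<dots> = (\<Sum>j<k. fscale (M h j l) (?op g (u j)))" by (rule mat_op_sum)
    finally show "M (g ** h) i l = (\<Sum>j\<in>{..<k}. M g i j * M h j l)"
      by (simp add: M_def[of "g ** h"] hip_sum hip_scale) (simp add: M_def mult.commute)
  qed simp
  then obtain r1 where r1: "idx r1 = {..<k}" "mtx r1 = M" by (rule ex_rep)
  have "M (adj g) i j = cnj (M g j i)" if "g \<in> SL3" for g i j
    unfolding M_def using hip_mat_op_adj[OF r adj_SL3[OF that]] by (simp add: hip_cnj)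
  then have "star_rep r1" by (simp add: star_rep_def r1)
  moreover have "(\<Sum>b\<in>?I. mtx r g a b * u i b) = (\<Sum>j<k. u j a * mtx r1 g j i)"
    if "g \<in> SL3" "i < k" "a \<in> ?I" for g i a
  proof -
    have "(\<Sum>b\<in>?I. mtx r g a b * u i b) = ?op g (u i) a" using that by (simp add: mat_op_def)
    also have "\<dots> = (\<Sum>j<k. fscale (M g j i) (u j)) a"
      unfolding M_def using rec[OF inv[OF that(1) uW[OF that(2)]]] by (rule arg_cong)
    finally show ?thesis by (simp add: sum_fun_apply fscale_def r1 mult.commute)
  qed
  ultimately show ?thesis using that[OF r1(1) _ on uW rec] by blast
qed

text \<open>An internal direct sum given by intertwiners \<open>A\<close> and \<open>B\<close> whose
  columns together form a basis. The columns are not assumed orthonormal, because the copy of a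
  summand inside \<open>s\<close> will be only the linear image of an orthonormal family.\<close>

lemma rep_iso_dsumI:
  assumes A: "\<And>g j i. g \<in> SL3 \<Longrightarrow> j \<in> idx s \<Longrightarrow> i \<in> idx r1 \<Longrightarrow>
      (\<Sum>j'\<in>idx s. mtx s g j j' * A j' i) = (\<Sum>i'\<in>idx r1. A j i' * mtx r1 g i' i)"
    and B: "\<And>g j i. g \<in> SL3 \<Longrightarrow> j \<in> idx s \<Longrightarrow> i \<in> idx r2 \<Longrightarrow>
      (\<Sum>j'\<in>idx s. mtx s g j j' * B j' i) = (\<Sum>i'\<in>idx r2. B j i' * mtx r2 g i' i)"
    and inj: "\<And>c d. (\<And>j. j \<in> idx s \<Longrightarrow> (\<Sum>i\<in>idx r1. A j i * c i) + (\<Sum>i\<in>idx r2. B j i * d i) = 0) \<Longrightarrow>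
      (\<forall>i\<in>idx r1. c i = 0) \<and> (\<forall>i\<in>idx r2. d i = 0)"
    and surj: "\<And>w. \<exists>c d. \<forall>j\<in>idx s. (\<Sum>i\<in>idx r1. A j i * c i) + (\<Sum>i\<in>idx r2. B j i * d i) = w j"
  shows "r1 \<oplus>\<^sub>r r2 \<cong>\<^sub>r s"
proof (rule rep_iso_of_bij_matrix[where X = "\<lambda>j. case_sum (A j) (B j)"])
  fix g j i assume g: "g \<in> SL3" and j: "j \<in> idx s" and i: "i \<in> idx (r1 \<oplus>\<^sub>r r2)"
  then show "(\<Sum>j'\<in>idx s. mtx s g j j' * case_sum (A j') (B j') i) =
      (\<Sum>i'\<in>idx (r1 \<oplus>\<^sub>r r2). case_sum (A j) (B j) i' * mtx (r1 \<oplus>\<^sub>r r2) g i' i)"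
    by (cases i) (simp_all add: in_Plus_iff sum.Plus A B)
next
  fix v i assume v: "\<And>j. j \<in> idx s \<Longrightarrow> (\<Sum>i\<in>idx (r1 \<oplus>\<^sub>r r2). case_sum (A j) (B j) i * v i) = 0"
    and i: "i \<in> idx (r1 \<oplus>\<^sub>r r2)"
  have "(\<forall>i\<in>idx r1. v (Inl i) = 0) \<and> (\<forall>i\<in>idx r2. v (Inr i) = 0)"
    using v by (intro inj) (simp add: sum.Plus)
  then show "v i = 0" using i by auto
next
  fix w
  obtain c d where "\<forall>j\<in>idx s. (\<Sum>i\<in>idx r1. A j i * c i) + (\<Sum>i\<in>idx r2. B j i * d i) = w j"
    using surj by blast
  then show "\<exists>v. \<forall>j\<in>idx s. (\<Sum>i\<in>idx (r1 \<oplus>\<^sub>r r2). case_sum (A j) (B j) i * v i) = w j"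
    by (intro exI[of _ "case_sum c d"]) (simp add: sum.Plus)
qed

section \<open>Characters determine unitary representations\<close>

definition rtrace :: "'i rep \<Rightarrow> complex^3^3 \<Rightarrow> complex" where
  "rtrace r g = (\<Sum>i\<in>idx r. mtx r g i i)"

lemma rtrace_dsum: "rtrace (r \<oplus>\<^sub>r s) g = rtrace r g + rtrace s g"
  by (simp add: rtrace_def sum.Plus)

lemma rtrace_tensor: "rtrace (r \<otimes>\<^sub>r s) g = rtrace r g * rtrace s g"
  by (simp add: rtrace_def sum_product sum.cartesian_product mtx_tensor case_prod_unfold)

lemma rtrace_one: "rtrace r (mat 1) = of_nat (card (idx r))"
  by (simp add: rtrace_def mtx_one)

lemma rtrace_iso: assumes "r \<cong>\<^sub>r s" and g: "g \<in> SL3" shows "rtrace r g = rtrace s g"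
proof -
  obtain P Q where
    PQ: "\<And>i k. i \<in> idx r \<Longrightarrow> k \<in> idx r \<Longrightarrow> (\<Sum>j\<in>idx s. P i j * Q j k) = (if i = k then 1 else 0)"
    and QP: "\<And>j l. j \<in> idx s \<Longrightarrow> l \<in> idx s \<Longrightarrow> (\<Sum>i\<in>idx r. Q j i * P i l) = (if j = l then 1 else 0)"
    and eq: "\<And>i l. i \<in> idx r \<Longrightarrow> l \<in> idx s \<Longrightarrow>
        (\<Sum>k\<in>idx r. mtx r g i k * P k l) = (\<Sum>j\<in>idx s. P i j * mtx s g j l)"
    using assms unfolding rep_iso_def by blast
  have "rtrace r g = (\<Sum>i\<in>idx r. \<Sum>k\<in>idx r. mtx r g i k * (\<Sum>l\<in>idx s. P k l * Q l i))"
    unfolding rtrace_def by (intro sum.cong refl) (simp add: PQ delta_mult)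
  also have "\<dots> = (\<Sum>i\<in>idx r. \<Sum>l\<in>idx s. (\<Sum>j\<in>idx s. P i j * mtx s g j l) * Q l i)"
    unfolding sum_mult_assoc by (intro sum.cong refl) (simp add: eq)
  also have "\<dots> = (\<Sum>i\<in>idx r. \<Sum>l\<in>idx s. \<Sum>j\<in>idx s. Q l i * P i j * mtx s g j l)"
    by (simp add: sum_distrib_left sum_distrib_right mult_ac)
  also have "\<dots> = (\<Sum>l\<in>idx s. \<Sum>i\<in>idx r. \<Sum>j\<in>idx s. Q l i * P i j * mtx s g j l)"
    by (rule sum.swap)
  also have "\<dots> = (\<Sum>l\<in>idx s. \<Sum>j\<in>idx s. \<Sum>i\<in>idx r. Q l i * P i j * mtx s g j l)"
    by (intro sum.cong refl sum.swap)
  also have "\<dots> = rtrace s g"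
    unfolding rtrace_def by (intro sum.cong refl) (simp add: QP delta_mult flip: sum_distrib_right)
  finally show ?thesis .
qed

definition intertwiner :: "'i rep \<Rightarrow> 'j rep \<Rightarrow> ('j \<Rightarrow> 'i \<Rightarrow> complex) \<Rightarrow> bool" where
  "intertwiner r s X \<longleftrightarrow> (\<forall>g\<in>SL3. \<forall>j\<in>idx s. \<forall>i\<in>idx r.
     (\<Sum>j'\<in>idx s. mtx s g j j' * X j' i) = (\<Sum>i'\<in>idx r. X j i' * mtx r g i' i))"

text \<open>If every intertwiner vanished, the orthogonal projection onto the span of the matrices of
  \<open>r \<oplus> s\<close>, which commutes with the action, would fix the block matrix \<open>(1, 0)\<close>; its trace on \<open>r\<close>
  differs from its trace on \<open>s\<close>.\<close>

lemma nonzero_intertwiner_exists: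
  fixes r :: "'i rep" and s :: "'j rep"
  assumes r: "star_rep r" and s: "star_rep s"
    and tr: "\<And>g. g \<in> SL3 \<Longrightarrow> rtrace r g = rtrace s g" and ne: "idx r \<noteq> {}"
  obtains X j i where "intertwiner r s X" "j \<in> idx s" "i \<in> idx r" "X j i \<noteq> 0"
proof (rule ccontr)
  assume "\<not> thesis"
  then have no: "X j i = 0" if "intertwiner r s X" "j \<in> idx s" "i \<in> idx r" for X j i
    using that \<open>\<And>X j i. intertwiner r s X \<Longrightarrow> j \<in> idx s \<Longrightarrow> i \<in> idx r \<Longrightarrow> X j i \<noteq> 0 \<Longrightarrow> thesis\<close> by blast
  let ?R = "r \<oplus>\<^sub>r s"
  define K where "K = idx ?R"
  have finK: "finite K" by (simp add: K_def del: idx_simps)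
  have starR: "star_rep ?R" using r s by (rule star_rep_dsum)
  define D where "D g = (\<lambda>(x, y). if x \<in> K \<and> y \<in> K then mtx ?R g x y else 0)" for g
  define Lm where "Lm g T = (\<lambda>(x, y). if x \<in> K \<and> y \<in> K then \<Sum>z\<in>K. mtx ?R g x z * T (z, y) else 0)"
    for g and T :: "('i + 'j) \<times> ('i + 'j) \<Rightarrow> complex"
  define A where "A = fn.span (D ` SL3)"
  have subA: "fn.subspace A" by (simp add: A_def)
  have DA: "D g \<in> A" if "g \<in> SL3" for g using that by (auto simp: A_def intro: fn.span_base)
  have "D ` SL3 \<subseteq> supported_on (K \<times> K)" by (auto simp: D_def supported_on_def)
  then have suppA: "A \<subseteq> supported_on (K \<times> K)"
    unfolding A_def by (rule fn.span_minimal[OF _ subspace_supported])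
  have LA: "Lm g T \<in> A" if g: "g \<in> SL3" and T: "T \<in> A" for g T
    using T unfolding A_def
  proof (induction rule: fn.span_induct_alt)
    case base
    have "Lm g 0 = 0" by (auto simp: Lm_def)
    then show ?case by (simp only: fn.span_zero)
  next
    case (step c x y)
    then obtain h where h: "h \<in> SL3" "x = D h" by auto
    have "Lm g x = D (g ** h)"
      using is_repD[OF g h(1), of _ ?R] by (auto simp: Lm_def D_def h K_def fun_eq_iff simp del: idx_simps)
    moreover have "Lm g (fscale c x + y) = fscale c (Lm g x) + Lm g y"
      by (auto simp: Lm_def fscale_def fun_eq_iff algebra_simps sum.distrib sum_distrib_left)
    moreover have "D (g ** h) \<in> fn.span (D ` SL3)"
      using h g by (intro fn.span_base) auto
    ultimately show ?case
      using step by (simp only: fn.span_add fn.span_scale)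
  qed
  obtain k u where u: "orthonormal (K \<times> K) k u" "\<And>i. i < k \<Longrightarrow> u i \<in> A"
    and rec: "\<And>v. v \<in> A \<Longrightarrow> v = (\<Sum>i<k. fscale (hip (K \<times> K) (u i) v) (u i))"
    using orthonormal_basis_exists[OF _ subA suppA] finK by blast
  have rec': "v x = (\<Sum>i<k. hip (K \<times> K) (u i) v * u i x)" if "v \<in> A" for v x
    using arg_cong[OF rec[OF that], of "\<lambda>f. f x"] by (simp add: sum_fun_apply fscale_def)
  \<comment> \<open>The matrix of the orthogonal projection onto \<open>A\<close>, at row
    \<open>(x, y)\<close> and column \<open>(z, w)\<close>.\<close>
  define P where "P x y z w = (\<Sum>i<k. u i (x, y) * cnj (u i (z, w)))" for x y z w
  have P_cnj: "P x y z w = cnj (P z w x y)" for x y z w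
    by (simp add: P_def mult.commute)
  have starK: "mtx ?R (adj g) x y = cnj (mtx ?R g y x)" if "g \<in> SL3" "x \<in> K" "y \<in> K" for g x y
    using star_repD[OF starR] that by (simp only: K_def)
  have sumKK: "(\<Sum>q\<in>K \<times> K. f q) = (\<Sum>x\<in>K. \<Sum>y\<in>K. f (x, y))"
    for f :: "('i + 'j) \<times> ('i + 'j) \<Rightarrow> complex"
    by (simp add: sum.cartesian_product)
  have adjL: "hip (K \<times> K) T (Lm g U) = cnj (hip (K \<times> K) U (Lm (adj g) T))" if g: "g \<in> SL3" for g T U
  proof -
    have "hip (K \<times> K) T (Lm g U) = (\<Sum>x\<in>K. \<Sum>y\<in>K. \<Sum>z\<in>K. cnj (T (x, y)) * (mtx ?R g x z * U (z, y)))"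
      by (simp add: hip_def Lm_def sumKK sum_distrib_left)
    also have "\<dots> = (\<Sum>y\<in>K. \<Sum>x\<in>K. \<Sum>z\<in>K. cnj (T (x, y)) * (mtx ?R g x z * U (z, y)))"
      by (rule sum.swap)
    also have "\<dots> = (\<Sum>y\<in>K. \<Sum>z\<in>K. \<Sum>x\<in>K. cnj (T (x, y)) * (mtx ?R g x z * U (z, y)))"
      by (intro sum.cong refl sum.swap)
    also have "\<dots> = (\<Sum>z\<in>K. \<Sum>y\<in>K. \<Sum>x\<in>K. cnj (T (x, y)) * (mtx ?R g x z * U (z, y)))"
      by (rule sum.swap)
    also have "\<dots> = cnj (hip (K \<times> K) U (Lm (adj g) T))"
      by (simp add: hip_def Lm_def sumKK sum_distrib_left starK[OF g] mult_ac)
    finally show ?thesis .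
  qed
  \<comment> \<open>The adjoint of left multiplication by \<open>g\<close> is left multiplication by
    \<open>adj g\<close>, and both preserve \<open>A\<close>, so the projection commutes with left
    multiplication. With \<open>y\<close> and \<open>w\<close> held fixed, \<open>P\<close> is
    therefore an intertwiner in \<open>x\<close> and \<open>z\<close>, and its mixed blocks must
    vanish.\<close>
  have comm: "(\<Sum>x'\<in>K. mtx ?R g x x' * P x' y z w) = (\<Sum>z'\<in>K. P x y z' w * mtx ?R g z' z)"
    if g: "g \<in> SL3" and K: "x \<in> K" "y \<in> K" "z \<in> K" "w \<in> K" for g x y z w
  proof -
    let ?h = "\<lambda>i j. hip (K \<times> K) (u i) (Lm g (u j))"
    have "(\<Sum>x'\<in>K. mtx ?R g x x' * P x' y z w) = (\<Sum>i<k. Lm g (u i) (x, y) * cnj (u i (z, w)))"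
      unfolding P_def sum_mult_assoc using K by (simp add: Lm_def)
    also have "\<dots> = (\<Sum>i<k. \<Sum>j<k. ?h j i * u j (x, y) * cnj (u i (z, w)))"
      by (intro sum.cong refl) (simp add: rec'[OF LA[OF g u(2)]] sum_distrib_right)
    also have "\<dots> = (\<Sum>j<k. \<Sum>i<k. ?h j i * u j (x, y) * cnj (u i (z, w)))"
      by (rule sum.swap)
    also have "\<dots> = (\<Sum>j<k. u j (x, y) * cnj (\<Sum>i<k. hip (K \<times> K) (u i) (Lm (adj g) (u j)) * u i (z, w)))"
      by (simp add: adjL[OF g] sum_distrib_left mult_ac)
    also have "\<dots> = (\<Sum>j<k. u j (x, y) * cnj (Lm (adj g) (u j) (z, w)))"
      by (intro sum.cong refl) (simp add: rec'[OF LA[OF adj_SL3[OF g] u(2)], of _ "(z, w)"])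
    also have "\<dots> = (\<Sum>j<k. u j (x, y) * (\<Sum>z'\<in>K. cnj (u j (z', w)) * mtx ?R g z' z))"
      using K by (simp add: Lm_def starK[OF g] mult_ac)
    also have "\<dots> = (\<Sum>z'\<in>K. P x y z' w * mtx ?R g z' z)"
      unfolding P_def sum_mult_assoc ..
    finally show ?thesis .
  qed
  have KI: "Inl i \<in> K \<longleftrightarrow> i \<in> idx r" "Inr j \<in> K \<longleftrightarrow> j \<in> idx s" for i j
    by (simp_all add: K_def in_Plus_iff)
  have sumK: "(\<Sum>x\<in>K. f x) = (\<Sum>i\<in>idx r. f (Inl i)) + (\<Sum>j\<in>idx s. f (Inr j))" for f :: "_ \<Rightarrow> complex"
    by (simp add: K_def sum.Plus)
  have P0: "P (Inr j) y (Inl i) w = 0" if "i \<in> idx r" "j \<in> idx s" "y \<in> K" "w \<in> K" for i j y w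
  proof (rule no[of "\<lambda>j i. P (Inr j) y (Inl i) w"])
    show "intertwiner r s (\<lambda>j i. P (Inr j) y (Inl i) w)"
      unfolding intertwiner_def
    proof (intro ballI)
      fix g j i assume "g \<in> SL3" "j \<in> idx s" "i \<in> idx r"
      then show "(\<Sum>j'\<in>idx s. mtx s g j j' * P (Inr j') y (Inl i) w) =
          (\<Sum>i'\<in>idx r. P (Inr j) y (Inl i') w * mtx r g i' i)"
        using comm[of g "Inr j" y "Inl i" w] that by (simp add: sumK KI)
    qed
  qed (use that in auto)
  then have P0': "P (Inl i) y (Inr j) w = 0" if "i \<in> idx r" "j \<in> idx s" "y \<in> K" "w \<in> K" for i j y w
    using P_cnj[of "Inl i" y] that by simp
  define e :: "('i + 'j) \<times> ('i + 'j) \<Rightarrow> complex"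
    where "e = (\<lambda>(x, y). if x = y \<and> x \<in> Inl ` idx r then 1 else 0)"
  define e' where "e' = (\<Sum>i<k. fscale (hip (K \<times> K) (u i) e) (u i))"
  have e'A: "e' \<in> A"
    unfolding e'_def by (intro fn.subspace_sum[OF subA] fn.subspace_scale[OF subA] u(2)) simp
  have Pe: "(\<Sum>i<k. hip (K \<times> K) (u i) T * u i (x, y)) = (\<Sum>z\<in>K. \<Sum>w\<in>K. P x y z w * T (z, w))"
    for T x y
  proof -
    have "(\<Sum>i<k. u i (x, y) * (\<Sum>q\<in>K \<times> K. cnj (u i q) * T q)) =
        (\<Sum>q\<in>K \<times> K. (\<Sum>i<k. u i (x, y) * cnj (u i q)) * T q)"
      by (rule sum_mult_assoc)
    then show ?thesis
      by (simp add: hip_def P_def sum.cartesian_product case_prod_unfold mult.commute)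
  qed
  let ?one = "D (mat 1)"
  \<comment> \<open>Diagonal entries suffice, since only traces are compared. In the rows of
    \<open>s\<close> the vanishing blocks kill every term; in the rows of \<open>r\<close> they
    allow \<open>e\<close> to be replaced by the identity, which lies in \<open>A\<close> and is
    fixed by the projection.\<close>
  have e'e: "e' (x, x) = e (x, x)" if x: "x \<in> K" for x
  proof (cases x)
    case (Inr j)
    then have "e' (x, x) = (\<Sum>z\<in>K. \<Sum>w\<in>K. P x x z w * e (z, w))"
      by (simp add: e'_def sum_fun_apply fscale_def Pe)
    also have "\<dots> = 0" using x Inr by (intro sum.neutral ballI) (auto simp: e_def P0 KI)
    finally show ?thesis using Inr by (auto simp: e_def)
  next
    case (Inl i)
    have "e' (x, x) = (\<Sum>z\<in>K. \<Sum>w\<in>K. P x x z w * e (z, w))"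
      by (simp add: e'_def sum_fun_apply fscale_def Pe)
    also have "\<dots> = (\<Sum>z\<in>K. \<Sum>w\<in>K. P x x z w * ?one (z, w))"
    proof (intro sum.cong refl)
      fix z w assume zw: "z \<in> K" "w \<in> K"
      show "P x x z w * e (z, w) = P x x z w * ?one (z, w)"
        using zw x Inl P0'[of i _ x w] mtx_one[of z ?R w]
        by (cases z) (auto simp: e_def D_def KI K_def in_Plus_iff)
    qed
    also have "\<dots> = ?one (x, x)"
      by (simp add: rec'[OF DA[OF SL3_one], of "(x, x)"] Pe)
    also have "\<dots> = e (x, x)" using x Inl mtx_one[of x ?R x] by (auto simp: D_def e_def KI K_def)
    finally show ?thesis .
  qed
  \<comment> \<open>A linear functional that vanishes on every \<open>D h\<close> by equality of the
    traces, hence on \<open>A\<close>, but takes the dimension of \<open>r\<close> as its value at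
    \<open>e'\<close>.\<close>
  define t where "t T = (\<Sum>i\<in>idx r. T (Inl i, Inl i)) - (\<Sum>j\<in>idx s. T (Inr j, Inr j))"
    for T :: "('i + 'j) \<times> ('i + 'j) \<Rightarrow> complex"
  have "t T = 0" if "T \<in> A" for T
    using that unfolding A_def
  proof (induction rule: fn.span_induct_alt)
    case base
    then show ?case by (simp add: t_def)
  next
    case (step c x y)
    then obtain h where h: "h \<in> SL3" "x = D h" by auto
    have "t x = 0" using tr[OF h(1)] by (simp add: t_def h D_def KI rtrace_def)
    moreover have "t (fscale c x + y) = c * t x + t y"
      by (simp add: t_def fscale_def sum.distrib sum_distrib_left algebra_simps)
    ultimately show ?case using step by (simp only: mult_zero_right add_0_right)
  qed
  then have "t e' = 0" using e'A by blast
  moreover have "t e' = of_nat (card (idx r))"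
    by (simp add: t_def e'e KI) (simp add: e_def image_iff)
  ultimately show False using ne by simp
qed

text \<open>Strong induction on the dimension of \<open>r\<close>. A nonzero intertwiner is an
  isomorphism from the complement of its kernel to its image, so the representation
  \<open>r1\<close> on that complement is a common summand: \<open>r\<close> is \<open>r1\<close>
  plus the kernel \<open>r2\<close>, and \<open>s\<close> is \<open>r1\<close> plus the complement
  \<open>s2\<close> of the image. Subtracting the trace of \<open>r1\<close> leaves
  \<open>r2\<close> and \<open>s2\<close> with equal traces.\<close>

theorem rep_iso_of_rtrace_eq:
  fixes r s :: "nat rep"
  assumes "star_rep r" "star_rep s" "\<And>g. g \<in> SL3 \<Longrightarrow> rtrace r g = rtrace s g"
  shows "r \<cong>\<^sub>r s"
  using assms
proof (induction "card (idx r)" arbitrary: r s rule: less_induct)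
  case less
  note r = less.prems(1) and s = less.prems(2) and tr = less.prems(3)
  show ?case
  proof (cases "idx r = {}")
    case True
    have "of_nat (card (idx s)) = (0 :: complex)"
      using tr[OF SL3_one] True by (simp add: rtrace_one)
    then have "idx s = {}" by simp
    then show ?thesis using True by (simp add: rep_iso_def)
  next
    case False
    obtain X j0 i0 where X: "intertwiner r s X" and X0: "j0 \<in> idx s" "i0 \<in> idx r" "X j0 i0 \<noteq> 0"
      using nonzero_intertwiner_exists[OF r s tr False] by blast
    have XD: "(\<Sum>j'\<in>idx s. mtx s g j j' * X j' i) = (\<Sum>i'\<in>idx r. X j i' * mtx r g i' i)"
      if "g \<in> SL3" "j \<in> idx s" "i \<in> idx r" for g i j
      using X that by (simp add: intertwiner_def)
    define Xv where "Xv v = (\<lambda>j. if j \<in> idx s then \<Sum>i\<in>idx r. X j i * v i else 0)" for v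
    have Xv_add: "Xv (v + w) = Xv v + Xv w" and Xv_scale: "Xv (fscale c v) = fscale c (Xv v)"
      and Xv_0: "Xv 0 = 0" for v w c
      by (auto simp: Xv_def fun_eq_iff fscale_def algebra_simps sum.distrib sum_distrib_left)
    have Xv_op: "Xv (mat_op (idx r) (mtx r g) v) = mat_op (idx s) (mtx s g) (Xv v)" if "g \<in> SL3" for g v
      by (auto simp: Xv_def fun_eq_iff mat_op_def sum_mult_assoc XD[OF that])
    define K where "K = {v \<in> supported_on (idx r). Xv v = 0}"
    have invK: "invariant r K"
      using subspace_supported[of "idx r"]
      by (auto simp: invariant_def K_def fn.subspace_def Xv_add Xv_scale Xv_0 Xv_op mat_op_supported
          simp flip: zero_fun_def) (simp_all add: mat_op_def fun_eq_iff fscale_def)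
    define W where "W = Xv ` supported_on (idx r)"
    have invW: "invariant s W"
      unfolding invariant_def
    proof (intro conjI ballI)
      show "fn.subspace W" unfolding fn.subspace_def W_def
      proof (intro conjI ballI allI)
        have S: "fn.subspace (supported_on (idx r))" by (rule subspace_supported)
        show "0 \<in> Xv ` supported_on (idx r)" using Xv_0 fn.subspace_0[OF S] by (metis image_eqI)
        fix x y assume "x \<in> Xv ` supported_on (idx r)" "y \<in> Xv ` supported_on (idx r)"
        then obtain v w where "v \<in> supported_on (idx r)" "w \<in> supported_on (idx r)" "x = Xv v" "y = Xv w"
          by blast
        then show "x + y \<in> Xv ` supported_on (idx r)"
          by (intro image_eqI[where x = "v + w"] fn.subspace_add[OF S]) (simp_all add: Xv_add)
      next
        fix c x assume "x \<in> Xv ` supported_on (idx r)"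
        then obtain v where "v \<in> supported_on (idx r)" "x = Xv v" by blast
        then show "fscale c x \<in> Xv ` supported_on (idx r)"
          by (intro image_eqI[where x = "fscale c v"] fn.subspace_scale[OF subspace_supported])
            (simp_all add: Xv_scale)
      qed
      show "W \<subseteq> supported_on (idx s)" by (auto simp: W_def Xv_def supported_on_def)
      fix g v assume "g \<in> SL3" "v \<in> W"
      then show "mat_op (idx s) (mtx s g) v \<in> W"
        by (auto simp: W_def Xv_op[symmetric] mat_op_supported)
    qed
    have subs: "fn.subspace K" "K \<subseteq> supported_on (idx r)" "fn.subspace W" "W \<subseteq> supported_on (idx s)"
      using invK invW by (auto simp: invariant_def)
    obtain r1 :: "nat rep" and k u where r1: "idx r1 = {..<k}" "star_rep r1"
      and u_in: "\<And>i. i < k \<Longrightarrow> u i \<in> ortho_compl (idx r) K"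
      and u: "orthonormal (idx r) k u"
      and u_rec: "\<And>v. v \<in> ortho_compl (idx r) K \<Longrightarrow> v = (\<Sum>i<k. fscale (hip (idx r) (u i) v) (u i))"
      and u_eq: "\<And>g i a. g \<in> SL3 \<Longrightarrow> i < k \<Longrightarrow> a \<in> idx r \<Longrightarrow>
        (\<Sum>b\<in>idx r. mtx r g a b * u i b) = (\<Sum>j<k. u j a * mtx r1 g j i)"
      by (rule star_subrep[OF r invariant_ortho_compl[OF r invK]]) blast
    obtain r2 :: "nat rep" and l v where r2: "idx r2 = {..<l}" "star_rep r2"
      and v_in: "\<And>i. i < l \<Longrightarrow> v i \<in> K"
      and v: "orthonormal (idx r) l v"
      and v_rec: "\<And>x. x \<in> K \<Longrightarrow> x = (\<Sum>i<l. fscale (hip (idx r) (v i) x) (v i))"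
      and v_eq: "\<And>g i a. g \<in> SL3 \<Longrightarrow> i < l \<Longrightarrow> a \<in> idx r \<Longrightarrow>
        (\<Sum>b\<in>idx r. mtx r g a b * v i b) = (\<Sum>j<l. v j a * mtx r2 g j i)"
      by (rule star_subrep[OF r invK]) blast
    obtain s2 :: "nat rep" and m z where s2: "idx s2 = {..<m}" "star_rep s2"
      and z_in: "\<And>i. i < m \<Longrightarrow> z i \<in> ortho_compl (idx s) W"
      and z: "orthonormal (idx s) m z"
      and z_rec: "\<And>x. x \<in> ortho_compl (idx s) W \<Longrightarrow> x = (\<Sum>i<m. fscale (hip (idx s) (z i) x) (z i))"
      and z_eq: "\<And>g i a. g \<in> SL3 \<Longrightarrow> i < m \<Longrightarrow> a \<in> idx s \<Longrightarrow>
        (\<Sum>b\<in>idx s. mtx s g a b * z i b) = (\<Sum>j<m. z j a * mtx s2 g j i)"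
      by (rule star_subrep[OF s invariant_ortho_compl[OF s invW]]) blast
    have orth_coeff: "c i = 0" if "orthonormal I n w" "(\<Sum>i<n. fscale (c i) (w i)) = 0" "i < n"
      for I :: "nat set" and n c w i
    proof -
      have "hip I (w i) (\<Sum>i<n. fscale (c i) (w i)) = c i"
        using that(1,3) by (simp add: hip_sum hip_scale orthonormal_def delta_mult)
      then show ?thesis unfolding that(2) by (simp add: hip_def)
    qed
    have meet: "x = 0" if "x \<in> B" "x \<in> ortho_compl I B" "finite I" for I :: "nat set" and x B
      using that hip_self_eq_0[of I x] by (auto simp: ortho_compl_def supported_on_def fun_eq_iff)
    have comb: "(\<Sum>i<n. fscale (c i) (w i)) \<in> B" if "fn.subspace B" "\<And>i. i < n \<Longrightarrow> w i \<in> B"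
      for B :: "(nat \<Rightarrow> complex) set" and n c w
      using that by (intro fn.subspace_sum fn.subspace_scale) auto
    have iso1: "r1 \<oplus>\<^sub>r r2 \<cong>\<^sub>r r"
    proof (rule rep_iso_dsumI[where A = "\<lambda>a i. u i a" and B = "\<lambda>a i. v i a"])
      fix c d assume *: "\<And>j. j \<in> idx r \<Longrightarrow> (\<Sum>i\<in>idx r1. u i j * c i) + (\<Sum>i\<in>idx r2. v i j * d i) = 0"
      define x where "x = (\<Sum>i<k. fscale (c i) (u i))"
      define y where "y = (\<Sum>i<l. fscale (d i) (v i))"
      have xK: "x \<in> ortho_compl (idx r) K" unfolding x_def by (intro comb subspace_ortho_compl u_in)
      have yK: "y \<in> K" unfolding y_def by (intro comb subs v_in)
      have "x + y = 0"
      proof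
        fix j
        show "(x + y) j = 0 j"
        proof (cases "j \<in> idx r")
          case True
          then show ?thesis using *[OF True] by (simp add: x_def y_def sum_fun_apply fscale_def r1 r2 mult.commute)
        next
          case False
          then show ?thesis using xK yK by (simp add: ortho_compl_def K_def supported_on_def)
        qed
      qed
      then have "x = fscale (-1) y" by (simp add: eq_neg_iff_add_eq_0 fun_eq_iff fscale_def)
      then have "x = 0" using meet[of x K "idx r"] xK fn.subspace_scale[OF subs(1) yK, of "-1"] by simp
      then have "y = 0" using \<open>x + y = 0\<close> by simp
      show "(\<forall>i\<in>idx r1. c i = 0) \<and> (\<forall>i\<in>idx r2. d i = 0)"
        using orth_coeff[OF u, of c] orth_coeff[OF v, of d] \<open>x = 0\<close> \<open>y = 0\<close>
        by (auto simp: x_def y_def r1 r2)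
    next
      fix w :: "nat \<Rightarrow> complex"
      define w' where "w' = (\<lambda>i. if i \<in> idx r then w i else 0)"
      obtain y x where xy: "y \<in> K" "x \<in> ortho_compl (idx r) K" "w' = y + x"
        by (rule ortho_decomp[OF finite_idx subs(1,2), of w']) (auto simp: w'_def supported_on_def)
      show "\<exists>c d. \<forall>j\<in>idx r. (\<Sum>i\<in>idx r1. u i j * c i) + (\<Sum>i\<in>idx r2. v i j * d i) = w j"
      proof (intro exI ballI)
        fix j assume j: "j \<in> idx r"
        have "w j = y j + x j" using j xy(3) by (simp add: w'_def fun_eq_iff) metis
        also have "y j = (\<Sum>i<l. fscale (hip (idx r) (v i) y) (v i)) j" using v_rec[OF xy(1)] by simp
        also have "x j = (\<Sum>i<k. fscale (hip (idx r) (u i) x) (u i)) j" using u_rec[OF xy(2)] by simp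
        finally show "(\<Sum>i\<in>idx r1. u i j * hip (idx r) (u i) x) + (\<Sum>i\<in>idx r2. v i j * hip (idx r) (v i) y) = w j"
          by (simp add: sum_fun_apply fscale_def r1 r2 mult.commute)
      qed
    qed (simp_all add: u_eq v_eq r1 r2)
    have iso2: "r1 \<oplus>\<^sub>r s2 \<cong>\<^sub>r s"
    proof (rule rep_iso_dsumI[where A = "\<lambda>j i. Xv (u i) j" and B = "\<lambda>a i. z i a"])
      fix g j i assume g: "g \<in> SL3" and j: "j \<in> idx s" and i: "i \<in> idx r1"
      have "(\<Sum>j'\<in>idx s. mtx s g j j' * Xv (u i) j') = mat_op (idx s) (mtx s g) (Xv (u i)) j"
        using j by (simp add: mat_op_def)
      also have "\<dots> = Xv (mat_op (idx r) (mtx r g) (u i)) j" by (simp add: Xv_op[OF g])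
      also have "\<dots> = (\<Sum>a\<in>idx r. X j a * (\<Sum>i'<k. u i' a * mtx r1 g i' i))"
        using j i by (simp add: Xv_def mat_op_def u_eq[OF g] r1)
      also have "\<dots> = (\<Sum>i'\<in>idx r1. Xv (u i') j * mtx r1 g i' i)"
        unfolding sum_mult_assoc using j by (simp add: Xv_def r1)
      finally show "(\<Sum>j'\<in>idx s. mtx s g j j' * Xv (u i) j') = (\<Sum>i'\<in>idx r1. Xv (u i') j * mtx r1 g i' i)" .
    next
      fix c d assume *: "\<And>j. j \<in> idx s \<Longrightarrow> (\<Sum>i\<in>idx r1. Xv (u i) j * c i) + (\<Sum>i\<in>idx s2. z i j * d i) = 0"
      define x where "x = (\<Sum>i<k. fscale (c i) (u i))"
      define y where "y = (\<Sum>i<m. fscale (d i) (z i))"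
      have xK: "x \<in> ortho_compl (idx r) K" unfolding x_def by (intro comb subspace_ortho_compl u_in)
      have yW: "y \<in> ortho_compl (idx s) W" unfolding y_def by (intro comb subspace_ortho_compl z_in)
      have XvW: "Xv x \<in> W" using xK by (auto simp: W_def ortho_compl_def)
      have Xx: "Xv x j = (\<Sum>i<k. Xv (u i) j * c i)" if "j \<in> idx s" for j
      proof -
        have "Xv x j = (\<Sum>a\<in>idx r. X j a * (\<Sum>i<k. u i a * c i))"
          using that by (simp add: Xv_def x_def sum_fun_apply fscale_def mult.commute)
        then show ?thesis unfolding sum_mult_assoc using that by (simp add: Xv_def)
      qed
      have "Xv x + y = 0"
      proof
        fix j
        show "(Xv x + y) j = 0 j"
        proof (cases "j \<in> idx s")
          case True
          then show ?thesis
            using *[OF True] by (simp add: Xx y_def sum_fun_apply fscale_def r1 s2 mult.commute)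
        next
          case False
          then show ?thesis using yW XvW subs(4) by (auto simp: ortho_compl_def supported_on_def)
        qed
      qed
      then have "y = fscale (-1) (Xv x)" by (simp add: eq_neg_iff_add_eq_0 fun_eq_iff fscale_def add.commute)
      then have "y = 0" using meet[of y W "idx s"] yW fn.subspace_scale[OF subs(3) XvW, of "-1"] by simp
      then have "Xv x = 0" using \<open>Xv x + y = 0\<close> by simp
      then have "x \<in> K" using xK by (simp add: K_def ortho_compl_def)
      then have "x = 0" using meet[of x K "idx r"] xK by simp
      show "(\<forall>i\<in>idx r1. c i = 0) \<and> (\<forall>i\<in>idx s2. d i = 0)"
        using orth_coeff[OF u, of c] orth_coeff[OF z, of d] \<open>x = 0\<close> \<open>y = 0\<close>
        by (auto simp: x_def y_def r1 s2)
    next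
      fix w :: "nat \<Rightarrow> complex"
      define w' where "w' = (\<lambda>i. if i \<in> idx s then w i else 0)"
      obtain y' x where xy: "y' \<in> W" "x \<in> ortho_compl (idx s) W" "w' = y' + x"
        by (rule ortho_decomp[OF finite_idx subs(3,4), of w']) (auto simp: w'_def supported_on_def)
      obtain t where t: "t \<in> supported_on (idx r)" "y' = Xv t" using xy(1) by (auto simp: W_def)
      obtain p q where pq: "p \<in> K" "q \<in> ortho_compl (idx r) K" "t = p + q"
        by (rule ortho_decomp[OF finite_idx subs(1,2) t(1)]) blast
      have y'q: "y' = Xv q" using pq(1) by (simp add: t(2) pq(3) Xv_add K_def)
      show "\<exists>c d. \<forall>j\<in>idx s. (\<Sum>i\<in>idx r1. Xv (u i) j * c i) + (\<Sum>i\<in>idx s2. z i j * d i) = w j"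
      proof (intro exI ballI)
        fix j assume j: "j \<in> idx s"
        have qa: "q a = (\<Sum>i<k. u i a * hip (idx r) (u i) q)" for a
        proof -
          have "q a = (\<Sum>i<k. fscale (hip (idx r) (u i) q) (u i)) a"
            using u_rec[OF pq(2)] by (rule fun_cong)
          then show ?thesis by (simp only: sum_fun_apply fscale_def mult.commute)
        qed
        have "Xv q j = (\<Sum>a\<in>idx r. X j a * q a)" using j by (simp add: Xv_def)
        also have "\<dots> = (\<Sum>a\<in>idx r. X j a * (\<Sum>i<k. u i a * hip (idx r) (u i) q))"
          by (simp only: qa)
        also have "\<dots> = (\<Sum>i<k. Xv (u i) j * hip (idx r) (u i) q)"
          unfolding sum_mult_assoc using j by (simp add: Xv_def)
        finally have Xq: "Xv q j = (\<Sum>i<k. Xv (u i) j * hip (idx r) (u i) q)" .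
        have "w j = Xv q j + x j" using j xy(3) y'q by (simp add: w'_def fun_eq_iff) metis
        also have "x j = (\<Sum>i<m. fscale (hip (idx s) (z i) x) (z i)) j" using z_rec[OF xy(2)] by simp
        finally show "(\<Sum>i\<in>idx r1. Xv (u i) j * hip (idx r) (u i) q) + (\<Sum>i\<in>idx s2. z i j * hip (idx s) (z i) x) = w j"
          by (simp add: sum_fun_apply fscale_def r1 s2 mult.commute Xq)
      qed
    qed (simp_all add: z_eq s2)
    \<comment> \<open>A trivial complement would make \<open>Xv\<close> vanish, against
      \<open>X j0 i0 \<noteq> 0\<close>; so the kernel is smaller than \<open>r\<close> and the
      induction hypothesis applies.\<close>
    have "k > 0"
    proof (rule ccontr)
      assume "\<not> k > 0"
      let ?e = "unit_fun i0 :: nat \<Rightarrow> complex"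
      have e: "?e \<in> supported_on (idx r)" using X0 by (auto simp: supported_on_def unit_fun_def)
      obtain p q where pq: "p \<in> K" "q \<in> ortho_compl (idx r) K" "?e = p + q"
        by (rule ortho_decomp[OF finite_idx subs(1,2) e]) blast
      have "q = 0" using u_rec[OF pq(2)] \<open>\<not> k > 0\<close> by simp
      then have "Xv ?e = 0" using pq by (simp add: K_def)
      then have "Xv ?e j0 = 0" by simp
      then show False using X0 by (simp add: Xv_def unit_fun_def delta_mult)
    qed
    then have "card (idx r2) < card (idx r)"
      using rep_iso_card[OF iso1] by (simp add: card_Plus r1 r2)
    moreover have "rtrace r2 g = rtrace s2 g" if "g \<in> SL3" for g
    proof -
      have "rtrace r1 g + rtrace r2 g = rtrace r1 g + rtrace s2 g"
        using rtrace_iso[OF iso1 that] rtrace_iso[OF iso2 that] tr[OF that] by (simp only: rtrace_dsum)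
      then show ?thesis by simp
    qed
    ultimately have "r2 \<cong>\<^sub>r s2" using less.hyps[of r2 s2] r2 s2 by simp
    then have "r1 \<oplus>\<^sub>r r2 \<cong>\<^sub>r r1 \<oplus>\<^sub>r s2" by (intro dsum_cong rep_iso_refl)
    then show ?thesis
      using rep_iso_trans[OF rep_iso_sym[OF iso1] rep_iso_trans[OF _ iso2]] by blast
  qed
qed

section \<open>Symmetric powers of unitarizable representations\<close>

text \<open>Unitarity with respect to the Hermitian form with diagonal Gram matrix \<open>w\<close>.\<close>

definition wstar_rep :: "'i rep \<Rightarrow> bool" where
  "wstar_rep r \<longleftrightarrow> (\<exists>w :: 'i \<Rightarrow> real. (\<forall>i\<in>idx r. w i > 0) \<and>
     (\<forall>g\<in>SL3. \<forall>i\<in>idx r. \<forall>j\<in>idx r.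
        of_real (w i) * mtx r (adj g) i j = cnj (mtx r g j i) * of_real (w j)))"

lemma wstar_std_rep: "wstar_rep std_rep"
  unfolding wstar_rep_def by (intro exI[of _ "\<lambda>_. 1"]) simp

text \<open>Conjugation by the diagonal matrix of the square roots of \<open>w\<close> turns the
  weighted Hermitian form into the standard one.\<close>

lemma wstar_rep_imp_star_rep:
  fixes r :: "'i rep"
  assumes "wstar_rep r"
  obtains s :: "nat rep" where "star_rep s" "s \<cong>\<^sub>r r"
proof -
  obtain w :: "'i \<Rightarrow> real" where w0: "\<And>i. i \<in> idx r \<Longrightarrow> w i > 0"
    and w: "\<And>g i j. g \<in> SL3 \<Longrightarrow> i \<in> idx r \<Longrightarrow> j \<in> idx r \<Longrightarrow>
        of_real (w i) * mtx r (adj g) i j = cnj (mtx r g j i) * of_real (w j)"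
    using assms unfolding wstar_rep_def by blast
  define q where "q i = complex_of_real (sqrt (w i))" for i
  have q0: "q i \<noteq> 0" and qq: "q i * q i = of_real (w i)" and cq: "cnj (q i) = q i"
    if "i \<in> idx r" for i
    using w0[OF that] by (simp_all add: q_def flip: of_real_mult)
  define M where "M g i j = q i * mtx r g i j * (1 / q j)" for g i j
  have "is_rep (idx r) M"
    unfolding is_rep_def
  proof (intro conjI ballI)
    fix i j assume ij: "i \<in> idx r" "j \<in> idx r"
    then show "M (mat 1) i j = (if i = j then 1 else 0)"
      using q0 by (simp add: M_def mtx_one)
    have "regular_on_SL3 (\<lambda>g. mtx r g i j)"
      using is_rep_idx_mtx[of r] ij by (simp add: is_rep_def)
    then show "regular_on_SL3 (\<lambda>g. M g i j)"
      unfolding M_def by (intro regular_on_mult regular_on_const)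
  next
    fix g h i k assume "g \<in> SL3" "h \<in> SL3" "i \<in> idx r" "k \<in> idx r"
    then show "M (g ** h) i k = (\<Sum>j\<in>idx r. M g i j * M h j k)"
      using q0 by (simp add: M_def is_repD sum_distrib_left sum_distrib_right mult_ac)
  qed simp
  then obtain s where s: "idx s = idx r" "mtx s = M" by (rule ex_rep)
  have "star_rep s"
    unfolding star_rep_def s
  proof (intro ballI)
    fix g i j assume g: "g \<in> SL3" and ij: "i \<in> idx r" "j \<in> idx r"
    have "q i * (q i * mtx r (adj g) i j) = cnj (mtx r g j i) * (q j * q j)"
      using w[OF g ij] qq[OF ij(1)] qq[OF ij(2)] by (simp flip: mult.assoc)
    then show "M (adj g) i j = cnj (M g j i)"
      using q0[OF ij(1)] q0[OF ij(2)] cq[OF ij(1)] cq[OF ij(2)]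
      by (simp add: M_def field_simps)
  qed
  moreover have "s \<cong>\<^sub>r r"
    unfolding rep_iso_def s
  proof (intro exI conjI ballI)
    fix i k assume "i \<in> idx r" "k \<in> idx r"
    then show "(\<Sum>j\<in>idx r. (if i = j then q i else 0) * (if j = k then 1 / q j else 0)) = (if i = k then 1 else 0)"
      using q0 by (simp add: delta_mult)
    from \<open>i \<in> idx r\<close> \<open>k \<in> idx r\<close>
    show "(\<Sum>j\<in>idx r. (if i = j then 1 / q i else 0) * (if j = k then q j else 0)) = (if i = k then 1 else 0)"
      using q0 by (simp add: delta_mult)
    fix g assume "g \<in> SL3"
    have "(\<Sum>j\<in>idx r. M g i j * (if j = k then q j else 0)) = M g i k * q k"
      using \<open>k \<in> idx r\<close> by (simp add: delta_mult)
    moreover have "(\<Sum>j\<in>idx r. (if i = j then q i else 0) * mtx r g j k) = q i * mtx r g i k"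
      using \<open>i \<in> idx r\<close> by (simp add: delta_mult)
    ultimately show "(\<Sum>j\<in>idx r. M g i j * (if j = k then q j else 0)) =
        (\<Sum>j\<in>idx r. (if i = j then q i else 0) * mtx r g j k)"
      using q0[OF \<open>k \<in> idx r\<close>] by (simp add: M_def)
  qed
  ultimately show ?thesis
    using that[of "nat_rep s"] star_rep_nat_rep rep_iso_trans[OF nat_rep_iso] by blast
qed

lemma idx_sym_pow [simp]: "idx (sym_pow m r) = monomials m (idx r)"
  by transfer auto

lemma mtx_sym_pow: "mtx (sym_pow m r) g \<alpha> \<beta> = sym_entry (mtx r g) \<alpha> (some_word \<beta>)"
  by transfer auto

text \<open>The multinomial coefficient of \<open>\<alpha>\<close>.\<close>

definition num_words :: "'i multiset \<Rightarrow> nat" where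
  "num_words \<alpha> = card {xs. mset xs = \<alpha>}"

lemma finite_words_of: "finite {xs. mset xs = \<alpha>}"
  by (rule finite_subset[OF _ finite_words[of "set_mset \<alpha>" "size \<alpha>"]]) (auto simp: words_def)

lemma num_words_pos: "num_words \<alpha> > 0"
  unfolding num_words_def card_gt_0_iff using finite_words_of[of \<alpha>] ex_mset[of \<alpha>] by auto

lemma sum_sym_entry:
  assumes "size \<alpha> = size \<beta>"
  shows "(\<Sum>js | mset js = \<beta>. sym_entry K \<alpha> js) = of_nat (num_words \<beta>) * sym_entry K \<alpha> (some_word \<beta>)"
proof -
  have "(\<Sum>js | mset js = \<beta>. sym_entry K \<alpha> js) = (\<Sum>js | mset js = \<beta>. sym_entry K \<alpha> (some_word \<beta>))"
  proof (intro sum.cong refl)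
    fix js assume "js \<in> {js. mset js = \<beta>}"
    then show "sym_entry K \<alpha> js = sym_entry K \<alpha> (some_word \<beta>)"
      using assms by (intro sym_entry_perm) auto
  qed
  then show ?thesis by (simp add: num_words_def)
qed

text \<open>A monomial is the average of the pure tensors of its words, so its squared norm is the
  product of the weights of its letters divided by the number of those words. These norms are
  unequal even over the standard representation, and the construction is iterated for S^t(S^3);
  hence the general diagonal Gram matrices.\<close>

lemma wstar_rep_sym_pow:
  fixes r :: "'i rep"
  assumes "wstar_rep r"
  shows "wstar_rep (sym_pow m r)"
proof -
  obtain w :: "'i \<Rightarrow> real" where w0: "\<And>i. i \<in> idx r \<Longrightarrow> w i > 0"
    and w: "\<And>g i j. g \<in> SL3 \<Longrightarrow> i \<in> idx r \<Longrightarrow> j \<in> idx r \<Longrightarrow>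
        of_real (w i) * mtx r (adj g) i j = cnj (mtx r g j i) * of_real (w j)"
    using assms unfolding wstar_rep_def by blast
  define W where "W \<alpha> = (\<Prod>i\<in>#\<alpha>. w i)" for \<alpha>
  have W_pos: "W \<alpha> > 0" if "set_mset \<alpha> \<subseteq> idx r" for \<alpha>
    using that by (induction \<alpha>) (auto simp: W_def w0)
  have pow: "of_real (W (mset xs)) * pow_entry (mtx r (adj g)) xs ys =
      cnj (pow_entry (mtx r g) ys xs) * of_real (W (mset ys))"
    if "g \<in> SL3" "length xs = length ys" "set xs \<subseteq> idx r" "set ys \<subseteq> idx r" for g xs ys
    using that(2-)
  proof (induction xs ys rule: list_induct2)
    case (Cons x xs y ys)
    have "of_real (W (mset (x # xs))) * pow_entry (mtx r (adj g)) (x # xs) (y # ys) =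
       (of_real (w x) * mtx r (adj g) x y) * (of_real (W (mset xs)) * pow_entry (mtx r (adj g)) xs ys)"
      by (simp add: W_def mult_ac)
    also have "\<dots> = cnj (pow_entry (mtx r g) (y # ys) (x # xs)) * of_real (W (mset (y # ys)))"
      using Cons w[OF that(1), of x y] by (simp add: W_def mult_ac)
    finally show ?case .
  qed (simp add: W_def)
  show ?thesis unfolding wstar_rep_def
  proof (intro exI[of _ "\<lambda>\<alpha>. W \<alpha> / real (num_words \<alpha>)"] conjI ballI)
    fix \<alpha> assume "\<alpha> \<in> idx (sym_pow m r)"
    then show "W \<alpha> / real (num_words \<alpha>) > 0"
      using num_words_pos[of \<alpha>] by (intro divide_pos_pos W_pos) (auto simp: monomials_def)
  next
    fix g \<alpha> \<beta> assume g: "g \<in> SL3" and "\<alpha> \<in> idx (sym_pow m r)" "\<beta> \<in> idx (sym_pow m r)"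
    then have a: "size \<alpha> = m" "set_mset \<alpha> \<subseteq> idx r" and b: "size \<beta> = m" "set_mset \<beta> \<subseteq> idx r"
      by (auto simp: monomials_def)
    let ?S = "\<lambda>g \<alpha> \<beta>. sym_entry (mtx r g) \<alpha> (some_word \<beta>)"
    \<comment> \<open>Multiplied by the size of the class, the entry becomes a double sum over
      words, in which \<open>\<alpha>\<close> and \<open>\<beta>\<close> can exchange roles.\<close>
    have S: "of_nat (num_words \<beta>) * ?S g \<alpha> \<beta> = (\<Sum>js | mset js = \<beta>. \<Sum>is | mset is = \<alpha>. pow_entry (mtx r g) is js)"
      if "size \<alpha> = size \<beta>" for g \<alpha> \<beta>
      unfolding sum_sym_entry[OF that, symmetric] by (simp add: sym_entry_def)
    have "of_real (W \<alpha>) * (of_nat (num_words \<beta>) * ?S (adj g) \<alpha> \<beta>) =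
        (\<Sum>js | mset js = \<beta>. \<Sum>is | mset is = \<alpha>. of_real (W (mset is)) * pow_entry (mtx r (adj g)) is js)"
      using a b by (simp add: S sum_distrib_left)
    also have "\<dots> = (\<Sum>js | mset js = \<beta>. \<Sum>is | mset is = \<alpha>. cnj (pow_entry (mtx r g) js is) * of_real (W (mset js)))"
    proof (intro sum.cong refl pow[OF g])
      fix js "is" assume "js \<in> {js. mset js = \<beta>}" "is \<in> {is. mset is = \<alpha>}"
      then have *: "mset js = \<beta>" "mset is = \<alpha>" by auto
      show "length is = length js" using * a b by (metis size_mset)
      show "set is \<subseteq> idx r" "set js \<subseteq> idx r" using * a b by (metis set_mset_mset)+
    qed
    also have "\<dots> = cnj (\<Sum>js | mset js = \<beta>. \<Sum>is | mset is = \<alpha>. pow_entry (mtx r g) js is) * of_real (W \<beta>)"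
      by (simp add: sum_distrib_right)
    also have "(\<Sum>js | mset js = \<beta>. \<Sum>is | mset is = \<alpha>. pow_entry (mtx r g) js is) =
        of_nat (num_words \<alpha>) * ?S g \<beta> \<alpha>"
      using a b by (subst S) (simp_all add: sum.swap[of _ "{js. mset js = \<beta>}"])
    finally show "of_real (W \<alpha> / real (num_words \<alpha>)) * mtx (sym_pow m r) (adj g) \<alpha> \<beta> =
        cnj (mtx (sym_pow m r) g \<beta> \<alpha>) * of_real (W \<beta> / real (num_words \<beta>))"
      using num_words_pos[of \<alpha>] num_words_pos[of \<beta>] by (simp add: mtx_sym_pow field_simps)
  qed
qed

text \<open>Triangularity is phrased through a rank function rather than an order on the indices:
  ranks add along words and so pass to monomials, which lets the argument be repeated for a
  symmetric power of a symmetric power.\<close>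

lemma pow_entry_triangular:
  fixes \<rho> :: "'i \<Rightarrow> nat"
  assumes K: "\<And>i j. i \<in> I \<Longrightarrow> j \<in> I \<Longrightarrow> K i j \<noteq> 0 \<Longrightarrow> i = j \<or> \<rho> i < \<rho> j"
    and "length xs = length ys" "set xs \<subseteq> I" "set ys \<subseteq> I" "pow_entry K xs ys \<noteq> 0"
  shows "xs = ys \<or> sum_list (map \<rho> xs) < sum_list (map \<rho> ys)"
  using assms(2-)
proof (induction xs ys rule: list_induct2)
  case (Cons x xs y ys)
  then have "x = y \<or> \<rho> x < \<rho> y" "xs = ys \<or> sum_list (map \<rho> xs) < sum_list (map \<rho> ys)"
    using K[of x y] by auto
  then show ?case by auto
qed simp

text \<open>A word of \<open>\<alpha>\<close> has the same rank sum as
  \<open>some_word \<alpha>\<close>, so a nonzero entry between them forces equality; a single word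
  contributes to each diagonal entry.\<close>

lemma sym_entry_triangular:
  fixes \<rho> :: "'i \<Rightarrow> nat"
  assumes K: "\<And>i j. i \<in> I \<Longrightarrow> j \<in> I \<Longrightarrow> K i j \<noteq> 0 \<Longrightarrow> i = j \<or> \<rho> i < \<rho> j"
    and \<alpha>: "\<alpha> \<in> monomials m I" and \<beta>: "\<beta> \<in> monomials m I"
  shows "sym_entry K \<alpha> (some_word \<beta>) \<noteq> 0 \<Longrightarrow> \<alpha> = \<beta> \<or> (\<Sum>i\<in>#\<alpha>. \<rho> i) < (\<Sum>i\<in>#\<beta>. \<rho> i)"
    and "sym_entry K \<alpha> (some_word \<alpha>) = (\<Prod>i\<in>#\<alpha>. K i i)"
proof -
  have W: "length xs = m \<and> set xs \<subseteq> I" if "mset xs = \<gamma>" "\<gamma> \<in> monomials m I" for xs \<gamma>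
    using that by (auto simp: monomials_def)
  have pow_entry_self: "pow_entry K xs xs = prod_list (map (\<lambda>i. K i i) xs)" for xs
    by (induction xs) simp_all
  have sw: "mset (some_word \<gamma>) = \<gamma>" for \<gamma> :: "'i multiset" by simp
  {
    assume "sym_entry K \<alpha> (some_word \<beta>) \<noteq> 0"
    then obtain xs where xs: "mset xs = \<alpha>" "pow_entry K xs (some_word \<beta>) \<noteq> 0"
      unfolding sym_entry_def by (metis (mono_tags, lifting) mem_Collect_eq sum.neutral)
    have "xs = some_word \<beta> \<or> sum_list (map \<rho> xs) < sum_list (map \<rho> (some_word \<beta>))"
      using pow_entry_triangular[of I K \<rho>, OF K _ _ _ xs(2)] W[OF xs(1) \<alpha>] W[OF sw \<beta>] by auto
    moreover have "sum_list (map \<rho> xs) = (\<Sum>i\<in>#\<alpha>. \<rho> i)"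
      "sum_list (map \<rho> (some_word \<beta>)) = (\<Sum>i\<in>#\<beta>. \<rho> i)"
      using xs(1) by (metis mset_map sum_mset_sum_list sw)+
    ultimately show "\<alpha> = \<beta> \<or> (\<Sum>i\<in>#\<alpha>. \<rho> i) < (\<Sum>i\<in>#\<beta>. \<rho> i)"
      using xs(1) by auto
  }
  have "pow_entry K xs (some_word \<alpha>) = (if xs = some_word \<alpha> then pow_entry K xs xs else 0)"
    if "xs \<in> {xs. mset xs = \<alpha>}" for xs
  proof -
    have "sum_list (map \<rho> xs) = sum_list (map \<rho> (some_word \<alpha>))"
      using that by (metis (mono_tags, lifting) mem_Collect_eq mset_map sum_mset_sum_list sw)
    then show ?thesis
      using pow_entry_triangular[of I K \<rho> xs "some_word \<alpha>", OF K] W[OF _ \<alpha>, of xs] W[OF sw \<alpha>] that by auto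
  qed
  then have "sym_entry K \<alpha> (some_word \<alpha>) =
      (\<Sum>xs | mset xs = \<alpha>. if xs = some_word \<alpha> then pow_entry K xs xs else 0)"
    unfolding sym_entry_def by (intro sum.cong refl) blast
  also have "\<dots> = pow_entry K (some_word \<alpha>) (some_word \<alpha>)"
    using finite_words_of[of \<alpha>] by (simp add: sum.delta)
  also have "\<dots> = prod_list (map (\<lambda>i. K i i) (some_word \<alpha>))"
    by (rule pow_entry_self)
  also have "\<dots> = (\<Prod>i\<in>#\<alpha>. K i i)"
    by (metis mset_map prod_mset_prod_list sw)
  finally show "sym_entry K \<alpha> (some_word \<alpha>) = (\<Prod>i\<in>#\<alpha>. K i i)" .
qed

definition complete_sym :: "'i set \<Rightarrow> ('i \<Rightarrow> complex) \<Rightarrow> nat \<Rightarrow> complex" where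
  "complete_sym I d m = (\<Sum>\<alpha>\<in>monomials m I. \<Prod>i\<in>#\<alpha>. d i)"

lemma rtrace_sym_pow_triangular:
  fixes \<rho> :: "'i \<Rightarrow> nat"
  assumes "\<And>i j. i \<in> idx r \<Longrightarrow> j \<in> idx r \<Longrightarrow> mtx r g i j \<noteq> 0 \<Longrightarrow> i = j \<or> \<rho> i < \<rho> j"
  shows "rtrace (sym_pow m r) g = complete_sym (idx r) (\<lambda>i. mtx r g i i) m"
  unfolding rtrace_def complete_sym_def
  by (simp add: mtx_sym_pow) (intro sum.cong refl, rule sym_entry_triangular(2)[OF assms])

section \<open>Triangularization\<close>

text \<open>Both conjugators are kept in \<open>SL3\<close> because matrix coefficients are
  multiplicative only there.\<close>

definition SL3_conj :: "complex^3^3 \<Rightarrow> complex^3^3 \<Rightarrow> bool" where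
  "SL3_conj g h \<longleftrightarrow> (\<exists>p\<in>SL3. \<exists>q\<in>SL3. p ** q = mat 1 \<and> h = q ** g ** p)"

lemma SL3_conj_trans: "SL3_conj g h \<Longrightarrow> SL3_conj h k \<Longrightarrow> SL3_conj g k"
  unfolding SL3_conj_def
proof clarify
  fix p q p' q' assume *: "p \<in> SL3" "q \<in> SL3" "p' \<in> SL3" "q' \<in> SL3" "p ** q = mat 1" "p' ** q' = mat 1"
  have "(p ** p') ** (q' ** q) = p ** (p' ** q') ** q" by (simp add: matrix_mul_assoc)
  then have "(p ** p') ** (q' ** q) = mat 1" using * by simp
  moreover have "q' ** (q ** g ** p) ** p' = (q' ** q) ** g ** (p ** p')"
    by (simp add: matrix_mul_assoc)
  ultimately show "\<exists>x\<in>SL3. \<exists>y\<in>SL3. x ** y = mat 1 \<and> q' ** (q ** g ** p) ** p' = y ** g ** x"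
    using * by (intro bexI[of _ "p ** p'"] bexI[of _ "q' ** q"]) auto
qed

lemma SL3_conj_in: "SL3_conj g h \<Longrightarrow> g \<in> SL3 \<Longrightarrow> h \<in> SL3"
  by (auto simp: SL3_conj_def)

lemma SL3_conjI:
  assumes "p \<in> SL3"
  obtains q where "q ** p = mat 1" "SL3_conj g (q ** g ** p)"
proof -
  have "invertible p" using assms by (simp add: invertible_det_nz SL3_def)
  then obtain q where q: "p ** q = mat 1" "q ** p = mat 1" unfolding invertible_def by blast
  have "det p * det q = 1" using q(1) det_mul[of p q] by simp
  then have "q \<in> SL3" using assms by (simp add: SL3_def)
  then show ?thesis using that[of q] q assms unfolding SL3_conj_def by blast
qed

lemma rtrace_conj:
  assumes "SL3_conj g h" "g \<in> SL3"
  shows "rtrace r h = rtrace r g"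
proof -
  obtain p q where pq: "p \<in> SL3" "q \<in> SL3" "p ** q = mat 1" "h = q ** g ** p"
    using assms unfolding SL3_conj_def by blast
  have tr: "rtrace r (a ** b) = rtrace r (b ** a)" if "a \<in> SL3" "b \<in> SL3" for a b
    unfolding rtrace_def using that
    by (simp add: is_repD mult.commute) (subst sum.swap, simp)
  have "rtrace r h = rtrace r (p ** (q ** g))" unfolding pq by (rule tr) (use pq assms in auto)
  then show ?thesis using pq by (simp add: matrix_mul_assoc)
qed

lemma exists_eigenvector_3:
  fixes g :: "complex^3^3"
  obtains v c where "v \<noteq> 0" "g *v v = c *s v"
proof -
  \<comment> \<open>The characteristic polynomial \<open>det (g - c)\<close>: its coefficients are
    the determinant, minus the sum of the principal 2x2 minors, the trace and -1.\<close>
  define p where "p = [:det g, - (g$1$1*g$2$2 - g$1$2*g$2$1 + g$1$1*g$3$3 - g$1$3*g$3$1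
      + g$2$2*g$3$3 - g$2$3*g$3$2), g$1$1 + g$2$2 + g$3$3, -1:]"
  have det: "det (g - mat c) = poly p c" for c
    by (simp add: p_def det_3 mat_def algebra_simps)
  have "degree p = 3" by (simp add: p_def)
  then obtain c where "poly p c = 0"
    using fundamental_theorem_of_algebra[of p] by (auto simp: constant_degree)
  then have "\<not> invertible (g - mat c)" by (simp add: det invertible_det_nz)
  then have "\<not> (\<exists>B. B ** (g - mat c) = mat 1)" by (simp add: invertible_left_inverse)
  then obtain v where "(g - mat c) *v v = 0" "v \<noteq> 0" unfolding matrix_left_invertible_ker by blast
  then have "g *v v = c *s v"
    by (simp add: matrix_vector_mult_def mat_def vec_eq_iff forall_3 sum_3 algebra_simps)
  then show ?thesis using that \<open>v \<noteq> 0\<close> by blast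
qed

text \<open>After division by a nonzero entry, \<open>v\<close> can be completed to a matrix of
  determinant 1 by unit columns; the minus sign and the cyclic permutation used for a second or
  third pivot keep the determinant positive.\<close>

lemma SL3_first_column:
  fixes v :: "complex^3"
  assumes "v \<noteq> 0"
  obtains p c where "p \<in> SL3" "c \<noteq> 0" "v = c *s (p *v axis 1 1)"
proof -
  have col: "(p *v axis 1 1) $ i = p $ i $ 1" for p :: "complex^3^3" and i
    by (simp add: matrix_vector_mult_def axis_def if_distrib sum.delta cong: if_cong)
  have "v $ 1 \<noteq> 0 \<or> v $ 1 = 0 \<and> v $ 2 \<noteq> 0 \<or> v $ 1 = 0 \<and> v $ 2 = 0 \<and> v $ 3 \<noteq> 0"
    using assms by (auto simp: vec_eq_iff forall_3)
  then show ?thesis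
  proof (elim disjE conjE)
    assume "v $ 1 \<noteq> 0"
    then show ?thesis
      by (intro that[of "vector [vector [1, 0, 0], vector [v$2 / v$1, 1, 0], vector [v$3 / v$1, 0, 1]]" "v $ 1"])
        (auto simp: SL3_def det_3 vector_3 vec_eq_iff forall_3 col)
  next
    assume "v $ 1 = 0" "v $ 2 \<noteq> 0"
    then show ?thesis
      by (intro that[of "vector [vector [0, -1, 0], vector [1, 0, 0], vector [v$3 / v$2, 0, 1]]" "v $ 2"])
        (auto simp: SL3_def det_3 vector_3 vec_eq_iff forall_3 col)
  next
    assume "v $ 1 = 0" "v $ 2 = 0" "v $ 3 \<noteq> 0"
    then show ?thesis
      by (intro that[of "vector [vector [0, 1, 0], vector [0, 0, 1], vector [1, 0, 0]]" "v $ 3"])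
        (auto simp: SL3_def det_3 vector_3 vec_eq_iff forall_3 col)
  qed
qed

text \<open>Moving an eigenvector to the first basis vector clears the first column; a second
  conjugation, inside the lower 2x2 block, clears the remaining entry.\<close>

lemma exists_conj_upper_triangular:
  obtains h where "SL3_conj g h" "h $ 2 $ 1 = 0" "h $ 3 $ 1 = 0" "h $ 3 $ 2 = 0"
proof -
  obtain v c where v: "v \<noteq> 0" "g *v v = c *s v" by (rule exists_eigenvector_3)
  obtain p d where p: "p \<in> SL3" "d \<noteq> 0" "v = d *s (p *v axis 1 1)" by (rule SL3_first_column[OF v(1)])
  obtain q where q: "q ** p = mat 1" "SL3_conj g (q ** g ** p)" by (rule SL3_conjI[OF p(1)])
  define h where "h = q ** g ** p"
  have vp: "p *v axis 1 1 = (1 / d) *s v" using p by simp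
  have "h *v axis 1 1 = q *v (g *v (p *v axis 1 1))" by (simp add: h_def matrix_vector_mul_assoc matrix_mul_assoc)
  also have "\<dots> = c *s (q *v (p *v axis 1 1))"
    by (simp add: vp vector_scalar_commute v(2))
  also have "q *v (p *v axis 1 1) = axis 1 1" by (simp add: matrix_vector_mul_assoc q)
  finally have "(h *v axis 1 1) $ i = c * axis 1 1 $ i" for i by simp
  moreover have "(h *v axis 1 1) $ i = h $ i $ 1" for i
    by (simp add: matrix_vector_mult_def axis_def if_distrib sum.delta cong: if_cong)
  ultimately have hc: "h $ i $ 1 = c * axis 1 1 $ i" for i by metis
  have h1: "h $ 2 $ 1 = 0" "h $ 3 $ 1 = 0" using hc[of 2] hc[of 3] by (simp_all add: axis_def)
  have gh: "SL3_conj g h" using q by (simp add: h_def)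
  have "\<exists>p q. p \<in> SL3 \<and> q \<in> SL3 \<and> p ** q = mat 1 \<and>
     (q ** h ** p) $ 2 $ 1 = 0 \<and> (q ** h ** p) $ 3 $ 1 = 0 \<and> (q ** h ** p) $ 3 $ 2 = 0"
  \<comment> \<open>If this entry is 0, the third basis vector is an eigenvector of the lower block
    and a signed swap of determinant 1 puts it second.\<close>
  proof (cases "h $ 2 $ 3 = 0")
    case True
    show ?thesis
      by (intro exI[of _ "vector [vector [1, 0, 0], vector [0, 0, -1], vector [0, 1, 0]] :: complex^3^3"]
          exI[of _ "vector [vector [1, 0, 0], vector [0, 0, 1], vector [0, -1, 0]] :: complex^3^3"])
        (simp add: SL3_def det_3 vector_3 matrix_matrix_mult_def sum_3 vec_eq_iff forall_3 mat_def h1 True)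
  next
    case False
    \<comment> \<open>The roots \<open>s\<close> of this quadratic are those for which
      \<open>e_2 + s e_3\<close> is an eigenvector of the lower block.\<close>
    have "degree [: - h$3$2, h$2$2 - h$3$3, h$2$3 :] = 2" using False by simp
    then obtain s where "poly [: - h$3$2, h$2$2 - h$3$3, h$2$3 :] s = 0"
      using fundamental_theorem_of_algebra[of "[: - h$3$2, h$2$2 - h$3$3, h$2$3 :]"]
      by (auto simp: constant_degree)
    then have s: "h$3$2 + h$3$3 * s - s * (h$2$2 + h$2$3 * s) = 0" by (simp add: algebra_simps)
    show ?thesis using s
      by (intro exI[of _ "vector [vector [1, 0, 0], vector [0, 1, 0], vector [0, s, 1]] :: complex^3^3"]
          exI[of _ "vector [vector [1, 0, 0], vector [0, 1, 0], vector [0, -s, 1]] :: complex^3^3"])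
        (simp add: SL3_def det_3 vector_3 matrix_matrix_mult_def sum_3 vec_eq_iff forall_3 mat_def h1 algebra_simps)
  qed
  then obtain p q where *: "p \<in> SL3" "q \<in> SL3" "p ** q = mat 1"
    "(q ** h ** p) $ 2 $ 1 = 0" "(q ** h ** p) $ 3 $ 1 = 0" "(q ** h ** p) $ 3 $ 2 = 0" by blast
  then have "SL3_conj h (q ** h ** p)" unfolding SL3_conj_def by blast
  from SL3_conj_trans[OF gh this] * show ?thesis using that by blast
qed

section \<open>Polarization operators\<close>

text \<open>A function \<open>f\<close> of two multisets stands for a bihomogeneous tensor that is symmetric in its first
  and in its last arguments; \<open>pol_up\<close> and \<open>pol_down\<close> are the raising and lowering operators of the
  \<open>sl\<^sub>2\<close> that commutes with the action of \<open>GL(V)\<close>.\<close>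

definition pol_up :: "('i multiset \<Rightarrow> 'i multiset \<Rightarrow> complex) \<Rightarrow> 'i multiset \<Rightarrow> 'i multiset \<Rightarrow> complex" where
  "pol_up f \<alpha> \<beta> = (\<Sum>x\<in>#\<alpha>. f (\<alpha> - {#x#}) (add_mset x \<beta>))"

definition pol_down :: "('i multiset \<Rightarrow> 'i multiset \<Rightarrow> complex) \<Rightarrow> 'i multiset \<Rightarrow> 'i multiset \<Rightarrow> complex" where
  "pol_down f \<alpha> \<beta> = (\<Sum>y\<in>#\<beta>. f (add_mset y \<alpha>) (\<beta> - {#y#}))"

lemma pol_flip: "pol_down f \<alpha> \<beta> = pol_up (\<lambda>\<beta> \<alpha>. f \<alpha> \<beta>) \<beta> \<alpha>"
  by (simp add: pol_up_def pol_down_def)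

lemma sum_mset_cong: "(\<And>x. x \<in># M \<Longrightarrow> f x = g x) \<Longrightarrow> (\<Sum>x\<in>#M. f x) = (\<Sum>x\<in>#M. g x)"
  by (metis image_mset_cong)

lemma sum_mset_diff: "(\<Sum>x\<in>#M. f x - g x) = (\<Sum>x\<in>#M. f x) - (\<Sum>x\<in>#M. g x :: complex)"
  by (induction M) simp_all

lemma sum_mset_divide: "(\<Sum>x\<in>#M. f x / c) = (\<Sum>x\<in>#M. f x) / (c :: complex)"
  by (induction M) (simp_all add: add_divide_distrib)

lemma pol_up_add_mset:
  "pol_up f (add_mset x \<alpha>) \<beta> = f \<alpha> (add_mset x \<beta>) + (\<Sum>z\<in>#\<alpha>. f (add_mset x (\<alpha> - {#z#})) (add_mset z \<beta>))"
proof -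
  have "(\<Sum>z\<in>#\<alpha>. f (add_mset x \<alpha> - {#z#}) (add_mset z \<beta>)) =
      (\<Sum>z\<in>#\<alpha>. f (add_mset x (\<alpha> - {#z#})) (add_mset z \<beta>))"
    by (intro sum_mset_cong) (simp add: add_mset_remove_trivial_If)
  then show ?thesis by (simp add: pol_up_def)
qed

text \<open>A letter \<open>x\<close> goes from \<open>\<alpha>\<close> to \<open>\<beta>\<close>
  and then a letter comes back: either the same one, which restores
  \<open>f \<alpha> \<beta>\<close> once for every letter of \<open>\<alpha>\<close>, or some
  \<open>y\<close> of \<open>\<beta>\<close>.\<close>

lemma pol_up_down:
  "pol_up (pol_down f) \<alpha> \<beta> = of_nat (size \<alpha>) * f \<alpha> \<beta> +
     (\<Sum>x\<in>#\<alpha>. \<Sum>y\<in>#\<beta>. f (add_mset y (\<alpha> - {#x#})) (add_mset x (\<beta> - {#y#})))"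
proof -
  have "pol_down f (\<alpha> - {#x#}) (add_mset x \<beta>) =
      f \<alpha> \<beta> + (\<Sum>y\<in>#\<beta>. f (add_mset y (\<alpha> - {#x#})) (add_mset x (\<beta> - {#y#})))"
    if "x \<in># \<alpha>" for x
    using that by (simp add: pol_flip pol_up_add_mset)
  then have "pol_up (pol_down f) \<alpha> \<beta> = (\<Sum>x\<in>#\<alpha>. f \<alpha> \<beta> +
      (\<Sum>y\<in>#\<beta>. f (add_mset y (\<alpha> - {#x#})) (add_mset x (\<beta> - {#y#}))))"
    unfolding pol_up_def by (intro sum_mset_cong) simp
  then show ?thesis by (simp add: sum_mset.distrib)
qed

text \<open>The \<open>sl_2\<close> relation: on bidegree \<open>(p, q)\<close> the commutator of
  raising and lowering is \<open>p - q\<close>. The double sum of \<open>pol_up_down\<close> is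
  symmetric under exchange of the two rows and cancels.\<close>

lemma pol_commutator:
  "pol_up (pol_down f) \<alpha> \<beta> + of_nat (size \<beta>) * f \<alpha> \<beta> =
   pol_down (pol_up f) \<alpha> \<beta> + of_nat (size \<alpha>) * f \<alpha> \<beta>"
proof -
  have "pol_down (pol_up f) \<alpha> \<beta> = pol_up (pol_down (\<lambda>\<beta> \<alpha>. f \<alpha> \<beta>)) \<beta> \<alpha>"
  proof -
    have "(\<lambda>\<beta> \<alpha>. pol_up f \<alpha> \<beta>) = pol_down (\<lambda>\<beta> \<alpha>. f \<alpha> \<beta>)"
      by (intro ext) (simp add: pol_flip)
    then show ?thesis by (simp only: pol_flip[of "pol_up f"])
  qed
  also have "\<dots> = of_nat (size \<beta>) * f \<alpha> \<beta> +
     (\<Sum>y\<in>#\<beta>. \<Sum>x\<in>#\<alpha>. f (add_mset y (\<alpha> - {#x#})) (add_mset x (\<beta> - {#y#})))"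
    by (rule pol_up_down)
  finally show ?thesis by (simp add: pol_up_down sum_mset.swap[of _ \<beta> \<alpha>])
qed

definition bihom :: "nat \<Rightarrow> nat \<Rightarrow> 'i set \<Rightarrow> ('i multiset \<Rightarrow> 'i multiset \<Rightarrow> complex) \<Rightarrow> bool" where
  "bihom p q I f \<longleftrightarrow> (\<forall>\<alpha> \<beta>. f \<alpha> \<beta> \<noteq> 0 \<longrightarrow> \<alpha> \<in> monomials p I \<and> \<beta> \<in> monomials q I)"

lemma bihom_flip: "bihom p q I f \<longleftrightarrow> bihom q p I (\<lambda>\<beta> \<alpha>. f \<alpha> \<beta>)"
  by (auto simp: bihom_def)

lemma bihom_up: assumes "bihom p (Suc q) I f" shows "bihom (Suc p) q I (pol_up f)"
  unfolding bihom_def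
proof (intro allI impI)
  fix \<alpha> \<beta> assume "pol_up f \<alpha> \<beta> \<noteq> 0"
  then obtain x where "x \<in># \<alpha>" "f (\<alpha> - {#x#}) (add_mset x \<beta>) \<noteq> 0"
    unfolding pol_up_def by (metis (mono_tags, lifting) sum_mset.neutral_const sum_mset_cong)
  then have "x \<in># \<alpha>" "\<alpha> - {#x#} \<in> monomials p I" "add_mset x \<beta> \<in> monomials (Suc q) I"
    using assms by (auto simp: bihom_def)
  moreover obtain A where "\<alpha> = add_mset x A" using \<open>x \<in># \<alpha>\<close> by (metis insert_DiffM)
  ultimately show "\<alpha> \<in> monomials (Suc p) I \<and> \<beta> \<in> monomials q I"
    by (auto simp: monomials_def)
qed

lemma bihom_down: "bihom (Suc p) q I f \<Longrightarrow> bihom p (Suc q) I (pol_down f)"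
  using bihom_up[of q p I "\<lambda>\<beta> \<alpha>. f \<alpha> \<beta>"] unfolding bihom_flip[of p] bihom_flip[of "Suc p"] pol_flip .

lemma pol_up_linear:
  "pol_up (\<lambda>\<alpha> \<beta>. (f \<alpha> \<beta> - h \<alpha> \<beta>) / c) \<alpha> \<beta> = (pol_up f \<alpha> \<beta> - pol_up h \<alpha> \<beta>) / c"
  by (simp add: pol_up_def diff_divide_distrib sum_mset_diff sum_mset_divide)

lemma pol_down_up_solve:
  assumes "bihom p q I f" "p \<ge> q" "c > 0"
  shows "\<exists>h. bihom p q I h \<and> (\<forall>\<alpha> \<beta>. pol_down (pol_up h) \<alpha> \<beta> + of_nat c * h \<alpha> \<beta> = f \<alpha> \<beta>)"
  using assms
proof (induction q arbitrary: p c f)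
  case 0
  define h where "h \<alpha> \<beta> = f \<alpha> \<beta> / of_nat c" for \<alpha> \<beta>
  have "h \<alpha> (add_mset x \<beta>) = 0" for \<alpha> x \<beta>
  proof -
    have "add_mset x \<beta> \<notin> monomials 0 I" by (simp add: monomials_def)
    then show ?thesis using 0 by (auto simp: h_def bihom_def)
  qed
  then have "pol_up h = (\<lambda>_ _. 0)" by (intro ext) (simp add: pol_up_def)
  then have "pol_down (pol_up h) \<alpha> \<beta> = 0" for \<alpha> \<beta> by (simp add: pol_down_def)
  moreover have "bihom p 0 I h" using 0(1) by (auto simp: bihom_def h_def)
  moreover have "of_nat c * h \<alpha> \<beta> = f \<alpha> \<beta>" for \<alpha> \<beta> using 0(3) by (simp add: h_def)
  ultimately show ?case by (intro exI[of _ h]) simp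
next
  case (Suc q)
  obtain k where k: "bihom (Suc p) q I k"
    and keq: "\<And>\<alpha> \<beta>. pol_down (pol_up k) \<alpha> \<beta> + of_nat (c + (p - Suc q) + 2) * k \<alpha> \<beta> = pol_up f \<alpha> \<beta>"
    using Suc.IH[OF bihom_up[OF Suc.prems(1)], of "c + (p - Suc q) + 2"] Suc.prems by auto
  define h where "h \<alpha> \<beta> = (f \<alpha> \<beta> - pol_down k \<alpha> \<beta>) / of_nat c" for \<alpha> \<beta>
  have h: "bihom p (Suc q) I h"
    unfolding bihom_def
  proof (intro allI impI)
    fix \<alpha> \<beta> assume "h \<alpha> \<beta> \<noteq> 0"
    then have "f \<alpha> \<beta> \<noteq> 0 \<or> pol_down k \<alpha> \<beta> \<noteq> 0" by (auto simp: h_def)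
    then show "\<alpha> \<in> monomials p I \<and> \<beta> \<in> monomials (Suc q) I"
      using Suc.prems(1) bihom_down[OF k] by (auto simp: bihom_def)
  qed
  have ud: "pol_up (pol_down k) \<alpha> \<beta> = pol_up f \<alpha> \<beta> - of_nat c * k \<alpha> \<beta>" for \<alpha> \<beta>
  proof (cases "k \<alpha> \<beta> = 0")
    case True
    then show ?thesis using pol_commutator[of k \<alpha> \<beta>] keq[of \<alpha> \<beta>] by simp
  next
    case False
    then have s: "size \<alpha> = Suc p" "size \<beta> = q" using k by (auto simp: bihom_def monomials_def)
    have "of_nat (Suc p) = (of_nat (p - Suc q + 2) + of_nat q :: complex)"
      using Suc.prems(2) unfolding of_nat_add[symmetric] of_nat_eq_iff by simp
    then show ?thesis using pol_commutator[of k \<alpha> \<beta>] keq[of \<alpha> \<beta>] s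
      by (simp add: algebra_simps)
  qed
  have "pol_down (pol_up h) \<alpha> \<beta> + of_nat c * h \<alpha> \<beta> = f \<alpha> \<beta>" for \<alpha> \<beta>
  proof -
    have "pol_up h = (\<lambda>\<alpha> \<beta>. (pol_up f \<alpha> \<beta> - pol_up (pol_down k) \<alpha> \<beta>) / of_nat c)"
    proof -
      have "h = (\<lambda>\<alpha> \<beta>. (f \<alpha> \<beta> - pol_down k \<alpha> \<beta>) / of_nat c)" by (intro ext) (simp add: h_def)
      then show ?thesis by (simp only:) (intro ext pol_up_linear)
    qed
    also have "\<dots> = k" using Suc.prems(3) by (intro ext) (simp add: ud)
    finally show ?thesis using Suc.prems(3) by (simp add: h_def)
  qed
  then show ?case using h by blast
qed

text \<open>By the commutator, lowering and then raising equals raising and then lowering plus the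
  positive constant \<open>p - q\<close>, and \<open>pol_down_up_solve\<close> applies. In
  particular, raising is surjective onto bidegree \<open>(p, q)\<close>.\<close>

lemma pol_up_down_surj:
  assumes "bihom p q I f" "p > q"
  shows "\<exists>h. bihom p q I h \<and> pol_up (pol_down h) = f"
proof -
  obtain h where h: "bihom p q I h" and e: "\<And>\<alpha> \<beta>. pol_down (pol_up h) \<alpha> \<beta> + of_nat (p - q) * h \<alpha> \<beta> = f \<alpha> \<beta>"
    using pol_down_up_solve[of p q I f "p - q"] assms by auto
  have "pol_up (pol_down h) \<alpha> \<beta> = f \<alpha> \<beta>" for \<alpha> \<beta>
  proof (cases "h \<alpha> \<beta> = 0")
    case True
    then show ?thesis using pol_commutator[of h \<alpha> \<beta>] e[of \<alpha> \<beta>] by simp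
  next
    case False
    then have s: "size \<alpha> = p" "size \<beta> = q" using h by (auto simp: bihom_def monomials_def)
    then show ?thesis using pol_commutator[of h \<alpha> \<beta>] e[of \<alpha> \<beta>] assms(2)
      by (simp add: of_nat_diff algebra_simps)
  qed
  then show ?thesis using h by blast
qed

text \<open>Alternation along columns of height two: each pair holds the top and bottom letter of a
  column, while \<open>\<alpha>\<close> and \<open>\<beta>\<close> hold the letters of the two rows
  outside the listed columns.\<close>

fun col_alt :: "('i multiset \<Rightarrow> 'i multiset \<Rightarrow> complex) \<Rightarrow> ('i \<times> 'i) list \<Rightarrow> 'i multiset \<Rightarrow> 'i multiset \<Rightarrow> complex" where
  "col_alt f [] \<alpha> \<beta> = f \<alpha> \<beta>"
| "col_alt f ((x, y) # cs) \<alpha> \<beta> =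
     col_alt f cs (add_mset x \<alpha>) (add_mset y \<beta>) - col_alt f cs (add_mset y \<alpha>) (add_mset x \<beta>)"

text \<open>Alternating a column is a 2x2 determinant and so \<open>sl_2\<close>-invariant: the two
  terms in which the moved letter belongs to the column cancel.\<close>

lemma pol_up_col_alt: "pol_up (col_alt f cs) \<alpha> \<beta> = col_alt (pol_up f) cs \<alpha> \<beta>"
proof (induction cs arbitrary: \<alpha> \<beta>)
  case Nil
  have "col_alt f [] = f" by (intro ext) simp
  then show ?case by simp
next
  case (Cons c cs)
  obtain x y where c: "c = (x, y)" by (cases c)
  show ?case
    unfolding c
    by (simp add: Cons[symmetric] pol_up_add_mset)
      (simp add: pol_up_def sum_mset_diff add_mset_commute)
qed

text \<open>Lowering is raising with the two rows exchanged, and that exchange swaps the letters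
  within every column.\<close>

lemma pol_down_col_alt: "pol_down (col_alt f cs) \<alpha> \<beta> = col_alt (pol_down f) cs \<alpha> \<beta>"
proof -
  have flip: "col_alt (\<lambda>\<beta> \<alpha>. f \<alpha> \<beta>) cs \<beta> \<alpha> = col_alt f (map prod.swap cs) \<alpha> \<beta>"
    for f :: "'a multiset \<Rightarrow> 'a multiset \<Rightarrow> complex" and cs \<alpha> \<beta>
    by (induction f cs \<alpha> \<beta> arbitrary: \<alpha> \<beta> rule: col_alt.induct) simp_all
  have "pol_down (col_alt f (map prod.swap ds)) \<alpha> \<beta> = col_alt (pol_down f) (map prod.swap ds) \<alpha> \<beta>" for ds
    unfolding pol_flip flip[symmetric] by (simp add: pol_up_col_alt)
  from this[of "map prod.swap cs"] show ?thesis by (simp add: o_def)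
qed

lemma bihom_col_alt:
  assumes "bihom p q I f" "col_alt f cs \<alpha> \<beta> \<noteq> 0"
  shows "set_mset \<alpha> \<subseteq> I \<and> set_mset \<beta> \<subseteq> I \<and> set cs \<subseteq> I \<times> I \<and>
    size \<alpha> + length cs = p \<and> size \<beta> + length cs = q"
  using assms(2)
proof (induction cs arbitrary: \<alpha> \<beta>)
  case Nil
  then show ?case using assms(1) by (auto simp: bihom_def monomials_def)
next
  case (Cons c cs)
  obtain x y where c: "c = (x, y)" by (cases c)
  then have "col_alt f cs (add_mset x \<alpha>) (add_mset y \<beta>) \<noteq> 0 \<or> col_alt f cs (add_mset y \<alpha>) (add_mset x \<beta>) \<noteq> 0"
    using Cons.prems by auto
  then show ?case
    by (elim disjE) (drule Cons.IH, simp add: c)+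
qed

text \<open>If alternating one more column gives zero, then \<open>col_alt f cs\<close> depends only on the sum of its two
  arguments, and the highest weight condition \<open>pol_up f = 0\<close> turns it into a multiple of itself.\<close>

lemma highest_weight_col_alt_inj:
  assumes f: "bihom a b I f" and up: "\<And>\<alpha> \<beta>. pol_up f \<alpha> \<beta> = 0"
    and alt: "\<And>cs \<alpha>. length cs = b \<Longrightarrow> col_alt f cs \<alpha> {#} = 0"
  shows "f \<alpha> \<beta> = 0"
proof -
  \<comment> \<open>Downward induction on the number of alternated columns: at \<open>n = 0\<close>
    the bidegree forces \<open>\<beta>\<close> to be empty and \<open>alt\<close> applies;
    \<open>n = b\<close> leaves no column and is the claim.\<close>
  have "col_alt f cs \<alpha> \<beta> = 0" if "length cs = b - n" "n \<le> b" for n cs \<alpha> \<beta>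
    using that
  proof (induction n arbitrary: cs \<alpha> \<beta>)
    case 0
    then show ?case using alt[of cs \<alpha>] bihom_col_alt[OF f, of cs \<alpha> \<beta>] by (cases "\<beta> = {#}") auto
  next
    case (Suc n)
    show ?case
    proof (rule ccontr)
      assume ne: "col_alt f cs \<alpha> \<beta> \<noteq> 0"
      then have "size \<beta> = Suc n" using bihom_col_alt[OF f ne] Suc.prems by arith
      then obtain y \<beta>' where \<beta>: "\<beta> = add_mset y \<beta>'" by (metis size_eq_Suc_imp_eq_union)
      have ex: "col_alt f cs (add_mset u \<gamma>) (add_mset v \<delta>) = col_alt f cs (add_mset v \<gamma>) (add_mset u \<delta>)"
        for u v \<gamma> \<delta>
        using Suc.IH[of "(u, v) # cs" \<gamma> \<delta>] Suc.prems by simp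
      have "(\<Sum>z\<in>#\<alpha>. col_alt f cs (add_mset y (\<alpha> - {#z#})) (add_mset z \<beta>')) = (\<Sum>z\<in>#\<alpha>. col_alt f cs \<alpha> \<beta>)"
        by (intro sum_mset_cong) (simp add: ex[of y] \<beta>)
      then have "pol_up (col_alt f cs) (add_mset y \<alpha>) \<beta>' = of_nat (size \<alpha> + 1) * col_alt f cs \<alpha> \<beta>"
        by (simp add: pol_up_add_mset \<beta> algebra_simps)
      moreover have "pol_up f = (\<lambda>_ _. 0)" by (intro ext) (rule up)
      moreover have "col_alt (\<lambda>_ _. 0) cs \<gamma> \<delta> = 0" for \<gamma> \<delta> :: "'a multiset"
        by (induction cs arbitrary: \<gamma> \<delta>) (auto simp: split_paired_all)
      ultimately have "of_nat (size \<alpha> + 1) * col_alt f cs \<alpha> \<beta> = 0"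
        by (metis pol_up_col_alt)
      moreover have "of_nat (size \<alpha> + 1) \<noteq> (0 :: complex)" unfolding of_nat_eq_0_iff by simp
      ultimately show False using ne by simp
    qed
  qed
  from this[of "[]" b] show ?thesis by simp
qed

section \<open>Schur functors of two-row partitions\<close>

lemma rep_iso_of_bij_map:
  fixes f :: "('i \<Rightarrow> complex) \<Rightarrow> 'j \<Rightarrow> complex"
  assumes add: "\<And>u v. f (u + v) = f u + f v" and scale: "\<And>c u. f (fscale c u) = fscale c (f u)"
    and eqv: "\<And>g v j. g \<in> SL3 \<Longrightarrow> v \<in> supported_on (idx r) \<Longrightarrow> j \<in> idx s \<Longrightarrow>
      f (mat_op (idx r) (mtx r g) v) j = mat_op (idx s) (mtx s g) (f v) j"
    and inj: "\<And>v. v \<in> supported_on (idx r) \<Longrightarrow> (\<And>j. j \<in> idx s \<Longrightarrow> f v j = 0) \<Longrightarrow> v = 0"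
    and surj: "\<And>w. \<exists>v. v \<in> supported_on (idx r) \<and> (\<forall>j\<in>idx s. f v j = w j)"
  shows "r \<cong>\<^sub>r s"
proof -
  have zero: "f 0 = 0" using scale[of 0 0] by (simp add: fscale_def fun_eq_iff zero_fun_def)
  have lin: "f v j = (\<Sum>i\<in>idx r. f (unit_fun i) j * v i)" if "v \<in> supported_on (idx r)" for v j
  proof -
    have "f (\<Sum>i\<in>A. fscale (v i) (unit_fun i)) = (\<Sum>i\<in>A. fscale (v i) (f (unit_fun i)))" for A
      by (induction A rule: infinite_finite_induct)
        (simp_all only: sum.infinite sum.empty sum.insert add scale zero not_False_eq_True)
    moreover have "f v = f (\<Sum>i\<in>idx r. fscale (v i) (unit_fun i))"
      by (rule arg_cong[OF unit_fun_expansion[OF finite_idx that]])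
    ultimately have "f v = (\<Sum>i\<in>idx r. fscale (v i) (f (unit_fun i)))"
      by (simp only:)
    then show ?thesis by (simp add: sum_fun_apply fscale_def mult.commute)
  qed
  have lin': "(\<Sum>i\<in>idx r. f (unit_fun i) j * v i) = f (\<lambda>i. if i \<in> idx r then v i else 0) j" for v j
    by (subst lin) (auto simp: supported_on_def intro!: sum.cong)
  have unit: "unit_fun i \<in> supported_on (idx r)" if "i \<in> idx r" for i
    using that by (auto simp: unit_fun_def supported_on_def)
  show ?thesis
  proof (rule rep_iso_of_bij_matrix[where X = "\<lambda>j i. f (unit_fun i) j"])
    fix g j i assume g: "g \<in> SL3" and j: "j \<in> idx s" and i: "i \<in> idx r"
    have "(\<Sum>j'\<in>idx s. mtx s g j j' * f (unit_fun i) j') = f (mat_op (idx r) (mtx r g) (unit_fun i)) j"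
      using j by (simp add: eqv[OF g unit[OF i]]) (simp add: mat_op_def)
    also have "\<dots> = (\<Sum>i'\<in>idx r. f (unit_fun i') j * mtx r g i' i)"
      using i by (subst lin[OF mat_op_supported]) (simp add: mat_op_def unit_fun_def delta_mult)
    finally show "(\<Sum>j'\<in>idx s. mtx s g j j' * f (unit_fun i) j') =
        (\<Sum>i'\<in>idx r. f (unit_fun i') j * mtx r g i' i)" .
  next
    fix v i assume v: "\<And>j. j \<in> idx s \<Longrightarrow> (\<Sum>i\<in>idx r. f (unit_fun i) j * v i) = 0" and i: "i \<in> idx r"
    have "(\<lambda>i. if i \<in> idx r then v i else 0) = 0"
      using v unfolding lin' by (intro inj) (auto simp: supported_on_def)
    then have "(if i \<in> idx r then v i else 0) = (0 :: 'i \<Rightarrow> complex) i" by (rule fun_cong)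
    then show "v i = 0" using i by simp
  next
    fix w
    show "\<exists>v. \<forall>j\<in>idx s. (\<Sum>i\<in>idx r. f (unit_fun i) j * v i) = w j"
      using surj[of w] lin by metis
  qed
qed

section \<open>Tensors that are symmetric along two rows\<close>

lemma sum_words_append:
  fixes F :: "'i list \<Rightarrow> complex"
  shows "(\<Sum>w\<in>words (a + b) I. F w) = (\<Sum>u\<in>words a I. \<Sum>v\<in>words b I. F (u @ v))"
  by (induction a arbitrary: F) (simp_all add: sum_words_Suc words_0)

lemma pow_entry_append:
  "length u = length u' \<Longrightarrow> pow_entry K (u @ v) (u' @ v') = pow_entry K u u' * pow_entry K v v'"
  by (induction u u' rule: list_induct2) simp_all

text \<open>\<open>sym_entry\<close> sums over the words of the output, here the words of the input
  vary. Counting the sum over both classes of words in the two orders yields the ratio of the class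
  sizes.\<close>

lemma sum_pow_entry_row:
  assumes "length u = size \<gamma>"
  shows "(\<Sum>u' | mset u' = \<gamma>. pow_entry K u u') =
    of_nat (num_words \<gamma>) / of_nat (num_words (mset u)) * sym_entry K (mset u) (some_word \<gamma>)"
proof -
  define K' where "K' i j = K j i" for i j
  have tr: "(\<Sum>u' | mset u' = \<gamma>. pow_entry K x u') = sym_entry K' \<gamma> x" if "length x = size \<gamma>" for x
    unfolding sym_entry_def
  proof (intro sum.cong refl)
    fix y assume "y \<in> {y. mset y = \<gamma>}"
    then have "length y = length x" using that by auto
    then show "pow_entry K x y = pow_entry K' y x" by (simp add: pow_entry_def K'_def)
  qed
  have "of_nat (num_words (mset u)) * sym_entry K' \<gamma> u =
      (\<Sum>x | mset x = mset u. sym_entry K' \<gamma> x)"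
  proof -
    have "sym_entry K' \<gamma> x = sym_entry K' \<gamma> u" if "mset x = mset u" for x
      using that assms mset_eq_length[OF that] by (intro sym_entry_perm) auto
    then have "(\<Sum>x | mset x = mset u. sym_entry K' \<gamma> x) = (\<Sum>x | mset x = mset u. sym_entry K' \<gamma> u)"
      by (intro sum.cong refl) blast
    then show ?thesis by (simp add: num_words_def)
  qed
  also have "\<dots> = (\<Sum>x | mset x = mset u. \<Sum>u' | mset u' = \<gamma>. pow_entry K x u')"
    using assms by (intro sum.cong refl tr[symmetric]) (auto dest: mset_eq_length)
  also have "\<dots> = (\<Sum>u' | mset u' = \<gamma>. sym_entry K (mset u) u')"
    unfolding sym_entry_def by (rule sum.swap)
  also have "\<dots> = of_nat (num_words \<gamma>) * sym_entry K (mset u) (some_word \<gamma>)"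
    using assms by (intro sum_sym_entry) simp
  finally show ?thesis
    using num_words_pos[of "mset u"] by (simp add: tr[OF assms] field_simps)
qed

text \<open>The product of the monomials \<open>\<alpha>\<close> and \<open>\<beta>\<close> is the average of the pure tensors of their words;
  \<open>unsym c\<close> holds the tensor coefficients of the element with monomial coefficients \<open>c\<close>.\<close>

definition unsym :: "nat \<Rightarrow> nat \<Rightarrow> 'i set \<Rightarrow> ('i multiset \<times> 'i multiset \<Rightarrow> complex) \<Rightarrow>
    'i multiset \<Rightarrow> 'i multiset \<Rightarrow> complex" where
  "unsym a b I c \<alpha> \<beta> = (if \<alpha> \<in> monomials a I \<and> \<beta> \<in> monomials b I
     then c (\<alpha>, \<beta>) / (of_nat (num_words \<alpha>) * of_nat (num_words \<beta>)) else 0)"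

definition row_tensor :: "nat \<Rightarrow> ('i multiset \<Rightarrow> 'i multiset \<Rightarrow> complex) \<Rightarrow> 'i list \<Rightarrow> complex" where
  "row_tensor a f w = f (mset (take a w)) (mset (drop a w))"

lemma bihom_unsym: "bihom a b I (unsym a b I c)"
  by (auto simp: bihom_def unsym_def)

lemma row_tensor_supported:
  assumes "bihom a b I f"
  shows "row_tensor a f \<in> supported_on (words (a + b) I)"
  unfolding supported_on_def
proof (clarify)
  fix w assume w: "w \<notin> words (a + b) I"
  show "row_tensor a f w = 0"
  proof (rule ccontr)
    assume "row_tensor a f w \<noteq> 0"
    then have "mset (take a w) \<in> monomials a I" "mset (drop a w) \<in> monomials b I"
      using assms by (auto simp: row_tensor_def bihom_def)
    then have "length (take a w) = a" "length (drop a w) = b" "set (take a w @ drop a w) \<subseteq> I"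
      unfolding monomials_def set_append by auto
    then have "length w = a + b" "set w \<subseteq> I" by (auto simp: min_def split: if_splits)
    then show False using w by (simp add: words_def)
  qed
qed

definition tensor_entry :: "('i \<Rightarrow> 'i \<Rightarrow> complex) \<Rightarrow> 'i multiset \<times> 'i multiset \<Rightarrow> 'i multiset \<times> 'i multiset \<Rightarrow> complex" where
  "tensor_entry K x y = sym_entry K (fst x) (some_word (fst y)) * sym_entry K (snd x) (some_word (snd y))"

text \<open>The divisions by class sizes in \<open>unsym\<close> absorb the ratios of
  \<open>sum_pow_entry_row\<close>, so the product of two symmetric powers embeds equivariantly as
  row-symmetric tensors.\<close>

lemma row_tensor_equivariant:
  assumes I: "finite I"
  shows "mat_op (words (a + b) I) (pow_entry K) (row_tensor a (unsym a b I c)) =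
    row_tensor a (unsym a b I (mat_op (monomials a I \<times> monomials b I) (tensor_entry K) c))"
proof (rule ext)
  fix w
  show "mat_op (words (a + b) I) (pow_entry K) (row_tensor a (unsym a b I c)) w =
    row_tensor a (unsym a b I (mat_op (monomials a I \<times> monomials b I) (tensor_entry K) c)) w"
  proof (cases "w \<in> words (a + b) I")
    case False
    have z: "row_tensor a (unsym a b I c') w = 0" for c'
      using row_tensor_supported[OF bihom_unsym, of a b I c'] False by (simp add: supported_on_def)
    show ?thesis using False by (simp only: z) (simp add: mat_op_def)
  next
    case True
    define u v where "u = take a w" and "v = drop a w"
    have uv: "w = u @ v" "length u = a" "length v = b" "set u \<subseteq> I" "set v \<subseteq> I"
      using True set_take_subset[of a w] set_drop_subset[of a w] by (auto simp: u_def v_def words_def)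
    have uvm: "mset u \<in> monomials a I" "mset v \<in> monomials b I" using uv by (auto simp: monomials_def)
    let ?n = "\<lambda>\<gamma>. complex_of_nat (num_words \<gamma>)"
    have n0: "?n \<gamma> \<noteq> 0" for \<gamma> :: "'a multiset" using num_words_pos[of \<gamma>] by simp
    have "mat_op (words (a + b) I) (pow_entry K) (row_tensor a (unsym a b I c)) w =
      (\<Sum>u'\<in>words a I. \<Sum>v'\<in>words b I. pow_entry K u u' * pow_entry K v v' * unsym a b I c (mset u') (mset v'))"
      using True uv unfolding mat_op_def sum_words_append
      by (auto intro!: sum.cong simp: row_tensor_def pow_entry_append words_def)
    also have "\<dots> = (\<Sum>\<alpha>\<in>monomials a I. \<Sum>\<beta>\<in>monomials b I. \<Sum>u' | mset u' = \<alpha>. \<Sum>v' | mset v' = \<beta>.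
        pow_entry K u u' * pow_entry K v v' * unsym a b I c \<alpha> \<beta>)"
      by (simp add: sum_words_eq[OF I]) (intro sum.cong refl sum.swap)
    also have "\<dots> = (\<Sum>\<alpha>\<in>monomials a I. \<Sum>\<beta>\<in>monomials b I.
        (\<Sum>u' | mset u' = \<alpha>. pow_entry K u u') * (\<Sum>v' | mset v' = \<beta>. pow_entry K v v') * unsym a b I c \<alpha> \<beta>)"
    proof (intro sum.cong refl)
      fix \<alpha> \<beta>
      show "(\<Sum>u' | mset u' = \<alpha>. \<Sum>v' | mset v' = \<beta>. pow_entry K u u' * pow_entry K v v' * unsym a b I c \<alpha> \<beta>) =
        (\<Sum>u' | mset u' = \<alpha>. pow_entry K u u') * (\<Sum>v' | mset v' = \<beta>. pow_entry K v v') * unsym a b I c \<alpha> \<beta>"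
        by (subst sum_product) (simp add: sum_distrib_right)
    qed
    also have "\<dots> = (\<Sum>\<alpha>\<in>monomials a I. \<Sum>\<beta>\<in>monomials b I.
        tensor_entry K (mset u, mset v) (\<alpha>, \<beta>) * c (\<alpha>, \<beta>) / (?n (mset u) * ?n (mset v)))"
    proof (intro sum.cong refl)
      fix \<alpha> \<beta> assume ab: "\<alpha> \<in> monomials a I" "\<beta> \<in> monomials b I"
      then have s: "length u = size \<alpha>" "length v = size \<beta>" using uv by (auto simp: monomials_def)
      show "(\<Sum>u' | mset u' = \<alpha>. pow_entry K u u') * (\<Sum>v' | mset v' = \<beta>. pow_entry K v v') * unsym a b I c \<alpha> \<beta>
        = tensor_entry K (mset u, mset v) (\<alpha>, \<beta>) * c (\<alpha>, \<beta>) / (?n (mset u) * ?n (mset v))"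
        unfolding sum_pow_entry_row[OF s(1)] sum_pow_entry_row[OF s(2)]
        using ab n0 by (simp add: unsym_def tensor_entry_def field_simps)
    qed
    also have "\<dots> = mat_op (monomials a I \<times> monomials b I) (tensor_entry K) c (mset u, mset v) / (?n (mset u) * ?n (mset v))"
      using uvm by (simp add: mat_op_def sum.cartesian_product case_prod_unfold sum_divide_distrib)
    also have "\<dots> = row_tensor a (unsym a b I (mat_op (monomials a I \<times> monomials b I) (tensor_entry K) c)) w"
      using uvm by (simp add: row_tensor_def unsym_def flip: u_def v_def)
    finally show ?thesis .
  qed
qed

section \<open>Row permutations of a two-row tableau\<close>

lemma boxes_two: "boxes [a, b] = map (Pair 0) [0..<a] @ map (Pair 1) [0..<b]"
proof -
  have "[0..<length [a, b]] = [0, 1]" by simp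
  then show ?thesis unfolding boxes_def by simp
qed

lemma boxes_two_nth:
  assumes "k < a + b"
  shows "boxes [a, b] ! k = (if k < a then (0, k) else (1, k - a))"
  using assms by (auto simp: boxes_two nth_append)

text \<open>The row group is the stabilizer of this word. Labelling the letters of a word with it
  turns equivalence under row permutations into equality of multisets.\<close>

definition row_labels :: "nat \<Rightarrow> nat \<Rightarrow> nat list" where
  "row_labels a b = replicate a 0 @ replicate b 1"

lemma row_labels: "length (row_labels a b) = a + b"
  "k < a + b \<Longrightarrow> row_labels a b ! k = fst (boxes [a, b] ! k)"
  by (auto simp: row_labels_def boxes_two_nth nth_append)

lemma row_group_two:
  "p \<in> row_group [a, b] \<longleftrightarrow> p permutes {..<a + b} \<and> permute_list p (row_labels a b) = row_labels a b"
proof (cases "p permutes {..<a + b}")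
  case True
  then have "p k < a + b" if "k < a + b" for k using permutes_in_image[OF True, of k] that by simp
  then show ?thesis
    using True by (auto simp: row_group_def list_eq_iff_nth_eq row_labels permute_list_nth)
qed (simp add: row_group_def)

definition row_mset :: "nat \<Rightarrow> nat \<Rightarrow> 'i list \<Rightarrow> (nat \<times> 'i) multiset" where
  "row_mset a b w = mset (zip (row_labels a b) w)"

lemma row_mset_eq:
  assumes "length w = a + b"
  shows "row_mset a b w = image_mset (Pair 0) (mset (take a w)) + image_mset (Pair 1) (mset (drop a w))"
proof -
  have "zip (row_labels a b) w = zip (row_labels a b) (take a w @ drop a w)" by simp
  also have "\<dots> = map (Pair 0) (take a w) @ map (Pair 1) (drop a w)"
    unfolding row_labels_def using assms by (subst zip_append) (auto simp: zip_replicate1)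
  finally show ?thesis by (simp add: row_mset_def del: append_take_drop_id)
qed

lemma row_mset_eq_iff:
  assumes "length w = a + b" "length w' = a + b"
  shows "row_mset a b w = row_mset a b w' \<longleftrightarrow>
    mset (take a w) = mset (take a w') \<and> mset (drop a w) = mset (drop a w')"
proof
  assume eq: "row_mset a b w = row_mset a b w'"
  have *: "image_mset snd (filter_mset (\<lambda>q. fst q = 0) (image_mset (Pair (0::nat)) A + image_mset (Pair 1) B)) = A"
    "image_mset snd (filter_mset (\<lambda>q. fst q = 1) (image_mset (Pair (0::nat)) A + image_mset (Pair 1) B)) = B"
    for A B :: "'a multiset"
    by (simp_all add: filter_mset_image_mset image_mset.compositionality o_def)
  show "mset (take a w) = mset (take a w') \<and> mset (drop a w) = mset (drop a w')"
    using eq unfolding row_mset_eq[OF assms(1)] row_mset_eq[OF assms(2)] by (metis *)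
qed (simp add: row_mset_eq assms)

lemma row_mset_permute:
  assumes "p \<in> row_group [a, b]" "length w = a + b"
  shows "row_mset a b (permute_list p w) = row_mset a b w"
proof -
  have p: "p permutes {..<a + b}" "permute_list p (row_labels a b) = row_labels a b"
    using assms by (auto simp: row_group_two)
  have "zip (row_labels a b) (permute_list p w) = permute_list p (zip (row_labels a b) w)"
    using p assms(2) by (subst permute_list_zip[OF p(1)]) (auto simp: row_labels)
  then show ?thesis using p(1) assms(2) by (simp add: row_mset_def row_labels)
qed

text \<open>A permutation that matches the labelled words also matches their labels, and so is a row
  permutation.\<close>

lemma row_mset_eqE:
  assumes "row_mset a b w = row_mset a b w'" "length w = a + b" "length w' = a + b"
  obtains p where "p \<in> row_group [a, b]" "permute_list p w = w'"
proof -
  have "mset (zip (row_labels a b) w') = mset (zip (row_labels a b) w)"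
    using assms by (simp add: row_mset_def)
  then obtain p where p: "p permutes {..<length (zip (row_labels a b) w)}"
    "permute_list p (zip (row_labels a b) w) = zip (row_labels a b) w'"
    by (rule mset_eq_permutation)
  have pp: "p permutes {..<a + b}" using p(1) assms by (simp add: row_labels)
  have "zip (permute_list p (row_labels a b)) (permute_list p w) = zip (row_labels a b) w'"
    using p(2) assms by (subst (asm) permute_list_zip[OF pp]) (auto simp: row_labels)
  then have "permute_list p (row_labels a b) = row_labels a b" "permute_list p w = w'"
    using assms by (simp_all add: zip_eq_conv row_labels)
  then show ?thesis using that[of p] pp by (simp add: row_group_two)
qed

lemma row_tensor_permute:
  assumes "p \<in> row_group [a, b]" "length w = a + b"
  shows "row_tensor a f (permute_list p w) = row_tensor a f w"
  using row_mset_permute[OF assms] assms(2) by (simp add: row_mset_eq_iff row_tensor_def)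

lemma row_group_comp: "p \<in> row_group lam \<Longrightarrow> q \<in> row_group lam \<Longrightarrow> p \<circ> q \<in> row_group lam"
  using permutes_in_image[of q "{..<sum_list lam}"]
  by (auto simp: row_group_def permutes_compose)

lemma row_group_inv: assumes "p \<in> row_group lam" shows "inv p \<in> row_group lam"
proof -
  have p: "p permutes {..<sum_list lam}" using assms by (simp add: row_group_def)
  then have "fst (boxes lam ! inv p k) = fst (boxes lam ! k)" if "k < sum_list lam" for k
    using assms that permutes_in_image[OF permutes_inv[OF p], of k] permutes_inverses(1)[OF p, of k]
    by (auto simp: row_group_def dest!: spec[of _ "inv p k"])
  then show ?thesis using permutes_inv[OF p] by (simp add: row_group_def)
qed

lemma finite_row_group: "finite (row_group lam)"
  by (rule finite_subset[OF _ finite_permutations[of "{..<sum_list lam}"]]) (auto simp: row_group_def)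

lemma id_in_row_group: "id \<in> row_group lam"
  by (simp add: row_group_def permutes_id)

text \<open>The row factor of the Young symmetrizer, separated from the column factor
  \<open>col_sum\<close> because on row-symmetric tensors it is only a scalar.\<close>

definition row_sum :: "nat list \<Rightarrow> ('i list \<Rightarrow> complex) \<Rightarrow> 'i list \<Rightarrow> complex" where
  "row_sum lam T = (\<Sum>p\<in>row_group lam. perm_tensor T p)"

definition col_sum :: "nat list \<Rightarrow> ('i list \<Rightarrow> complex) \<Rightarrow> 'i list \<Rightarrow> complex" where
  "col_sum lam T = (\<Sum>q\<in>col_group lam. fscale (of_int (sign q)) (perm_tensor T q))"

lemma young_symmetrizer_eq: "young_symmetrizer lam T = col_sum lam (row_sum lam T)"
  by (simp add: young_symmetrizer_def col_sum_def row_sum_def fun_eq_iff sum_fun_apply fscale_def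
      perm_tensor_def sum_distrib_left)

lemma col_sum_scale: "col_sum lam (fscale c T) = fscale c (col_sum lam T)"
  by (simp add: col_sum_def fun_eq_iff sum_fun_apply fscale_def perm_tensor_def sum_distrib_left mult_ac)

lemma young_symmetrizer_row_tensor:
  assumes "bihom a b I f"
  shows "young_symmetrizer [a, b] (row_tensor a f) =
    fscale (of_nat (card (row_group [a, b]))) (col_sum [a, b] (row_tensor a f))"
proof -
  have "perm_tensor (row_tensor a f) p w = row_tensor a f w" if p: "p \<in> row_group [a, b]" for p w
  proof (cases "length w = a + b")
    case True
    then show ?thesis
      using row_tensor_permute[OF row_group_inv[OF p]] by (simp add: perm_tensor_def)
  next
    case False
    then have "w \<notin> words (a + b) I" "permute_list (inv p) w \<notin> words (a + b) I"
      by (simp_all add: words_def)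
    then show ?thesis
      using row_tensor_supported[OF assms] by (simp add: perm_tensor_def supported_on_def)
  qed
  then have "row_sum [a, b] (row_tensor a f) = fscale (of_nat (card (row_group [a, b]))) (row_tensor a f)"
    by (simp add: row_sum_def fun_eq_iff sum_fun_apply fscale_def)
  then show ?thesis by (simp add: young_symmetrizer_eq col_sum_scale)
qed

text \<open>A row sum is invariant under the row group and so depends on a word only through the
  contents of its two rows. Hence the whole Schur space is reached from row tensors, as a quotient
  of the product of two symmetric powers.\<close>

lemma row_sum_eq_row_tensor:
  assumes T: "T \<in> supported_on (words (a + b) I)"
  obtains f where "bihom a b I f" "row_sum [a, b] T = row_tensor a f"
proof -
  let ?R = "row_sum [a, b] T"
  have inv: "?R (permute_list s w) = ?R w" if s: "s \<in> row_group [a, b]" and w: "length w = a + b" for s w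
  proof -
    have "?R (permute_list s w) = (\<Sum>p\<in>row_group [a, b]. T (permute_list (inv p) (permute_list s w)))"
      by (simp add: row_sum_def sum_fun_apply perm_tensor_def)
    also have "\<dots> = (\<Sum>p\<in>row_group [a, b]. T (permute_list (s \<circ> inv p) w))"
    proof (intro sum.cong refl)
      fix p assume "p \<in> row_group [a, b]"
      then have "inv p permutes {..<length w}"
        using w row_group_inv[of p "[a, b]"] by (auto simp: row_group_def)
      then show "T (permute_list (inv p) (permute_list s w)) = T (permute_list (s \<circ> inv p) w)"
        by (simp only: permute_list_compose)
    qed
    also have "\<dots> = (\<Sum>p\<in>row_group [a, b]. T (permute_list (inv p) w))"
    proof (rule sum.reindex_bij_witness[where i = "\<lambda>p. p \<circ> s" and j = "\<lambda>p. p \<circ> inv s"])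
      fix p assume p: "p \<in> row_group [a, b]"
      have sp: "s permutes {..<a + b}" "p permutes {..<a + b}" using s p by (auto simp: row_group_def)
      show "p \<circ> inv s \<circ> s = p" "p \<circ> s \<circ> inv s = p"
        using permutes_inv_o[OF sp(1)] by (simp_all add: o_assoc[symmetric])
      show "p \<circ> inv s \<in> row_group [a, b]" "p \<circ> s \<in> row_group [a, b]"
        using p s by (intro row_group_comp row_group_inv; simp)+
      have "inv (p \<circ> inv s) = inv (inv s) \<circ> inv p"
        using sp permutes_bij[OF permutes_inv[OF sp(1)]] permutes_bij[OF sp(2)] by (intro o_inv_distrib) auto
      then show "T (permute_list (inv (p \<circ> inv s)) w) = T (permute_list (s \<circ> inv p) w)"
        using sp by (simp add: permutes_inv_inv)
    qed
    finally show ?thesis by (simp add: row_sum_def sum_fun_apply perm_tensor_def)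
  qed
  have Rsupp: "?R \<in> supported_on (words (a + b) I)"
  proof -
    have "perm_tensor T p \<in> supported_on (words (a + b) I)" if "p \<in> row_group [a, b]" for p
      using that by (intro perm_tensor_supported[OF _ T]) (simp add: row_group_def)
    then show ?thesis by (auto simp: supported_on_def row_sum_def sum_fun_apply intro!: sum.neutral)
  qed
  define f where "f \<alpha> \<beta> = (if \<alpha> \<in> monomials a I \<and> \<beta> \<in> monomials b I
    then ?R (some_word \<alpha> @ some_word \<beta>) else 0)" for \<alpha> \<beta>
  have f: "bihom a b I f" by (auto simp: bihom_def f_def)
  have "?R w = row_tensor a f w" for w
  proof (cases "w \<in> words (a + b) I")
    case False
    then show ?thesis using row_tensor_supported[OF f] Rsupp by (simp add: supported_on_def)
  next
    case True
    then have len: "length w = a + b" by (simp add: words_def)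
    have m: "mset (take a w) \<in> monomials a I" "mset (drop a w) \<in> monomials b I"
      using True set_take_subset[of a w] set_drop_subset[of a w] by (auto simp: words_def monomials_def)
    define w' where "w' = some_word (mset (take a w)) @ some_word (mset (drop a w))"
    have l: "length (some_word (mset (take a w))) = a" "length (some_word (mset (drop a w))) = b"
      using mset_eq_length[OF mset_some_word] len by (metis length_take min.absorb2 le_add1)
        (metis add_diff_cancel_left' len length_drop mset_eq_length mset_some_word)
    then have "row_mset a b w = row_mset a b w'"
      using len by (subst row_mset_eq_iff) (auto simp: w'_def)
    then obtain p where "p \<in> row_group [a, b]" "permute_list p w = w'"
      by (rule row_mset_eqE) (use len l in \<open>auto simp: w'_def\<close>)
    then have "?R w = ?R w'" using inv[of p w] len by simp
    then show ?thesis using m by (simp add: row_tensor_def f_def w'_def)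
  qed
  then show ?thesis using that[OF f] by blast
qed

section \<open>The raising operator as a sum of transpositions\<close>

lemma perm_take_drop:
  assumes p: "p permutes {..<n}" and n: "n \<le> length w"
  shows "take n (permute_list p w) = permute_list p (take n w)" "drop n (permute_list p w) = drop n w"
proof -
  have pk: "p k < n" if "k < n" for k using permutes_in_image[OF p, of k] that by simp
  have pk': "p k = k" if "k \<ge> n" for k using p that by (auto simp: permutes_def)
  have w: "p permutes {..<length w}" by (rule permutes_subset[OF p]) (use n in auto)
  show "take n (permute_list p w) = permute_list p (take n w)"
    using n pk p w by (auto intro!: nth_equalityI simp: permute_list_nth)
  show "drop n (permute_list p w) = drop n w"
    using n pk' w by (auto intro!: nth_equalityI simp: permute_list_nth)
qed

lemma sum_mset_mset_nth: "(\<Sum>x\<in>#mset xs. h x) = (\<Sum>i<length xs. h (xs ! i) :: complex)"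
  by (induction xs) (simp_all add: sum.lessThan_Suc_shift del: sum.lessThan_Suc)

text \<open>Raising shifts the row break of a word from \<open>a\<close> to \<open>Suc a\<close>.
  The letter handed over to \<open>f\<close> in its second row is brought to position
  \<open>a\<close>, the first one after the old break, by a transposition; \<open>i = a\<close>
  gives the identity.\<close>

lemma pol_up_row_tensor:
  assumes w: "length w = a + b" and b: "b > 0"
  shows "pol_up f (mset (take (Suc a) w)) (mset (drop (Suc a) w)) =
    (\<Sum>i\<le>a. row_tensor a f (permute_list (Transposition.transpose i a) w))"
proof -
  let ?u = "take (Suc a) w"
  have lu: "length ?u = Suc a" using assms by simp
  have "pol_up f (mset ?u) (mset (drop (Suc a) w)) =
      (\<Sum>i<length ?u. f (mset ?u - {#?u ! i#}) (add_mset (?u ! i) (mset (drop (Suc a) w))))"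
    unfolding pol_up_def by (rule sum_mset_mset_nth)
  also have "\<dots> = (\<Sum>i\<le>a. row_tensor a f (permute_list (Transposition.transpose i a) w))"
    unfolding lu lessThan_Suc_atMost
  proof (intro sum.cong refl)
    fix i assume "i \<in> {..a}"
    then have i: "i \<le> a" by simp
    let ?t = "Transposition.transpose i a" and ?w = "permute_list (Transposition.transpose i a) w"
    have t: "?t permutes {..<Suc a}" using i by (intro permutes_swap_id) auto
    have tw: "?t permutes {..<length w}" by (rule permutes_subset[OF t]) (use assms in auto)
    have aw: "a < length w" using assms by simp
    have wa: "?w ! a = w ! i" using aw by (simp add: permute_list_nth[OF tw])
    have "mset ?u = mset (take (Suc a) ?w)"
      using perm_take_drop(1)[OF t, of w] aw t lu by simp
    also have "\<dots> = add_mset (w ! i) (mset (take a ?w))"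
      using aw by (simp add: take_Suc_conv_app_nth wa)
    finally have 1: "mset (take a ?w) = mset ?u - {#?u ! i#}" using i by simp
    have "drop a ?w = w ! i # drop (Suc a) ?w"
      using aw by (metis Cons_nth_drop_Suc length_permute_list wa)
    also have "drop (Suc a) ?w = drop (Suc a) w"
      using perm_take_drop(2)[OF t, of w] aw by simp
    finally have 2: "mset (drop a ?w) = add_mset (?u ! i) (mset (drop (Suc a) w))" using i by simp
    show "f (mset ?u - {#?u ! i#}) (add_mset (?u ! i) (mset (drop (Suc a) w))) = row_tensor a f ?w"
      by (simp only: row_tensor_def 1 2)
  qed
  finally show ?thesis .
qed

section \<open>Column permutations and alternation\<close>

definition col_swap :: "nat \<Rightarrow> nat set \<Rightarrow> nat \<Rightarrow> nat" where
  "col_swap a C k = (if k < a \<and> k \<in> C then a + k else if k \<ge> a \<and> k - a \<in> C then k - a else k)"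

lemma col_swap_insert:
  assumes "C \<subseteq> {..<a}" "j < a" "j \<notin> C"
  shows "col_swap a (insert j C) = Transposition.transpose j (a + j) \<circ> col_swap a C"
  using assms by (auto simp: fun_eq_iff col_swap_def Transposition.transpose_def)

lemma col_swap_involutive: "C \<subseteq> {..<a} \<Longrightarrow> col_swap a C (col_swap a C k) = k"
  by (auto simp: col_swap_def)

lemma col_swap_permutes:
  assumes "C \<subseteq> {..<b}" "b \<le> a"
  shows "col_swap a C permutes {..<a + b}"
proof (rule bij_imp_permutes)
  show "bij_betw (col_swap a C) {..<a + b} {..<a + b}"
    by (rule bij_betwI[where g = "col_swap a C"])
      (use assms in \<open>auto simp: col_swap_def\<close>)
qed (use assms in \<open>auto simp: col_swap_def\<close>)

lemma sign_col_swap: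
  assumes "finite C" "C \<subseteq> {..<b}" "b \<le> a"
  shows "sign (col_swap a C) = (-1) ^ card C"
  using assms
proof (induction C rule: finite_induct)
  case empty
  have "col_swap a {} = id" by (auto simp: col_swap_def)
  then show ?case by (simp add: sign_id)
next
  case (insert j C)
  have "col_swap a C permutes {..<a + b}" using insert.prems by (intro col_swap_permutes) auto
  then have p: "permutation (col_swap a C)" unfolding permutation_permutes by blast
  note p = p permutation_swap_id[of j "a + j"]
  have "sign (Transposition.transpose j (a + j)) = -1"
    using insert.prems by (subst sign_swap_id) auto
  then show ?case
    using insert p by (subst col_swap_insert) (auto simp: sign_compose)
qed

text \<open>Columns have height at most two, so a column permutation is determined by the set
  \<open>C\<close> of columns that it swaps.\<close>

lemma col_group_two:
  assumes "b \<le> a"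
  shows "col_group [a, b] = col_swap a ` Pow {..<b}"
proof (intro equalityI subsetI)
  fix q assume "q \<in> col_swap a ` Pow {..<b}"
  then obtain C where C: "C \<subseteq> {..<b}" "q = col_swap a C" by auto
  show "q \<in> col_group [a, b]"
    using col_swap_permutes[OF C(1) assms] C assms
    by (auto simp: col_group_def C(2) col_swap_def boxes_two_nth)
next
  fix q assume q: "q \<in> col_group [a, b]"
  then have perm: "q permutes {..<a + b}" and col: "\<And>k. k < a + b \<Longrightarrow> snd (boxes [a, b] ! q k) = snd (boxes [a, b] ! k)"
    by (auto simp: col_group_def)
  have im: "q k < a + b" if "k < a + b" for k using permutes_in_image[OF perm, of k] that by simp
  have col': "(if q k < a then q k else q k - a) = (if k < a then k else k - a)" if "k < a + b" for k
    using col[OF that] im[OF that] that by (simp add: boxes_two_nth split: if_splits)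
  have inj: "q k = q l \<longleftrightarrow> k = l" for k l using permutes_inj[OF perm] by (auto simp: inj_eq)
  define C where "C = {k. k < a \<and> q k \<noteq> k}"
  have 1: "q k = a + k \<and> k < b" if "k \<in> C" for k
    using that col'[of k] im[of k] by (auto simp: C_def split: if_splits)
  have 2: "q (a + k) = (if k \<in> C then k else a + k)" if "k < b" for k
  proof (cases "k \<in> C")
    case True
    then have "q (a + k) \<noteq> a + k" using 1[OF True] inj[of k "a + k"] assms that by auto
    then show ?thesis using True col'[of "a + k"] that by (auto split: if_splits)
  next
    case False
    then have "q k = k" using that assms by (auto simp: C_def)
    then have "q (a + k) \<noteq> k" using inj[of k "a + k"] that assms by auto
    then show ?thesis using False col'[of "a + k"] that by (auto split: if_splits)
  qed
  have "q k = col_swap a C k" for k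
  proof -
    consider "k < a" | "k \<ge> a" "k < a + b" | "k \<ge> a + b" by linarith
    then show ?thesis
    proof cases
      case 1
      then show ?thesis using \<open>\<And>k. k \<in> C \<Longrightarrow> q k = a + k \<and> k < b\<close> by (auto simp: col_swap_def C_def)
    next
      case 2
      then show ?thesis using \<open>\<And>k. k < b \<Longrightarrow> q (a + k) = (if k \<in> C then k else a + k)\<close>[of "k - a"]
        by (auto simp: col_swap_def)
    next
      case 3
      then have "q k = k" using perm by (auto simp: permutes_def)
      moreover have "k - a \<notin> C" using 3 1 by fastforce
      ultimately show ?thesis using 3 by (auto simp: col_swap_def)
    qed
  qed
  then have "q = col_swap a C" by (rule ext)
  moreover have "C \<subseteq> {..<b}" using 1 by auto
  ultimately show "q \<in> col_swap a ` Pow {..<b}" by auto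
qed

text \<open>Listed from the last column to the first, so that the column added in the induction of
  \<open>sum_col_swap\<close> stands at the head, where \<open>col_alt\<close> expands.\<close>

definition first_cols :: "nat \<Rightarrow> nat \<Rightarrow> 'i list \<Rightarrow> ('i \<times> 'i) list" where
  "first_cols a n w = map (\<lambda>j. (w ! j, w ! (a + j))) (rev [0..<n])"

text \<open>The subsets of the first \<open>Suc n\<close> columns split by whether they contain
  \<open>n\<close>. Those that do amount to exchanging the letters at \<open>n\<close> and
  \<open>a + n\<close> beforehand, with a minus sign, which is the recursion of
  \<open>col_alt\<close>.\<close>

lemma sum_col_swap:
  assumes "length w = a + b" "b \<le> a" "n \<le> b"
  shows "(\<Sum>C\<in>Pow {..<n}. (-1) ^ card C * row_tensor a f (permute_list (col_swap a C) w)) =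
    col_alt f (first_cols a n w) (mset (drop n (take a w))) (mset (drop (n + a) w))"
  using assms
proof (induction n arbitrary: w)
  case 0
  have "col_swap a {} = id" by (auto simp: col_swap_def)
  then show ?case by (simp add: first_cols_def row_tensor_def)
next
  case (Suc n)
  let ?t = "Transposition.transpose n (a + n)"
  let ?w = "permute_list ?t w"
  have na: "n < a" "a + n < length w" "n < length w" using Suc.prems by auto
  have t: "?t permutes {..<length w}" using na by (intro permutes_swap_id) auto
  have wn: "?w ! k = w ! ?t k" if "k < length w" for k using that by (simp add: permute_list_nth[OF t])
  have "(\<Sum>C\<in>Pow {..<Suc n}. (-1) ^ card C * row_tensor a f (permute_list (col_swap a C) w)) =
      (\<Sum>C\<in>Pow {..<n}. (-1) ^ card C * row_tensor a f (permute_list (col_swap a C) w)) +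
      (\<Sum>C\<in>insert n ` Pow {..<n}. (-1) ^ card C * row_tensor a f (permute_list (col_swap a C) w))"
    unfolding lessThan_Suc Pow_insert by (rule sum.union_disjoint) auto
  also have "(\<Sum>C\<in>insert n ` Pow {..<n}. (-1) ^ card C * row_tensor a f (permute_list (col_swap a C) w)) =
      (\<Sum>C\<in>Pow {..<n}. (-1) ^ card (insert n C) * row_tensor a f (permute_list (col_swap a (insert n C)) w))"
    by (subst sum.reindex) (auto simp: inj_on_def)
  also have "\<dots> = (\<Sum>C\<in>Pow {..<n}. - ((-1) ^ card C * row_tensor a f (permute_list (col_swap a C) ?w)))"
  proof (intro sum.cong refl)
    fix C assume "C \<in> Pow {..<n}"
    then have C: "C \<subseteq> {..<n}" by simp
    then have fC: "finite C" "n \<notin> C" using finite_subset by auto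
    have "col_swap a (insert n C) = ?t \<circ> col_swap a C"
      using C na by (intro col_swap_insert) auto
    moreover have "C \<subseteq> {..<b}" using C Suc.prems(3) by (auto dest!: subsetD)
    then have "col_swap a C permutes {..<length w}"
      using col_swap_permutes[of C b a] Suc.prems by simp
    ultimately have "permute_list (col_swap a (insert n C)) w = permute_list (col_swap a C) ?w"
      by (simp only: permute_list_compose)
    then show "(-1) ^ card (insert n C) * row_tensor a f (permute_list (col_swap a (insert n C)) w) =
        - ((-1) ^ card C * row_tensor a f (permute_list (col_swap a C) ?w))"
      using fC by simp
  qed
  also have "\<dots> = - col_alt f (first_cols a n ?w) (mset (drop n (take a ?w))) (mset (drop (n + a) ?w))"
    using Suc by (simp add: sum_negf)
  also have "(\<Sum>C\<in>Pow {..<n}. (-1) ^ card C * row_tensor a f (permute_list (col_swap a C) w)) =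
      col_alt f (first_cols a n w) (mset (drop n (take a w))) (mset (drop (n + a) w))"
    using Suc by simp
  also have "first_cols a n ?w = first_cols a n w"
    using na by (auto simp: first_cols_def wn Transposition.transpose_def)
  also have "drop n (take a ?w) = w ! (a + n) # drop (Suc n) (take a w)"
  proof -
    have "drop n (take a ?w) = ?w ! n # drop (Suc n) (take a ?w)"
      using na by (metis Cons_nth_drop_Suc length_permute_list length_take min_less_iff_conj nth_take)
    moreover have "drop (Suc n) (take a ?w) = drop (Suc n) (take a w)"
      using na by (intro nth_equalityI) (auto simp: wn Transposition.transpose_def)
    ultimately show ?thesis using na by (simp add: wn)
  qed
  also have "drop (n + a) ?w = w ! n # drop (Suc n + a) w"
  proof -
    have "drop (n + a) ?w = ?w ! (a + n) # drop (Suc (a + n)) ?w"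
      using na by (metis Cons_nth_drop_Suc add.commute length_permute_list)
    moreover have "drop (Suc (a + n)) ?w = drop (Suc (a + n)) w"
      using na by (intro nth_equalityI) (auto simp: wn Transposition.transpose_def)
    ultimately show ?thesis using na by (simp add: wn add.commute)
  qed
  also have "drop n (take a w) = w ! n # drop (Suc n) (take a w)"
    using na by (metis Cons_nth_drop_Suc length_take min_less_iff_conj nth_take)
  also have "drop (n + a) w = w ! (a + n) # drop (Suc n + a) w"
    using na by (metis Cons_nth_drop_Suc add.commute add_Suc)
  also have "first_cols a (Suc n) w = (w ! n, w ! (a + n)) # first_cols a n w"
    by (simp add: first_cols_def)
  ultimately show ?case
    by (simp add: first_cols_def)
qed

text \<open>Once all \<open>b\<close> columns are alternated the second row is used up; hence the
  empty multiset.\<close>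

lemma col_sum_row_tensor:
  assumes "length w = a + b" "b \<le> a"
  shows "col_sum [a, b] (row_tensor a f) w = col_alt f (first_cols a b w) (mset (drop b (take a w))) {#}"
proof -
  have inj: "inj_on (col_swap a) (Pow {..<b})"
  proof (rule inj_onI)
    fix C D assume "C \<in> Pow {..<b}" "D \<in> Pow {..<b}" and eq: "col_swap a C = col_swap a D"
    then have sub: "C \<subseteq> {..<a}" "D \<subseteq> {..<a}" using assms(2) by auto
    have "k \<in> E \<longleftrightarrow> k < a \<and> col_swap a E k \<noteq> k" if "E \<subseteq> {..<a}" for E k
      using that by (auto simp: col_swap_def)
    then show "C = D" using sub eq by (metis subsetI subset_antisym)
  qed
  have "inv (col_swap a C) = col_swap a C" if "C \<subseteq> {..<b}" for C
  proof -
    have "C \<subseteq> {..<a}" using that assms(2) by auto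
    then show ?thesis by (intro inv_unique_comp) (simp_all add: fun_eq_iff col_swap_involutive)
  qed
  then have "col_sum [a, b] (row_tensor a f) w =
      (\<Sum>C\<in>Pow {..<b}. (-1) ^ card C * row_tensor a f (permute_list (col_swap a C) w))"
    using assms(2) finite_subset[of _ "{..<b}"]
    by (simp add: col_sum_def col_group_two[OF assms(2)] sum.reindex[OF inj] sum_fun_apply fscale_def
        perm_tensor_def sign_col_swap[of _ b])
  also have "\<dots> = col_alt f (first_cols a b w) (mset (drop b (take a w))) {#}"
    using sum_col_swap[OF assms order_refl] assms by simp
  finally show ?thesis .
qed

section \<open>Jacobi--Trudi for two rows\<close>

lemma idx_schur [simp]: "idx (schur lam r) = basis_of (schur_space lam (idx r))"
  by transfer auto

lemma mtx_schur: "mtx (schur lam r) g =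
    restr_mtx (words (sum_list lam) (idx r)) (\<lambda>g. pow_entry (mtx r g)) (schur_space lam (idx r)) g"
  by transfer auto

lemma young_symmetrizer_add: "young_symmetrizer lam (T + U) = young_symmetrizer lam T + young_symmetrizer lam U"
  and young_symmetrizer_scale: "young_symmetrizer lam (fscale c T) = fscale c (young_symmetrizer lam T)"
  by (simp_all add: fun_eq_iff young_symmetrizer_def sum_fun_apply fscale_def perm_tensor_def
      sum.distrib[symmetric] sum_distrib_left algebra_simps)

text \<open>Lowering commutes with alternation, and after alternation the second row is empty, so
  there is no letter left for \<open>pol_down\<close> to move.\<close>

lemma young_symmetrizer_pol_down:
  assumes "bihom a b I (pol_down f)" "b \<le> a"
  shows "young_symmetrizer [a, b] (row_tensor a (pol_down f)) = 0"
proof (rule ext)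
  fix w
  have "row_tensor a (pol_down f) \<in> supported_on (words (sum_list [a, b]) I)"
    using row_tensor_supported[OF assms(1)] by simp
  note supp = young_symmetrizer_supported[OF this]
  show "young_symmetrizer [a, b] (row_tensor a (pol_down f)) w = 0 w"
  proof (cases "length w = a + b")
    case True
    then show ?thesis
      using assms(2)
      by (simp add: young_symmetrizer_row_tensor[OF assms(1)] fscale_def col_sum_row_tensor)
        (simp flip: pol_down_col_alt add: pol_down_def)
  next
    case False
    then show ?thesis using supp by (simp add: supported_on_def words_def)
  qed
qed

lemma row_tensor_unsym_inj:
  assumes "row_tensor a (unsym a b I c) = row_tensor a (unsym a b I c')"
    and "\<alpha> \<in> monomials a I" "\<beta> \<in> monomials b I"
  shows "c (\<alpha>, \<beta>) = c' (\<alpha>, \<beta>)"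
proof -
  have l: "length (some_word \<alpha>) = a"
    using assms(2) some_word_in_words[OF assms(2)] by (simp add: words_def)
  have "row_tensor a (unsym a b I d) (some_word \<alpha> @ some_word \<beta>) = unsym a b I d \<alpha> \<beta>" for d
    by (simp add: row_tensor_def l)
  then have "unsym a b I c \<alpha> \<beta> = unsym a b I c' \<alpha> \<beta>" using assms(1) by metis
  then show ?thesis using assms(2,3) num_words_pos[of \<alpha>] num_words_pos[of \<beta>] by (simp add: unsym_def)
qed

text \<open>On tensors, raising is a sum of place permutations; its equivariance thus reduces to
  \<open>mat_op_perm_tensor\<close>.\<close>

lemma row_tensor_pol_up:
  assumes f: "bihom a (Suc b) I f"
  shows "row_tensor (Suc a) (pol_up f) = (\<Sum>i\<le>a. perm_tensor (row_tensor a f) (Transposition.transpose i a))"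
proof (rule ext)
  fix w
  have "(\<Sum>i\<le>a. perm_tensor (row_tensor a f) (Transposition.transpose i a)) w =
      (\<Sum>i\<le>a. row_tensor a f (permute_list (Transposition.transpose i a) w))"
    by (simp add: sum_fun_apply perm_tensor_def)
  also have "\<dots> = row_tensor (Suc a) (pol_up f) w"
  proof (cases "length w = a + Suc b")
    case True
    then show ?thesis using pol_up_row_tensor[of w a "Suc b" f] by (simp add: row_tensor_def)
  next
    case False
    then show ?thesis
      using row_tensor_supported[OF f] row_tensor_supported[OF bihom_up[OF f]]
      by (simp add: supported_on_def words_def)
  qed
  finally show "row_tensor (Suc a) (pol_up f) w =
      (\<Sum>i\<le>a. perm_tensor (row_tensor a f) (Transposition.transpose i a)) w" ..
qed

text \<open>The isomorphism sends an element to its Young symmetrization and its image under \<^const>\<open>pol_up\<close>.\<close>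

lemma jacobi_trudi_two_rows:
  fixes r :: "'i rep"
  assumes ab: "Suc b \<le> a"
  shows "sym_pow a r \<otimes>\<^sub>r sym_pow (Suc b) r \<cong>\<^sub>r
    schur [a, Suc b] r \<oplus>\<^sub>r (sym_pow (Suc a) r \<otimes>\<^sub>r sym_pow b r)"
proof -
  let ?I = "idx r" and ?lam = "[a, Suc b]"
  let ?J = "words (sum_list ?lam) ?I"
  have J: "?J = words (a + Suc b) ?I" "words (Suc a + b) ?I = ?J" by simp_all
  define W where "W = schur_space ?lam ?I"
  define B where "B = basis_of W"
  have subW: "fn.subspace W" by (simp add: W_def schur_space_subspace)
  have Wsupp: "W \<subseteq> supported_on ?J"
    unfolding W_def schur_space_def using young_symmetrizer_supported by blast
  have finJ: "finite ?J" by (simp add: finite_words)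
  have indB: "fn.independent B" and spanB: "fn.span B = W"
    using basis_of[OF subW] by (auto simp: B_def)
  have finB: "finite B"
  proof -
    obtain B' where "finite B'" "B' \<subseteq> W" "fn.span B' = W"
      using finite_basis[OF finJ subW Wsupp] by metis
    then show ?thesis using fn.independent_span_bound[OF _ indB, of B'] spanB fn.span_superset[of B] by auto
  qed
  let ?R = "fn.representation B"
  define U where "U c = unsym a (Suc b) ?I c" for c
  define Y where "Y c = young_symmetrizer ?lam (row_tensor a (U c))" for c
  \<comment> \<open>Multiplication by the class sizes leads back from tensor coefficients to
    monomial coefficients, so that \<open>unsym\<close> undoes it (\<open>Urow\<close>).\<close>
  define E where "E c = (\<lambda>(\<alpha>, \<beta>). of_nat (num_words \<alpha>) * of_nat (num_words \<beta>) * pol_up (U c) \<alpha> \<beta>)" for c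
  define f where "f c = case_sum (?R (Y c)) (E c)" for c
  have n0: "complex_of_nat (num_words \<gamma>) \<noteq> 0" for \<gamma> :: "'i multiset" using num_words_pos[of \<gamma>] by simp
  have bU: "bihom a (Suc b) ?I (U c)" for c by (simp add: U_def bihom_unsym)
  have TU: "row_tensor a (U c) \<in> supported_on ?J" for c using row_tensor_supported[OF bU] by simp
  have YW: "Y c \<in> W" for c using TU by (auto simp: Y_def W_def schur_space_def)
  have U_add: "U (u + v) \<alpha> \<beta> = U u \<alpha> \<beta> + U v \<alpha> \<beta>" and U_scale: "U (fscale k u) \<alpha> \<beta> = k * U u \<alpha> \<beta>"
    for u v k \<alpha> \<beta> by (simp_all add: U_def unsym_def fscale_def add_divide_distrib)
  have T_add: "row_tensor a (U (u + v)) = row_tensor a (U u) + row_tensor a (U v)"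
    and T_scale: "row_tensor a (U (fscale k u)) = fscale k (row_tensor a (U u))" for u v k
    by (auto simp: fun_eq_iff row_tensor_def U_add U_scale[unfolded fscale_def] fscale_def)
  have E_add: "E (u + v) x = E u x + E v x" and E_scale: "E (fscale k u) x = k * E u x" for u v k x
    by (cases x; simp add: E_def pol_up_def U_add U_scale sum_mset.distrib sum_mset_distrib_left algebra_simps)+
  have Urow: "unsym (Suc a) b ?I (E c) = pol_up (U c)" for c
    using bihom_up[OF bU[of c]] n0 by (intro ext) (auto simp: unsym_def E_def bihom_def)
  let ?r = "sym_pow a r \<otimes>\<^sub>r sym_pow (Suc b) r" and ?s = "sym_pow (Suc a) r \<otimes>\<^sub>r sym_pow b r"
  have mtx_eq: "mtx (sym_pow p r \<otimes>\<^sub>r sym_pow q r) g = tensor_entry (mtx r g)" for p q g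
    by (intro ext) (simp add: mtx_tensor mtx_sym_pow tensor_entry_def)
  have U_op: "row_tensor a (U (mat_op (idx ?r) (mtx ?r g) c)) = mat_op ?J (pow_entry (mtx r g)) (row_tensor a (U c))"
    for g c
    using row_tensor_equivariant[OF finite_idx, of a "Suc b" r "mtx r g" c] by (simp add: U_def mtx_eq)
  have Y_op: "Y (mat_op (idx ?r) (mtx ?r g) c) = mat_op ?J (pow_entry (mtx r g)) (Y c)" for g c
    unfolding Y_def U_op by (rule mat_op_young_symmetrizer[OF finite_idx TU, symmetric])
  \<comment> \<open>Checked on tensors, where place permutations commute with the action;
    \<open>row_tensor_unsym_inj\<close> then returns to monomial coefficients.\<close>
  have E_op: "E (mat_op (idx ?r) (mtx ?r g) c) x = mat_op (idx ?s) (mtx ?s g) (E c) x"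
    if "x \<in> idx ?s" for g c x
  proof -
    have "row_tensor (Suc a) (unsym (Suc a) b ?I (E (mat_op (idx ?r) (mtx ?r g) c))) =
        (\<Sum>i\<le>a. perm_tensor (mat_op ?J (pow_entry (mtx r g)) (row_tensor a (U c))) (Transposition.transpose i a))"
      unfolding Urow row_tensor_pol_up[OF bU] U_op ..
    also have "\<dots> = (\<Sum>i\<le>a. mat_op ?J (pow_entry (mtx r g)) (perm_tensor (row_tensor a (U c)) (Transposition.transpose i a)))"
    proof (intro sum.cong refl mat_op_perm_tensor[symmetric] finite_idx TU)
      fix i assume "i \<in> {..a}"
      then show "Transposition.transpose i a permutes {..<sum_list ?lam}"
        by (intro permutes_swap_id) auto
    qed
    also have "\<dots> = mat_op ?J (pow_entry (mtx r g)) (\<Sum>i\<le>a. perm_tensor (row_tensor a (U c)) (Transposition.transpose i a))"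
      using mat_op_sum[of ?J "pow_entry (mtx r g)" "\<lambda>_. 1"
          "\<lambda>i. perm_tensor (row_tensor a (U c)) (Transposition.transpose i a)" "{..a}"]
      by (simp only: fn.scale_one)
    also have "\<dots> = mat_op ?J (pow_entry (mtx r g)) (row_tensor (Suc a) (unsym (Suc a) b ?I (E c)))"
      by (simp only: Urow row_tensor_pol_up[OF bU])
    also have "\<dots> = row_tensor (Suc a) (unsym (Suc a) b ?I (mat_op (idx ?s) (mtx ?s g) (E c)))"
      using row_tensor_equivariant[OF finite_idx, of "Suc a" b r "mtx r g" "E c"] by (simp add: mtx_eq)
    finally show ?thesis using that by (cases x) (auto dest: row_tensor_unsym_inj)
  qed
  have R_op: "?R (mat_op ?J (pow_entry (mtx r g)) v) b' = (\<Sum>b\<in>B. mtx (schur ?lam r) g b' b * ?R v b)"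
    if g: "g \<in> SL3" and v: "v \<in> W" for g v b'
  proof -
    let ?op = "mat_op ?J (pow_entry (mtx r g))"
    have opW: "?op x \<in> fn.span B" if xW: "x \<in> W" for x
    proof -
      obtain T where T: "x = young_symmetrizer ?lam T" "T \<in> supported_on ?J"
        using xW unfolding W_def schur_space_def by blast
      show ?thesis
        unfolding spanB T(1) mat_op_young_symmetrizer[OF finite_idx T(2)] W_def schur_space_def
        by (intro imageI mat_op_supported)
    qed
    have "v = (\<Sum>b\<in>B. fscale (?R v b) b)"
      using fn.sum_representation_eq[OF indB _ finB subset_refl, of v] v spanB by simp
    then have "?op v = ?op (\<Sum>b\<in>B. fscale (?R v b) b)" by (rule arg_cong)
    also have "\<dots> = (\<Sum>b\<in>B. fscale (?R v b) (?op b))" by (rule mat_op_sum)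
    finally have "?op v = (\<Sum>b\<in>B. fscale (?R v b) (?op b))" .
    moreover have "?op b \<in> fn.span B" if "b \<in> B" for b
      using that spanB fn.span_base[of b B] by (intro opW) simp
    ultimately have "?R (?op v) b' = (\<Sum>b\<in>B. ?R v b * ?R (?op b) b')"
      by (simp add: fn.representation_sum[OF indB] fn.representation_scale[OF indB] fn.span_scale)
    then show ?thesis
      by (simp add: mtx_schur restr_mtx_def W_def[symmetric] B_def[symmetric] mult.commute)
  qed
  have card0: "complex_of_nat (card (row_group ?lam)) \<noteq> 0"
    using finite_row_group[of ?lam] id_in_row_group[of ?lam] by auto
  have idxs: "idx (schur ?lam r \<oplus>\<^sub>r ?s) = B <+> idx ?s" by (simp add: B_def W_def)
  show ?thesis
  proof (rule rep_iso_of_bij_map[where f = f])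
    fix u v k
    have "Y (u + v) = Y u + Y v" "Y (fscale k u) = fscale k (Y u)"
      by (simp_all only: Y_def T_add T_scale young_symmetrizer_add young_symmetrizer_scale)
    then have "?R (Y (u + v)) x = ?R (Y u) x + ?R (Y v) x" "?R (Y (fscale k u)) x = k * ?R (Y u) x" for x
      using YW spanB by (simp_all add: fn.representation_add[OF indB] fn.representation_scale[OF indB])
    then show "f (u + v) = f u + f v" "f (fscale k u) = fscale k (f u)"
      by (auto simp: f_def fun_eq_iff fscale_def E_add E_scale[unfolded fscale_def] split: sum.splits)
  next
    fix g v j assume g: "g \<in> SL3" and j: "j \<in> idx (schur ?lam r \<oplus>\<^sub>r ?s)"
    show "f (mat_op (idx ?r) (mtx ?r g) v) j =
        mat_op (idx (schur ?lam r \<oplus>\<^sub>r ?s)) (mtx (schur ?lam r \<oplus>\<^sub>r ?s) g) (f v) j"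
    proof (cases j)
      case (Inl b)
      then show ?thesis
        using j R_op[OF g YW[of v], of b] unfolding idxs
        by (simp add: f_def Y_op mat_op_def[of "B <+> idx ?s"] sum.Plus finB del: idx_simps)
    next
      case (Inr x)
      then have x: "x \<in> idx ?s" using j by (auto simp del: idx_simps(5))
      show ?thesis
        using Inr j x unfolding idxs
        by (simp add: f_def E_op[OF x] mat_op_def[of "B <+> idx ?s"] mat_op_def[of "idx ?s"] sum.Plus finB del: idx_simps)
    qed
  next
    fix v assume v: "v \<in> supported_on (idx ?r)"
      and z: "\<And>j. j \<in> idx (schur ?lam r \<oplus>\<^sub>r ?s) \<Longrightarrow> f v j = 0"
    have "?R (Y v) b = 0" if "b \<in> B" for b
      using z[of "Inl b"] that unfolding idxs by (simp add: f_def in_Plus_iff)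
    then have Y0: "Y v = 0"
      using fn.sum_representation_eq[OF indB _ finB subset_refl, of "Y v"] YW[of v] spanB by simp
    have up: "pol_up (U v) \<alpha> \<beta> = 0" for \<alpha> \<beta>
    proof (cases "\<alpha> \<in> monomials (Suc a) ?I \<and> \<beta> \<in> monomials b ?I")
      case True
      then show ?thesis
        using z[of "Inr (\<alpha>, \<beta>)"] num_words_pos[of \<alpha>] num_words_pos[of \<beta>] unfolding idxs by (simp add: f_def in_Plus_iff E_def)
    next
      case False
      then show ?thesis using bihom_up[OF bU] by (auto simp: bihom_def)
    qed
    have "col_alt (U v) cs \<alpha> {#} = 0" if cs: "length cs = Suc b" for cs \<alpha>
    proof (rule ccontr)
      assume "col_alt (U v) cs \<alpha> {#} \<noteq> 0"
      note * = bihom_col_alt[OF bU this]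
      \<comment> \<open>A word with \<open>cs\<close> as its columns of height two: top letters,
        then \<open>\<alpha>\<close>, then bottom letters; reversed because
        \<open>first_cols\<close> starts with the last column.\<close>
      define w where "w = map fst (rev cs) @ some_word \<alpha> @ map snd (rev cs)"
      have la: "length (some_word \<alpha>) = size \<alpha>" using mset_some_word[of \<alpha>] by (metis size_mset)
      have aa: "a = size \<alpha> + Suc b" using * cs by simp
      have ta: "take a w = map fst (rev cs) @ some_word \<alpha>" and da: "drop a w = map snd (rev cs)"
        by (simp_all add: w_def la cs aa)
      have lw: "length w = a + Suc b" using * cs la by (simp add: w_def)
      have "map (\<lambda>j. (w ! j, w ! (a + j))) [0..<Suc b] = rev cs"
      proof (rule nth_equalityI)
        fix j assume "j < length (map (\<lambda>j. (w ! j, w ! (a + j))) [0..<Suc b])"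
        then have j: "j < Suc b" by simp
        have "w ! j = take a w ! j" using j ab by simp
        moreover have "w ! (a + j) = drop a w ! j" using lw by (simp)
        ultimately show "map (\<lambda>j. (w ! j, w ! (a + j))) [0..<Suc b] ! j = rev cs ! j"
          using j cs by (simp add: ta da nth_append del: upt_Suc)
      qed (simp add: cs)
      then have "first_cols a (Suc b) w = cs"
        unfolding first_cols_def rev_map[symmetric] by (metis rev_rev_ident)
      then have "col_alt (U v) cs \<alpha> {#} = col_sum ?lam (row_tensor a (U v)) w"
        using col_sum_row_tensor[OF lw ab, of "U v"] cs by (simp add: ta)
      moreover have "Y v w = 0" by (simp add: Y0)
      ultimately show False
        using \<open>col_alt (U v) cs \<alpha> {#} \<noteq> 0\<close> card0
        by (simp add: Y_def young_symmetrizer_row_tensor[OF bU] fscale_def)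
    qed
    then have "U v \<alpha> \<beta> = 0" for \<alpha> \<beta> by (intro highest_weight_col_alt_inj[OF bU up])
    then have "v (\<alpha>, \<beta>) = 0" if "(\<alpha>, \<beta>) \<in> idx ?r" for \<alpha> \<beta>
      using that n0[of \<alpha>] n0[of \<beta>] unfolding U_def unsym_def by (metis (no_types, lifting)
          divide_eq_0_iff idx_simps(5) idx_sym_pow mem_Sigma_iff mult_eq_0_iff)
    then show "v = 0" using v by (auto simp: supported_on_def fun_eq_iff)
  next
    fix w :: "('i list \<Rightarrow> complex) + 'i multiset \<times> 'i multiset \<Rightarrow> complex"
    define S where "S = (\<Sum>b\<in>B. fscale (w (Inl b)) b)"
    have "S \<in> W" unfolding S_def spanB[symmetric]
      by (intro fn.span_sum fn.span_scale fn.span_base)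
    then obtain T where T: "S = young_symmetrizer ?lam T" "T \<in> supported_on ?J"
      unfolding W_def schur_space_def by blast
    obtain f0 where f0: "bihom a (Suc b) ?I f0" "row_sum ?lam T = row_tensor a f0"
      by (rule row_sum_eq_row_tensor[OF T(2)[unfolded J(1)]])
    \<comment> \<open>The division compensates the scalar of
      \<open>young_symmetrizer_row_tensor\<close>.\<close>
    define f1 where "f1 \<alpha> \<beta> = (1 / of_nat (card (row_group ?lam))) * f0 \<alpha> \<beta>" for \<alpha> \<beta>
    have f1: "bihom a (Suc b) ?I f1" using f0 by (auto simp: bihom_def f1_def)
    have T1: "row_tensor a f1 = fscale (1 / of_nat (card (row_group ?lam))) (row_tensor a f0)"
      by (simp add: fun_eq_iff row_tensor_def f1_def fscale_def)
    have "S = col_sum ?lam (row_tensor a f0)" by (simp add: T(1) young_symmetrizer_eq f0(2))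
    also have "\<dots> = young_symmetrizer ?lam (row_tensor a f1)"
      using card0 by (subst young_symmetrizer_row_tensor[OF f1]) (simp add: T1 col_sum_scale)
    finally have S1: "S = young_symmetrizer ?lam (row_tensor a f1)" .
    \<comment> \<open>\<open>u\<close> is the defect of \<open>f1\<close> in the second component.
      Adding \<open>pol_down k\<close> with \<open>pol_up (pol_down k) = u\<close> repairs it and,
      by \<open>young_symmetrizer_pol_down\<close>, leaves the first component alone.\<close>
    define u where "u \<alpha> \<beta> = (if \<alpha> \<in> monomials (Suc a) ?I \<and> \<beta> \<in> monomials b ?I
      then w (Inr (\<alpha>, \<beta>)) / (of_nat (num_words \<alpha>) * of_nat (num_words \<beta>)) - pol_up f1 \<alpha> \<beta> else 0)" for \<alpha> \<beta>
    have "bihom (Suc a) b ?I u" by (auto simp: bihom_def u_def)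
    then obtain k where k: "bihom (Suc a) b ?I k" "pol_up (pol_down k) = u"
      using pol_up_down_surj[of "Suc a" b ?I u] ab by auto
    define f2 where "f2 \<alpha> \<beta> = f1 \<alpha> \<beta> + pol_down k \<alpha> \<beta>" for \<alpha> \<beta>
    define v where "v = (\<lambda>(\<alpha>, \<beta>). of_nat (num_words \<alpha>) * of_nat (num_words \<beta>) * f2 \<alpha> \<beta>)"
    have bk: "bihom a (Suc b) ?I (pol_down k)" by (rule bihom_down[OF k(1)])
    have f2: "f2 \<alpha> \<beta> = 0" if "\<not> (\<alpha> \<in> monomials a ?I \<and> \<beta> \<in> monomials (Suc b) ?I)" for \<alpha> \<beta>
    proof -
      have "f1 \<alpha> \<beta> = 0" "pol_down k \<alpha> \<beta> = 0" using that f1 bk unfolding bihom_def by blast+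
      then show ?thesis by (simp add: f2_def)
    qed
    have Uv: "U v = f2"
      using f2 n0 by (intro ext) (auto simp: U_def unsym_def v_def)
    have "row_tensor a f2 = row_tensor a f1 + row_tensor a (pol_down k)"
      by (simp add: fun_eq_iff row_tensor_def f2_def)
    then have "Y v = S"
      by (simp add: Y_def Uv young_symmetrizer_add young_symmetrizer_pol_down[OF bk ab] S1)
    moreover have "?R S b = w (Inl b)" if "b \<in> B" for b
    proof -
      have "?R S b = (\<Sum>c\<in>B. w (Inl c) * ?R c b)"
        unfolding S_def by (simp add: fn.representation_sum[OF indB] fn.representation_scale[OF indB]
            fn.span_scale fn.span_base)
      also have "\<dots> = (\<Sum>c\<in>B. w (Inl c) * (if c = b then 1 else 0))"
        by (intro sum.cong refl) (simp add: fn.representation_basis[OF indB])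
      finally show ?thesis using that finB by (simp add: delta_mult)
    qed
    moreover have "E v (\<alpha>, \<beta>) = w (Inr (\<alpha>, \<beta>))" if "(\<alpha>, \<beta>) \<in> idx ?s" for \<alpha> \<beta>
    proof -
      have "pol_up f2 \<alpha> \<beta> = pol_up f1 \<alpha> \<beta> + pol_up (pol_down k) \<alpha> \<beta>"
        by (simp add: pol_up_def f2_def sum_mset.distrib)
      then show ?thesis using that n0[of \<alpha>] n0[of \<beta>] by (simp add: E_def Uv k(2) u_def)
    qed
    ultimately have "\<forall>j\<in>idx (schur ?lam r \<oplus>\<^sub>r ?s). f v j = w j"
      unfolding idxs by (auto simp: f_def simp del: idx_simps)
    moreover have "v \<in> supported_on (idx ?r)"
      using f2 by (auto simp: supported_on_def v_def)
    ultimately show "\<exists>v. v \<in> supported_on (idx ?r) \<and> (\<forall>j\<in>idx (schur ?lam r \<oplus>\<^sub>r ?s). f v j = w j)"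
      by blast
  qed
qed

section \<open>Characters of classes in the representation ring\<close>

lemma star_rep_tensor: "star_rep r \<Longrightarrow> star_rep s \<Longrightarrow> star_rep (r \<otimes>\<^sub>r s)"
  by (auto simp: star_rep_def)

lemma rep_ring_of_nat_rep: "rep_ring_of (nat_rep r) = rep_ring_of r"
  by (rule rep_ring_of_iso[OF nat_rep_iso])

lemma rtrace_nat_rep: "g \<in> SL3 \<Longrightarrow> rtrace (nat_rep r) g = rtrace r g"
  by (rule rtrace_iso[OF nat_rep_iso])

lemma rep_ring_of_zero: "rep_ring_of zero_rep = 0"
  using rep_ring_of_iso[OF dsum_zero[of zero_rep]] by (simp add: rep_ring_of_dsum)

text \<open>A relation instead of a character map on the whole ring: it covers the classes that are
  differences of unitary representations, for which traces determine the class. Schur functors enter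
  it through their Jacobi--Trudi differences.\<close>

definition has_char :: "rep_ring \<Rightarrow> (complex^3^3 \<Rightarrow> complex) \<Rightarrow> bool" where
  "has_char x \<phi> \<longleftrightarrow> (\<exists>(r :: nat rep) (s :: nat rep). star_rep r \<and> star_rep s \<and>
     x = rep_ring_of r - rep_ring_of s \<and> (\<forall>g\<in>SL3. \<phi> g = rtrace r g - rtrace s g))"

lemma has_char_0: "has_char 0 (\<lambda>_. 0)"
  unfolding has_char_def
  by (intro exI[of _ zero_rep]) (simp add: star_rep_def)

lemma has_char_rep_ring_of:
  assumes "wstar_rep r"
  shows "has_char (rep_ring_of r) (rtrace r)"
proof -
  obtain s :: "nat rep" where s: "star_rep s" "s \<cong>\<^sub>r r" using wstar_rep_imp_star_rep[OF assms] .
  then show ?thesis unfolding has_char_def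
    by (intro exI[of _ s] exI[of _ zero_rep])
      (simp add: rep_ring_of_zero rep_ring_of_iso star_rep_def[of zero_rep] rtrace_def[of zero_rep] rtrace_iso)
qed

lemma has_char_minus: assumes "has_char x \<phi>" "has_char y \<psi>" shows "has_char (x - y) (\<lambda>g. \<phi> g - \<psi> g)"
proof -
  obtain r s r' s' :: "nat rep" where rs: "star_rep r" "star_rep s" "x = rep_ring_of r - rep_ring_of s"
      "\<And>g. g \<in> SL3 \<Longrightarrow> \<phi> g = rtrace r g - rtrace s g"
    and rs': "star_rep r'" "star_rep s'" "y = rep_ring_of r' - rep_ring_of s'"
      "\<And>g. g \<in> SL3 \<Longrightarrow> \<psi> g = rtrace r' g - rtrace s' g"
    using assms unfolding has_char_def by metis
  then show ?thesis unfolding has_char_def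
    by (intro exI[of _ "nat_rep (r \<oplus>\<^sub>r s')"] exI[of _ "nat_rep (s \<oplus>\<^sub>r r')"])
      (simp add: rep_ring_of_nat_rep rep_ring_of_dsum rtrace_nat_rep rtrace_dsum
        star_rep_nat_rep star_rep_dsum)
qed

lemma has_char_add: assumes "has_char x \<phi>" "has_char y \<psi>" shows "has_char (x + y) (\<lambda>g. \<phi> g + \<psi> g)"
  using has_char_minus[OF assms(1) has_char_minus[OF has_char_0 assms(2)]] by simp

lemma has_char_mult: assumes "has_char x \<phi>" "has_char y \<psi>" shows "has_char (x * y) (\<lambda>g. \<phi> g * \<psi> g)"
proof -
  obtain r s r' s' :: "nat rep" where rs: "star_rep r" "star_rep s" "x = rep_ring_of r - rep_ring_of s"
      "\<And>g. g \<in> SL3 \<Longrightarrow> \<phi> g = rtrace r g - rtrace s g"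
    and rs': "star_rep r'" "star_rep s'" "y = rep_ring_of r' - rep_ring_of s'"
      "\<And>g. g \<in> SL3 \<Longrightarrow> \<psi> g = rtrace r' g - rtrace s' g"
    using assms unfolding has_char_def by metis
  let ?p = "nat_rep ((r \<otimes>\<^sub>r r') \<oplus>\<^sub>r (s \<otimes>\<^sub>r s'))" and ?q = "nat_rep ((r \<otimes>\<^sub>r s') \<oplus>\<^sub>r (s \<otimes>\<^sub>r r'))"
  have "star_rep ?p" "star_rep ?q"
    using rs rs' by (simp_all add: star_rep_nat_rep star_rep_dsum star_rep_tensor)
  moreover have "x * y = rep_ring_of ?p - rep_ring_of ?q"
    unfolding rs(3) rs'(3)
    by (simp add: rep_ring_of_nat_rep rep_ring_of_dsum rep_ring_of_tensor algebra_simps)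
  moreover have "\<phi> g * \<psi> g = rtrace ?p g - rtrace ?q g" if "g \<in> SL3" for g
    unfolding rs(4)[OF that] rs'(4)[OF that]
    by (simp add: that rtrace_nat_rep rtrace_dsum rtrace_tensor algebra_simps)
  ultimately show ?thesis unfolding has_char_def by blast
qed

lemma has_char_eq_0:
  assumes "has_char x \<phi>" "\<And>g. g \<in> SL3 \<Longrightarrow> \<phi> g = 0"
  shows "x = 0"
proof -
  obtain r s :: "nat rep" where "star_rep r" "star_rep s" "x = rep_ring_of r - rep_ring_of s"
    "\<forall>g\<in>SL3. \<phi> g = rtrace r g - rtrace s g"
    using assms(1) unfolding has_char_def by blast
  moreover from this assms(2) have "r \<cong>\<^sub>r s" by (intro rep_iso_of_rtrace_eq) auto
  ultimately show ?thesis by (simp add: rep_ring_of_iso)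
qed

definition sym_char :: "int \<Rightarrow> 'i rep \<Rightarrow> complex^3^3 \<Rightarrow> complex" where
  "sym_char m r g = (if m < 0 then 0 else rtrace (sym_pow (nat m) r) g)"

lemma has_char_Sym:
  assumes "wstar_rep r"
  shows "has_char (Sym m r) (sym_char m r)"
proof (cases "m < 0")
  case True
  then show ?thesis using has_char_0 by (simp add: Sym_def sym_char_def[abs_def])
next
  case False
  then show ?thesis
    using has_char_rep_ring_of[OF wstar_rep_sym_pow[OF assms]] by (simp add: Sym_def sym_char_def[abs_def])
qed

section \<open>Complete symmetric functions\<close>

lemma monomials_0: "monomials 0 I = {{#}}"
  by (auto simp: monomials_def)

lemma monomials_Suc_empty: "monomials (Suc m) {} = {}"
  by (auto simp: monomials_def)

lemma finite_monomials: "finite I \<Longrightarrow> finite (monomials m I)"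
  by (simp add: finite_words monomials_eq)

lemma monomials_Suc_insert:
  "monomials (Suc m) (insert x I) = monomials (Suc m) I \<union> add_mset x ` monomials m (insert x I)"
proof (intro equalityI subsetI)
  fix \<alpha> assume \<alpha>: "\<alpha> \<in> monomials (Suc m) (insert x I)"
  show "\<alpha> \<in> monomials (Suc m) I \<union> add_mset x ` monomials m (insert x I)"
  proof (cases "x \<in># \<alpha>")
    case True
    then obtain \<beta> where "\<alpha> = add_mset x \<beta>" by (metis insert_DiffM)
    then show ?thesis using \<alpha> by (auto simp: monomials_def)
  qed (use \<alpha> in \<open>auto simp: monomials_def\<close>)
qed (auto simp: monomials_def)

lemma monomials_disjoint: "x \<notin> I \<Longrightarrow> monomials (Suc m) I \<inter> add_mset x ` monomials m (insert x I) = {}"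
  by (auto simp: monomials_def)

lemma prod_monomials_Suc_insert:
  assumes "finite I" "x \<notin> I"
  shows "(\<Prod>\<alpha>\<in>monomials (Suc m) (insert x I). F \<alpha>) =
    (\<Prod>\<alpha>\<in>monomials (Suc m) I. F \<alpha>) * (\<Prod>\<alpha>\<in>monomials m (insert x I). F (add_mset x \<alpha>))"
  unfolding monomials_Suc_insert using assms
  by (subst prod.union_disjoint) (auto simp: finite_monomials monomials_disjoint prod.reindex inj_on_def)

lemma complete_sym_Suc_insert:
  assumes "finite I" "x \<notin> I"
  shows "complete_sym (insert x I) d (Suc m) = complete_sym I d (Suc m) + d x * complete_sym (insert x I) d m"
  unfolding complete_sym_def monomials_Suc_insert using assms
  by (subst sum.union_disjoint)
    (auto simp: finite_monomials monomials_disjoint sum.reindex sum_distrib_left inj_on_def)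

lemma complete_sym_0: "complete_sym I d 0 = 1"
  by (simp add: complete_sym_def monomials_0)

text \<open>Adjoining \<open>x\<close> divides the series by \<open>1 - d x X\<close>, because a
  monomial that contains \<open>x\<close> is \<open>x\<close> times an arbitrary monomial.\<close>

lemma complete_sym_gen_fun:
  assumes "finite I"
  shows "Abs_fps (complete_sym I d) * (\<Prod>i\<in>I. 1 - fps_const (d i) * fps_X) = 1"
  using assms
proof (induction I rule: finite_induct)
  case empty
  have "complete_sym {} d m = (if m = 0 then 1 else 0)" for m
    by (cases m) (simp_all add: complete_sym_0, simp add: complete_sym_def monomials_Suc_empty)
  then show ?case by (simp add: fps_eq_iff)
next
  case (insert x I)
  have "Abs_fps (complete_sym (insert x I) d) * (1 - fps_const (d x) * fps_X) = Abs_fps (complete_sym I d)"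
  proof (rule fps_ext)
    fix n
    have "fps_nth (Abs_fps (complete_sym (insert x I) d) * (1 - fps_const (d x) * fps_X)) n =
      complete_sym (insert x I) d n - d x * fps_nth (fps_X * Abs_fps (complete_sym (insert x I) d)) n"
      by (simp add: algebra_simps)
    also have "\<dots> = complete_sym I d n"
      using insert by (cases n) (simp_all add: complete_sym_0 complete_sym_Suc_insert)
    finally show "fps_nth (Abs_fps (complete_sym (insert x I) d) * (1 - fps_const (d x) * fps_X)) n =
        fps_nth (Abs_fps (complete_sym I d)) n" by simp
  qed
  then show ?case using insert by (simp flip: mult.assoc)
qed

text \<open>Grouped for \<open>veronese_gen_fun\<close>: the three cubes, the product of the
  variables, and the two cyclic orbits of the other six monomials.\<close>

lemma prod_monomials_3:
  "(\<Prod>\<alpha>\<in>monomials 3 (UNIV :: 3 set). F \<alpha>) =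
    F {#1,1,1#} * F {#2,2,2#} * F {#3,3,3#} * F {#1,2,3#} *
    (F {#1,1,2#} * F {#2,2,3#} * F {#1,3,3#}) * (F {#1,2,2#} * F {#2,3,3#} * F {#1,1,3#})"
  unfolding UNIV_3 numeral_3_eq_3
  by (simp add: prod_monomials_Suc_insert monomials_Suc_empty monomials_0 mult_ac
      add_mset_commute del: One_nat_def)

section \<open>The equivariant Hilbert series of the cubic Veronese ring\<close>

lemma prod_UNIV_3: "(\<Prod>i\<in>(UNIV :: 3 set). f i) = f 1 * f 2 * f 3"
  unfolding UNIV_3 by (simp add: mult_ac)

lemma prod_three_linear:
  fixes u v w X :: "'a :: comm_ring_1"
  shows "(1 - u * X) * (1 - v * X) * (1 - w * X) =
    1 - (u + v + w) * X + (u * v + u * w + v * w) * X ^ 2 - (u * v * w) * X ^ 3"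
  by (simp add: algebra_simps power2_eq_square power3_eq_cube)

text \<open>The generating series is the reciprocal of \<open>1 - e1 X + e2 X^2 - X^3\<close>, whose
  last coefficient uses that the product of the variables is 1.\<close>

lemma complete_sym_rec:
  fixes d :: "3 \<Rightarrow> complex"
  defines "c \<equiv> complete_sym UNIV d"
  defines "e1 \<equiv> d 1 + d 2 + d 3" and "e2 \<equiv> d 1 * d 2 + d 1 * d 3 + d 2 * d 3"
  assumes e3: "d 1 * d 2 * d 3 = 1"
  shows "c 0 = 1" "c (Suc 0) = e1" "c (Suc (Suc 0)) = e1\<^sup>2 - e2"
    "c (Suc (Suc (Suc m))) = e1 * c (Suc (Suc m)) - e2 * c (Suc m) + c m"
proof -
  let ?C = "Abs_fps c"
  have "?C * ((1 - fps_const (d 1) * fps_X) * (1 - fps_const (d 2) * fps_X) * (1 - fps_const (d 3) * fps_X)) = 1"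
    using complete_sym_gen_fun[of "UNIV :: 3 set" d] unfolding prod_UNIV_3 c_def by simp
  moreover have "(1 - fps_const (d 1) * fps_X) * (1 - fps_const (d 2) * fps_X) * (1 - fps_const (d 3) * fps_X) =
      1 - fps_const e1 * fps_X + fps_const e2 * fps_X ^ 2 - fps_const (d 1 * d 2 * d 3) * fps_X ^ 3"
    unfolding e1_def e2_def prod_three_linear fps_const_add[symmetric] fps_const_mult[symmetric] ..
  ultimately have "?C * (1 - fps_const e1 * fps_X + fps_const e2 * fps_X ^ 2 - fps_X ^ 3) = 1"
    by (simp add: e3)
  then have *: "?C - fps_const e1 * (fps_X * ?C) + fps_const e2 * (fps_X ^ 2 * ?C) - fps_X ^ 3 * ?C = 1"
    by (simp add: algebra_simps)
  have n: "c n - e1 * (if n = 0 then 0 else c (n - 1)) + e2 * (if n < 2 then 0 else c (n - 2)) -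
      (if n < 3 then 0 else c (n - 3)) = (if n = 0 then 1 else 0)" for n
    using arg_cong[OF *, of "\<lambda>f. fps_nth f n"] by (simp add: fps_X_power_mult_nth cong: if_cong)
  show 0: "c 0 = 1" using n[of 0] by simp
  show 1: "c (Suc 0) = e1" using n[of 1] 0 by simp
  show "c (Suc (Suc 0)) = e1\<^sup>2 - e2" using n[of 2] 0 1 by (simp add: numeral_2_eq_2 algebra_simps)
  show "c (Suc (Suc (Suc m))) = e1 * c (Suc (Suc m)) - e2 * c (Suc m) + c m"
    using n[of "Suc (Suc (Suc m))"] by (simp add: algebra_simps)
qed

text \<open>The six monomials of degree 3 in exactly two of the variables are, modulo \<open>d 1 * d 2 * d 3 = 1\<close>,
  the roots; they form two triples with product 1 whose sums are \<open>s\<close> and \<open>s'\<close>, and \<open>s'\<close> and \<open>s\<close>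
  are also the second elementary symmetric functions of these triples.\<close>

lemma veronese_gen_fun:
  fixes d :: "3 \<Rightarrow> complex"
  defines "c \<equiv> complete_sym UNIV d"
  defines "h \<equiv> complete_sym (monomials 3 UNIV) (\<lambda>\<alpha>. \<Prod>i\<in>#\<alpha>. d i)"
  defines "s \<equiv> d 1 * d 1 * d 2 + d 2 * d 2 * d 3 + d 1 * d 3 * d 3"
  defines "s' \<equiv> d 1 * d 2 * d 2 + d 2 * d 3 * d 3 + d 1 * d 1 * d 3"
  assumes e3: "d 1 * d 2 * d 3 = 1"
  shows "Abs_fps (\<lambda>n. c (3 * n)) = Abs_fps h * ((1 - fps_X) *
    (1 + fps_const (1 + s + s') * fps_X + fps_X ^ 2) *
    (1 - fps_const s * fps_X + fps_const s' * fps_X ^ 2 - fps_X ^ 3) *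
    (1 - fps_const s' * fps_X + fps_const s * fps_X ^ 2 - fps_X ^ 3))"
proof -
  define x y z where "x = d 1" and "y = d 2" and "z = d 3"
  define e1 where "e1 = x + y + z"
  define e2 where "e2 = x * y + x * z + y * z"
  have xyz: "x * y * z = 1" using e3 by (simp add: x_def y_def z_def)
  note c = complete_sym_rec[OF e3, folded c_def x_def y_def z_def, folded e1_def e2_def]
  \<comment> \<open>Modulo \<open>x * y * z = 1\<close>, \<open>p1\<close> and \<open>p2\<close> are
    the first two elementary symmetric functions of the cubes \<open>x^3\<close>,
    \<open>y^3\<close>, \<open>z^3\<close>, the characteristic roots of the recursion for every
    third complete symmetric function.\<close>
  define p1 where "p1 = e1 ^ 3 - 3 * e1 * e2 + 3"
  define p2 where "p2 = e2 ^ 3 - 3 * e1 * e2 + 3"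
  have ss: "s + s' = e1 * e2 - 3"
    using xyz unfolding s_def s'_def e1_def e2_def x_def y_def z_def by algebra
  let ?D = "Abs_fps (\<lambda>n. c (3 * n))"
  have Dc': "c (Suc (Suc (Suc (Suc (Suc (Suc (Suc (Suc (Suc m))))))))) =
      p1 * c (Suc (Suc (Suc (Suc (Suc (Suc m)))))) - p2 * c (Suc (Suc (Suc m))) + c m" for m
    unfolding c(4) p1_def p2_def by algebra
  then have Dc: "c (m + 9) = p1 * c (m + 6) - p2 * c (m + 3) + c m" for m
    by (simp add: eval_nat_numeral)
  have c3: "c 3 = p1 + (1 + s + s')"
    unfolding numeral_3_eq_3 c p1_def ss add.assoc by (simp add: c ss) algebra
  have c6: "c 6 = p1 * c 3 - p2 + 1"
    unfolding c3 by (simp add: eval_nat_numeral c p1_def p2_def add.assoc ss) algebra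
  \<comment> \<open>The numerator sums the monomials of degree divisible by 3 whose exponents are
    all at most 2: the constant 1, the seven noncubes of degree 3, and \<open>(x * y * z)^2\<close>,
    which is 1.\<close>
  have D: "?D * (1 - fps_const p1 * fps_X + fps_const p2 * fps_X ^ 2 - fps_X ^ 3) =
      1 + fps_const (1 + s + s') * fps_X + fps_X ^ 2"
  proof (rule fps_ext)
    fix n
    have "?D * (1 - fps_const p1 * fps_X + fps_const p2 * fps_X ^ 2 - fps_X ^ 3) =
        ?D - fps_const p1 * (fps_X * ?D) + fps_const p2 * (fps_X ^ 2 * ?D) - fps_X ^ 3 * ?D"
      by (simp add: algebra_simps)
    then have "fps_nth (?D * (1 - fps_const p1 * fps_X + fps_const p2 * fps_X ^ 2 - fps_X ^ 3)) n =
       c (3 * n) - p1 * (if n = 0 then 0 else c (3 * (n - 1))) + p2 * (if n < 2 then 0 else c (3 * (n - 2))) -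
       (if n < 3 then 0 else c (3 * (n - 3)))"
      by (simp add: fps_X_power_mult_nth cong: if_cong)
    also have "\<dots> = fps_nth (1 + fps_const (1 + s + s') * fps_X + fps_X ^ 2) n"
    proof -
      consider "n = 0" | "n = 1" | "n = 2" | m where "n = Suc (Suc (Suc m))"
        by (metis One_nat_def Suc_1 not0_implies_Suc)
      then show ?thesis
      proof cases
        case 4
        have "c (3 * n) = p1 * c (3 * Suc (Suc m)) - p2 * c (3 * Suc m) + c (3 * m)"
          using Dc[of "3 * m"] by (simp add: 4 add.commute[of _ "3 * m"])
        then show ?thesis by (simp add: 4 fps_X_power_nth fps_X_nth)
      qed (simp_all add: c(1) c3 c6 fps_X_power_nth fps_X_nth)
    qed
    finally show "fps_nth (?D * (1 - fps_const p1 * fps_X + fps_const p2 * fps_X ^ 2 - fps_X ^ 3)) n =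
       fps_nth (1 + fps_const (1 + s + s') * fps_X + fps_X ^ 2) n" .
  qed
  have triple: "(1 - fps_const u * fps_X) * (1 - fps_const v * fps_X) * (1 - fps_const w * fps_X)
      = 1 - fps_const (u + v + w) * fps_X + fps_const (u * v + u * w + v * w) * fps_X ^ 2 - fps_const (u * v * w) * fps_X ^ 3"
    for u v w :: complex
    unfolding prod_three_linear fps_const_add[symmetric] fps_const_mult[symmetric] ..
  have cubes: "(1 - fps_const (x * x * x) * fps_X) * (1 - fps_const (y * y * y) * fps_X) * (1 - fps_const (z * z * z) * fps_X)
      = 1 - fps_const p1 * fps_X + fps_const p2 * fps_X ^ 2 - fps_X ^ 3"
  proof -
    have "x*x*x + y*y*y + z*z*z = p1" "x*x*x*(y*y*y) + x*x*x*(z*z*z) + y*y*y*(z*z*z) = p2" "x*x*x*(y*y*y)*(z*z*z) = 1"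
      using xyz unfolding p1_def p2_def e1_def e2_def by algebra+
    then show ?thesis unfolding triple by simp
  qed
  have s: "s = x * x * y + y * y * z + x * z * z" "s' = x * y * y + y * z * z + x * x * z"
    by (simp_all add: s_def s'_def x_def y_def z_def)
  have A: "(1 - fps_const (x * x * y) * fps_X) * (1 - fps_const (y * y * z) * fps_X) * (1 - fps_const (x * z * z) * fps_X)
      = 1 - fps_const s * fps_X + fps_const s' * fps_X ^ 2 - fps_X ^ 3"
  proof -
    have "x*x*y*(y*y*z) + x*x*y*(x*z*z) + y*y*z*(x*z*z) = s'" "x*x*y*(y*y*z)*(x*z*z) = 1"
      using xyz unfolding s by algebra+
    then show ?thesis unfolding triple by (simp add: s(1))
  qed
  have A': "(1 - fps_const (x * y * y) * fps_X) * (1 - fps_const (y * z * z) * fps_X) * (1 - fps_const (x * x * z) * fps_X)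
      = 1 - fps_const s' * fps_X + fps_const s * fps_X ^ 2 - fps_X ^ 3"
  proof -
    have "x*y*y*(y*z*z) + x*y*y*(x*x*z) + y*z*z*(x*x*z) = s" "x*y*y*(y*z*z)*(x*x*z) = 1"
      using xyz unfolding s by algebra+
    then show ?thesis unfolding triple by (simp add: s(2))
  qed
  let ?P = "1 - fps_const p1 * fps_X + fps_const p2 * fps_X ^ 2 - fps_X ^ 3"
  let ?A = "1 - fps_const s * fps_X + fps_const s' * fps_X ^ 2 - fps_X ^ 3"
  let ?A' = "1 - fps_const s' * fps_X + fps_const s * fps_X ^ 2 - fps_X ^ 3"
  have "Abs_fps h * (\<Prod>\<alpha>\<in>monomials 3 UNIV. 1 - fps_const (\<Prod>i\<in>#\<alpha>. d i) * fps_X) = 1"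
    unfolding h_def by (rule complete_sym_gen_fun) (simp add: finite_monomials)
  also have "(\<Prod>\<alpha>\<in>monomials 3 (UNIV :: 3 set). 1 - fps_const (\<Prod>i\<in>#\<alpha>. d i) * fps_X) =
      ((1 - fps_const (x * x * x) * fps_X) * (1 - fps_const (y * y * y) * fps_X) * (1 - fps_const (z * z * z) * fps_X))
      * (1 - fps_const (x * y * z) * fps_X) *
      ((1 - fps_const (x * x * y) * fps_X) * (1 - fps_const (y * y * z) * fps_X) * (1 - fps_const (x * z * z) * fps_X)) *
      ((1 - fps_const (x * y * y) * fps_X) * (1 - fps_const (y * z * z) * fps_X) * (1 - fps_const (x * x * z) * fps_X))"
    unfolding prod_monomials_3 by (simp add: x_def y_def z_def mult_ac)
  also have "\<dots> = ?P * (1 - fps_X) * ?A * ?A'"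
    unfolding cubes A A' xyz by simp
  finally have H: "Abs_fps h * (?P * (1 - fps_X) * ?A * ?A') = 1" .
  \<comment> \<open>Of the ten factors, the three in \<open>?P\<close> turn \<open>?D\<close> into
    its numerator; the other seven remain.\<close>
  have "?D = ?D * (Abs_fps h * (?P * (1 - fps_X) * ?A * ?A'))" by (simp add: H)
  also have "\<dots> = Abs_fps h * ((1 - fps_X) * (?D * ?P) * ?A * ?A')" by (simp only: mult_ac)
  finally show ?thesis unfolding D .
qed

text \<open>The product is unchanged when \<open>S\<close> and \<open>S'\<close> are exchanged, so
  it can be written in their sum and product. The terms of degree 1 and 8 cancel, and the
  coefficients of \<open>X ^ i\<close> and \<open>X ^ (9 - i)\<close> are opposite.\<close>

lemma veronese_numerator:
  fixes S S' X :: "'a :: comm_ring_1"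
  defines "p \<equiv> S + S'" and "q \<equiv> S * S'"
  shows "(1 - X) * (1 + (1 + S + S') * X + X ^ 2) * (1 - S * X + S' * X ^ 2 - X ^ 3) * (1 - S' * X + S * X ^ 2 - X ^ 3)
    = 1 - (p\<^sup>2 - q) * X ^ 2 + (p\<^sup>2 + p * q + 2 * q - 3) * X ^ 3 - (p ^ 3 + p\<^sup>2 - p * q - q) * X ^ 4
      + (p ^ 3 + p\<^sup>2 - p * q - q) * X ^ 5 - (p\<^sup>2 + p * q + 2 * q - 3) * X ^ 6 + (p\<^sup>2 - q) * X ^ 7 - X ^ 9"
  unfolding p_def q_def by (simp add: algebra_simps eval_nat_numeral)

text \<open>\<open>schur2 a b\<close> is the character of the partition with rows \<open>a\<close>
  and \<open>Suc b\<close>. Once \<open>d 1 * d 2 * d 3 = 1\<close>, both \<open>k2\<close>,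
  \<open>k3\<close>, \<open>k4\<close> and the coefficients of \<open>veronese_numerator\<close> are
  polynomials in \<open>e1\<close> and \<open>e2\<close>; their agreement identifies the numerator
  with the representations of the statement.\<close>

lemma veronese_recursion:
  fixes d :: "3 \<Rightarrow> complex" and n :: nat
  defines "c \<equiv> complete_sym UNIV d"
  defines "h \<equiv> complete_sym (monomials 3 UNIV) (\<lambda>\<alpha>. \<Prod>i\<in>#\<alpha>. d i)"
  defines "schur2 \<equiv> \<lambda>a b. c a * c (Suc b) - c (Suc a) * c b"
  defines "k2 \<equiv> schur2 4 1"
  defines "k3 \<equiv> schur2 5 3 + schur2 5 0 + schur2 4 1 + schur2 2 0"
  defines "k4 \<equiv> schur2 6 2 + schur2 5 3 + schur2 5 0 + schur2 4 1 + schur2 3 2 + c 3 + schur2 2 0"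
  defines "H \<equiv> \<lambda>j. if n < j then 0 else h (n - j)"
  assumes e3: "d 1 * d 2 * d 3 = 1"
  shows "c (3 * n) = h n - k2 * H 2 + k3 * H 3 - k4 * H 4 + k4 * H 5 - k3 * H 6 + k2 * H 7 - H 9"
proof -
  define e1 where "e1 = d 1 + d 2 + d 3"
  define e2 where "e2 = d 1 * d 2 + d 1 * d 3 + d 2 * d 3"
  define s where "s = d 1 * d 1 * d 2 + d 2 * d 2 * d 3 + d 1 * d 3 * d 3"
  define s' where "s' = d 1 * d 2 * d 2 + d 2 * d 3 * d 3 + d 1 * d 1 * d 3"
  define p where "p = s + s'"
  define q where "q = s * s'"
  have p: "p = e1 * e2 - 3"
    using e3 unfolding p_def s_def s'_def e1_def e2_def by algebra
  have q: "q = e1 ^ 3 + e2 ^ 3 - 6 * e1 * e2 + 9"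
    using e3 unfolding q_def s_def s'_def e1_def e2_def by algebra
  note c = complete_sym_rec[OF e3, folded c_def, folded e1_def e2_def]
  \<comment> \<open>Unfolding these recursions reduces the three coefficient identities to
    polynomial algebra in \<open>e1\<close> and \<open>e2\<close>.\<close>
  have c': "c 1 = e1" "c 2 = e1\<^sup>2 - e2" "c 3 = e1 * c 2 - e2 * c 1 + 1" "c 4 = e1 * c 3 - e2 * c 2 + c 1"
    "c 5 = e1 * c 4 - e2 * c 3 + c 2" "c 6 = e1 * c 5 - e2 * c 4 + c 3" "c 7 = e1 * c 6 - e2 * c 5 + c 4"
    by (simp_all add: eval_nat_numeral c)
  have sch: "schur2 4 1 = c 4 * c 2 - c 5 * c 1" "schur2 5 3 = c 5 * c 4 - c 6 * c 3"
    "schur2 5 0 = c 5 * c 1 - c 6" "schur2 2 0 = c 2 * c 1 - c 3" "schur2 6 2 = c 6 * c 3 - c 7 * c 2"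
    "schur2 3 2 = c 3 * c 3 - c 4 * c 2"
    by (simp_all add: schur2_def c(1) eval_nat_numeral)
  have k2: "k2 = p\<^sup>2 - q"
    unfolding k2_def sch p q c' by algebra
  have k3: "k3 = p\<^sup>2 + p * q + 2 * q - 3"
    unfolding k3_def sch p q c' by algebra
  have k4: "k4 = p ^ 3 + p\<^sup>2 - p * q - q"
    unfolding k4_def sch p q c' by algebra
  let ?h = "Abs_fps h"
  have "Abs_fps (\<lambda>n. c (3 * n)) = ?h * (1 - fps_const k2 * fps_X ^ 2 + fps_const k3 * fps_X ^ 3
      - fps_const k4 * fps_X ^ 4 + fps_const k4 * fps_X ^ 5 - fps_const k3 * fps_X ^ 6
      + fps_const k2 * fps_X ^ 7 - fps_X ^ 9)"
  proof -
    have "Abs_fps (\<lambda>n. c (3 * n)) = ?h * ((1 - fps_X) * (1 + (1 + fps_const s + fps_const s') * fps_X + fps_X ^ 2) *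
      (1 - fps_const s * fps_X + fps_const s' * fps_X ^ 2 - fps_X ^ 3) *
      (1 - fps_const s' * fps_X + fps_const s * fps_X ^ 2 - fps_X ^ 3))"
      using veronese_gen_fun[OF e3, folded c_def h_def s_def s'_def]
      by (simp flip: fps_const_add)
    also have "\<dots> = ?h * (1 - fps_const k2 * fps_X ^ 2 + fps_const k3 * fps_X ^ 3
      - fps_const k4 * fps_X ^ 4 + fps_const k4 * fps_X ^ 5 - fps_const k3 * fps_X ^ 6
      + fps_const k2 * fps_X ^ 7 - fps_X ^ 9)"
      unfolding veronese_numerator k2 k3 k4 p_def q_def
      by (simp add: fps_const_power flip: fps_const_add fps_const_mult fps_const_sub fps_const_power fps_numeral_fps_const)
    finally show ?thesis .
  qed
  also have "\<dots> = ?h - fps_const k2 * (fps_X ^ 2 * ?h) + fps_const k3 * (fps_X ^ 3 * ?h)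
      - fps_const k4 * (fps_X ^ 4 * ?h) + fps_const k4 * (fps_X ^ 5 * ?h) - fps_const k3 * (fps_X ^ 6 * ?h)
      + fps_const k2 * (fps_X ^ 7 * ?h) - fps_X ^ 9 * ?h"
    by (simp add: algebra_simps)
  finally have *: "Abs_fps (\<lambda>n. c (3 * n)) = \<dots>" .
  show ?thesis
    using arg_cong[OF *, of "\<lambda>f. fps_nth f n"] by (simp add: fps_X_power_mult_nth H_def cong: if_cong)
qed

section \<open>The decomposition of \<open>S\<^sup>t(S\<^sup>3)\<close>\<close>

lemma Schur_two_rows:
  assumes "Suc b \<le> a"
  shows "Schur [a, Suc b] r =
    Sym (int a) r * Sym (int (Suc b)) r - Sym (int (Suc a)) r * Sym (int b) r"
  using rep_ring_of_iso[OF jacobi_trudi_two_rows[OF assms, of r]]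
  by (simp add: rep_ring_of_tensor rep_ring_of_dsum Schur_def Sym_def nat_add_distrib)

definition std_char :: "nat \<Rightarrow> complex^3^3 \<Rightarrow> complex" where
  "std_char m g = rtrace (sym_pow m std_rep) g"

text \<open>The second row has length \<open>Suc b\<close>: \<open>schur_char 4 1\<close> belongs to
  the partition (4,2).\<close>

definition schur_char :: "nat \<Rightarrow> nat \<Rightarrow> complex^3^3 \<Rightarrow> complex" where
  "schur_char a b g = std_char a g * std_char (Suc b) g - std_char (Suc a) g * std_char b g"

lemma has_char_Sym_std: "has_char (Sym (int m) std_rep) (std_char m)"
  using has_char_Sym[OF wstar_std_rep, of "int m"] by (simp add: sym_char_def[abs_def] std_char_def[abs_def])

lemma has_char_Schur_std:
  assumes "Suc b \<le> a"
  shows "has_char (Schur [a, Suc b] std_rep) (schur_char a b)"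
  unfolding Schur_two_rows[OF assms] schur_char_def[abs_def]
  by (intro has_char_minus has_char_mult has_char_Sym_std)

text \<open>Traces are invariant under conjugation, so \<open>g\<close> may be taken triangular. Its
  symmetric cube is then triangular as well, with the ten cubic monomials of the diagonal entries
  \<open>d i\<close> on its diagonal, so both families of traces are complete symmetric functions,
  and determinant 1 is the relation required by \<open>veronese_recursion\<close>.\<close>

lemma sym_char_recursion:
  assumes g: "g \<in> SL3" and t: "t \<ge> 0"
  defines "H \<equiv> \<lambda>j. sym_char (t - j) (sym_pow 3 std_rep) g"
    and "c \<equiv> \<lambda>m. std_char m g" and "S \<equiv> \<lambda>a b. schur_char a b g"
  shows "H 0 = sym_char (3 * t) std_rep g + S 4 1 * (H 2 - H 7)
    - (S 5 3 + S 5 0 + S 4 1 + S 2 0) * (H 3 - H 6)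
    + (S 6 2 + S 5 3 + S 5 0 + S 4 1 + S 3 2 + c 3 + S 2 0) * (H 4 - H 5) + H 9"
proof -
  obtain h where gh: "SL3_conj g h" and h: "h $ 2 $ 1 = 0" "h $ 3 $ 1 = 0" "h $ 3 $ 2 = 0"
    by (rule exists_conj_upper_triangular)
  \<comment> \<open>Written out by cases because 3 equals 0 in the index type, whose own order would
    put it before 1.\<close>
  define \<rho> :: "3 \<Rightarrow> nat" where "\<rho> i = (if i = 1 then 0 else if i = 2 then 1 else 2)" for i
  have tri: "i = j \<or> \<rho> i < \<rho> j" if "mtx std_rep h i j \<noteq> 0" for i j
    using that h exhaust_3[of i] exhaust_3[of j] by (auto simp: \<rho>_def)
  define d where "d i = h $ i $ i" for i
  have "det h = d 1 * d 2 * d 3" by (simp add: det_3 h d_def)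
  then have d1: "d 1 * d 2 * d 3 = 1" using SL3_conj_in[OF gh g] by (simp add: SL3_def)
  have std: "std_char m g = complete_sym UNIV d m" for m
    using rtrace_sym_pow_triangular[of std_rep h \<rho> m, OF tri]
    by (simp add: std_char_def d_def[abs_def] flip: rtrace_conj[OF gh g])
  have tri3: "\<alpha> = \<beta> \<or> (\<Sum>i\<in>#\<alpha>. \<rho> i) < (\<Sum>i\<in>#\<beta>. \<rho> i)"
    if "\<alpha> \<in> idx (sym_pow 3 std_rep)" "\<beta> \<in> idx (sym_pow 3 std_rep)" "mtx (sym_pow 3 std_rep) h \<alpha> \<beta> \<noteq> 0" for \<alpha> \<beta>
    using that unfolding mtx_sym_pow idx_sym_pow
    by (intro sym_entry_triangular(1)[where K = "mtx std_rep h" and I = "idx std_rep"] tri)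
  have diag: "mtx (sym_pow 3 std_rep) h \<alpha> \<alpha> = (\<Prod>i\<in>#\<alpha>. d i)" if "\<alpha> \<in> monomials 3 UNIV" for \<alpha>
    unfolding mtx_sym_pow using sym_entry_triangular(2)[where K = "mtx std_rep h" and I = UNIV, OF tri that that]
    by (simp add: d_def)
  define hh where "hh = complete_sym (monomials 3 UNIV) (\<lambda>\<alpha>. \<Prod>i\<in>#\<alpha>. d i)"
  have "rtrace (sym_pow n (sym_pow 3 std_rep)) g = hh n" for n
  proof -
    have "rtrace (sym_pow n (sym_pow 3 std_rep)) g = rtrace (sym_pow n (sym_pow 3 std_rep)) h"
      by (simp add: rtrace_conj[OF gh g])
    also have "\<dots> = complete_sym (monomials 3 UNIV) (\<lambda>\<alpha>. mtx (sym_pow 3 std_rep) h \<alpha> \<alpha>) n"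
      using rtrace_sym_pow_triangular[of "sym_pow 3 std_rep" h _ n, OF tri3] by simp
    also have "\<dots> = hh n"
      unfolding hh_def complete_sym_def
    proof (intro sum.cong refl arg_cong[where f = prod_mset] image_mset_cong diag)
      fix \<gamma> :: "3 multiset multiset" and \<alpha> assume "\<gamma> \<in> monomials n (monomials 3 UNIV)" "\<alpha> \<in># \<gamma>"
      then show "\<alpha> \<in> monomials 3 UNIV" by (auto simp: monomials_def)
    qed
    finally show ?thesis .
  qed
  \<comment> \<open>Negative degrees vanish by the convention of \<open>sym_char\<close>, which
    matches the truncation in \<open>veronese_recursion\<close>.\<close>
  then have H: "H (int j) = (if nat t < j then 0 else hh (nat t - j))" for j
    using t by (auto simp: H_def sym_char_def nat_diff_distrib)
  have H': "H 0 = hh (nat t)" using H[of 0] by simp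
  have c3: "sym_char (3 * t) std_rep g = complete_sym UNIV d (3 * nat t)"
    using t std[of "3 * nat t"] by (simp add: sym_char_def std_char_def nat_mult_distrib)
  have "complete_sym UNIV d (3 * nat t) = H 0 - S 4 1 * H 2
    + (S 5 3 + S 5 0 + S 4 1 + S 2 0) * H 3
    - (S 6 2 + S 5 3 + S 5 0 + S 4 1 + S 3 2 + c 3 + S 2 0) * H 4
    + (S 6 2 + S 5 3 + S 5 0 + S 4 1 + S 3 2 + c 3 + S 2 0) * H 5
    - (S 5 3 + S 5 0 + S 4 1 + S 2 0) * H 6 + S 4 1 * H 7 - H 9"
    using veronese_recursion[OF d1, of "nat t", folded hh_def]
    unfolding S_def c_def schur_char_def std H' using H[of 2] H[of 3] H[of 4] H[of 5] H[of 6] H[of 7] H[of 9]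
    by simp
  then show ?thesis unfolding c3 by (simp add: algebra_simps)
qed

theorem mainTheorem7:
  fixes t :: int
  assumes "t \<ge> 2"
  shows "Sym t (sym_pow 3 std_rep) =
    Sym (3 * t) std_rep
    + Schur [4, 2] std_rep
      * (Sym (t - 2) (sym_pow 3 std_rep) - Sym (t - 7) (sym_pow 3 std_rep))
    - (Schur [5, 4] std_rep + Schur [5, 1] std_rep + Schur [4, 2] std_rep + Schur [2, 1] std_rep)
      * (Sym (t - 3) (sym_pow 3 std_rep) - Sym (t - 6) (sym_pow 3 std_rep))
    + (Schur [6, 3] std_rep + Schur [5, 4] std_rep + Schur [5, 1] std_rep + Schur [4, 2] std_rep
        + Schur [3, 3] std_rep + Sym 3 std_rep + Schur [2, 1] std_rep)
      * (Sym (t - 4) (sym_pow 3 std_rep) - Sym (t - 5) (sym_pow 3 std_rep))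
    + Sym (t - 9) (sym_pow 3 std_rep)" (is "?lhs = ?rhs")
proof -
  have Sc: "has_char (Schur [4, 2] std_rep) (schur_char 4 1)" "has_char (Schur [5, 4] std_rep) (schur_char 5 3)"
    "has_char (Schur [5, 1] std_rep) (schur_char 5 0)" "has_char (Schur [2, 1] std_rep) (schur_char 2 0)"
    "has_char (Schur [6, 3] std_rep) (schur_char 6 2)" "has_char (Schur [3, 3] std_rep) (schur_char 3 2)"
    using has_char_Schur_std[of 1 4] has_char_Schur_std[of 3 5] has_char_Schur_std[of 0 5]
      has_char_Schur_std[of 0 2] has_char_Schur_std[of 2 6] has_char_Schur_std[of 2 3]
    by (simp_all add: eval_nat_numeral)
  have S3: "has_char (Sym 3 std_rep) (std_char 3)" using has_char_Sym_std[of 3] by simp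
  note intros = has_char_minus has_char_add has_char_mult Sc S3
    has_char_Sym[OF wstar_std_rep] has_char_Sym[OF wstar_rep_sym_pow[OF wstar_std_rep]]
  \<comment> \<open>The \<open>has_char\<close> rules follow the shape of the difference of the two
    sides and assemble its character along the way; that character vanishes by
    \<open>sym_char_recursion\<close>.\<close>
  have "?lhs - ?rhs = 0"
    by (rule has_char_eq_0, (rule intros)+) (use sym_char_recursion[of _ t] assms in simp)
  then show ?thesis by simp
qed

end
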